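(* Let $G$ be an $E$-group that can be generated by three elements. Then $G$ is abelian.
   Context: A group $G$ (finite or infinite) is called an $E$-group if every element commutes with all of its endomorphic images, i.e. $g\,\alpha(g)=\alpha(g)\,g$ for every $g\in G$ and every endomorphism $\alpha$ of $G$. *)

theory Defs
  imports "HOL-Algebra.Generated_Groups"
begin

locale E_group = group +
  assumes endo_image_commute:
    "\<lbrakk>\<alpha> \<in> hom G G; g \<in> carrier G\<rbrakk> \<Longrightarrow> g \<otimes> \<alpha> g = \<alpha> g \<otimes> g"

end

theory Submission
  imports Defs "HOL-Algebra.Multiplicative_Group" "HOL-Number_Theory.Cong"
begin

text \<open>
  Every element commutes with its conjugates, so \<open>G\<close> is a 2-Engel group: triple commutators are
  alternating, central and of exponent 3. Let \<open>d\<close> be the exponent of the abelianization (0 if infinite).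
  A functional from the abelianization onto the integers modulo \<open>d\<close>, followed by powers of an element
  \<open>g\<close> with \<open>g\<^sup>d = 1\<close>, is an endomorphism, and it forces \<open>g\<close> to be central. Hence \<open>G\<close> is abelian if the
  abelianization is infinite; otherwise \<open>G\<close> has finite exponent and one can pass to its \<open>p\<close>-components.
  For three generators the alternating form \<open>[x, y]\<^sup>d\<close> is degenerate, which reduces the class to 2.

  In a nonabelian \<open>p\<close>-group of class 2 the map \<open>x \<mapsto> x\<^sup>d\<close> has central kernel. If \<open>d \<noteq> 2\<close>, comparing its image
  with the derived subgroup shows that the abelianization and the derived subgroup are both free of
  rank 3 modulo \<open>d\<close> and modulo some \<open>e\<close> dividing \<open>d\<close>, and that the \<open>d\<close>-th power map is given by a matrix \<open>M\<close>
  invertible modulo \<open>p\<close>. Endomorphisms correspond to matrices \<open>A\<close> with \<open>A M = M cof(A)\<close>,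
  essentially the isometries of the bilinear form \<open>M\<close>, and commuting with one's images means that
  \<open>A\<close> is scalar modulo \<open>e\<close>. A three-dimensional form always has a nonscalar isometry: \<open>M M\<^sup>-\<^sup>T\<close> if \<open>M\<close> is
  not symmetric, and a negated reflection or a transvection otherwise. When \<open>d = 2\<close> the power map is a
  quadratic map over the field with two elements, which leaves finitely many cases.
\<close>

section \<open>Commutators in 2-Engel groups\<close>

text \<open>Rank 3 enters twice. An alternating form on three generators has a radical, which
  removes class 3; and the exterior square of a module of rank 3 has rank 3 again, with the cross
  product as commutator map. So the power map has a square matrix, and as cof(A) = det(A) A^(-T) for
  invertible A, the condition A M = M cof(A) becomes A M A^T = det(A) M. An element commutes with
  its image when their cross product vanishes, hence the scalar matrices.

  Endomorphisms need not extend from a subgroup or lift from a quotient, so the E-property is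
  carried only to retracts and all test maps must be endomorphisms of the whole group. Freeness
  modulo d and e serves this: only the power relations remain to be checked. The isometries must
  then hold modulo the full prime power e, not just modulo p.

  The prime 2 is the obstacle: (x y)^d contains [y, x] to the power d(d-1)/2, which e need not
  divide. For d > 2 this coefficient is still a multiple of e/2, and for e > 2 maps congruent to 1
  modulo e/2 do not see it; for d = 2 it is odd and the power map is truly quadratic.\<close>

context group
begin

definition cm :: "'a \<Rightarrow> 'a \<Rightarrow> 'a" where
  "cm x y = x \<otimes> y \<otimes> inv x \<otimes> inv y"

definition central :: "'a \<Rightarrow> bool" where
  "central z \<longleftrightarrow> z \<in> carrier G \<and> (\<forall>g\<in>carrier G. z \<otimes> g = g \<otimes> z)"

lemma inv_cancel [simp]:
  assumes "x \<in> carrier G" "y \<in> carrier G"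
  shows "x \<otimes> (inv x \<otimes> y) = y" "inv x \<otimes> (x \<otimes> y) = y"
  using assms by (simp_all add: m_assoc[symmetric])

lemma cm_closed [simp, intro]: "\<lbrakk>x \<in> carrier G; y \<in> carrier G\<rbrakk> \<Longrightarrow> cm x y \<in> carrier G"
  by (simp add: cm_def)

lemma cm_swap: "\<lbrakk>x \<in> carrier G; y \<in> carrier G\<rbrakk> \<Longrightarrow> x \<otimes> y = cm x y \<otimes> (y \<otimes> x)"
  by (simp add: cm_def m_assoc)

lemma cm_eq_one_iff:
  "\<lbrakk>x \<in> carrier G; y \<in> carrier G\<rbrakk> \<Longrightarrow> cm x y = \<one> \<longleftrightarrow> x \<otimes> y = y \<otimes> x"
  by (metis cm_closed cm_swap l_one m_closed r_cancel_one')

lemma cm_self [simp]: "x \<in> carrier G \<Longrightarrow> cm x x = \<one>"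
  by (simp add: cm_eq_one_iff)

lemma cm_inv: "\<lbrakk>x \<in> carrier G; y \<in> carrier G\<rbrakk> \<Longrightarrow> inv (cm x y) = cm y x"
  by (simp add: cm_def inv_mult_group m_assoc)

text \<open>The usual conjugate of \<open>cm x' y\<close> by \<open>x\<close> is written as
  \<open>cm x (cm x' y) \<otimes> cm x' y\<close>, so that the correction disappears as soon as the
  nested commutator is trivial.\<close>

lemma cm_mult_left:
  "\<lbrakk>x \<in> carrier G; x' \<in> carrier G; y \<in> carrier G\<rbrakk>
    \<Longrightarrow> cm (x \<otimes> x') y = cm x (cm x' y) \<otimes> (cm x' y \<otimes> cm x y)"
  by (simp add: cm_def inv_mult_group m_assoc)

lemma cm_mult_right:
  "\<lbrakk>x \<in> carrier G; y \<in> carrier G; y' \<in> carrier G\<rbrakk>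
    \<Longrightarrow> cm x (y \<otimes> y') = cm x y \<otimes> (cm y (cm x y') \<otimes> cm x y')"
  by (simp add: cm_def inv_mult_group m_assoc)

lemma central_closed: "central z \<Longrightarrow> z \<in> carrier G"
  by (simp add: central_def)

lemma central_comm: "\<lbrakk>central z; g \<in> carrier G\<rbrakk> \<Longrightarrow> z \<otimes> g = g \<otimes> z"
  unfolding central_def by blast

lemma central_iff_cm: "central z \<longleftrightarrow> z \<in> carrier G \<and> (\<forall>g\<in>carrier G. cm z g = \<one>)"
  unfolding central_def using cm_eq_one_iff by blast

lemma cm_central [simp]:
  assumes "central z" "x \<in> carrier G"
  shows "cm z x = \<one>" "cm x z = \<one>"
proof -
  have z: "z \<in> carrier G" using assms(1) by (rule central_closed)
  show "cm z x = \<one>" by (rule cm_eq_one_iff[OF z assms(2), THEN iffD2, OF central_comm[OF assms]])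
  show "cm x z = \<one>" by (rule cm_eq_one_iff[OF assms(2) z, THEN iffD2, OF central_comm[OF assms, symmetric]])
qed

lemma central_one [simp]: "central \<one>"
  by (simp add: central_def)

lemma commute_mult:
  assumes "x \<in> carrier G" "y \<in> carrier G" "z \<in> carrier G" "x \<otimes> z = z \<otimes> x" "y \<otimes> z = z \<otimes> y"
  shows "(x \<otimes> y) \<otimes> z = z \<otimes> (x \<otimes> y)"
  using assms by (metis m_assoc)

lemma commute_mult':
  assumes "x \<in> carrier G" "y \<in> carrier G" "z \<in> carrier G" "z \<otimes> x = x \<otimes> z" "z \<otimes> y = y \<otimes> z"
  shows "z \<otimes> (x \<otimes> y) = (x \<otimes> y) \<otimes> z"
  using commute_mult[of x y z] assms by metis

text \<open>Lifts an identity for two adjacent factors to right-nested products, where it can serve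
  as a rewrite rule alongside \<open>m_assoc\<close>.\<close>

lemma mult_eq_lift:
  "\<lbrakk>x \<otimes> y = z; x \<in> carrier G; y \<in> carrier G; w \<in> carrier G\<rbrakk> \<Longrightarrow> x \<otimes> (y \<otimes> w) = z \<otimes> w"
  by (simp add: m_assoc[symmetric])

lemma commute_inv:
  assumes "x \<in> carrier G" "z \<in> carrier G" "x \<otimes> z = z \<otimes> x"
  shows "inv x \<otimes> z = z \<otimes> inv x"
  using assms by (metis inv_closed inv_solve_left inv_solve_right m_assoc m_closed)

lemma central_mult [simp]: "\<lbrakk>central x; central y\<rbrakk> \<Longrightarrow> central (x \<otimes> y)"
  unfolding central_def using commute_mult m_closed by blast

lemma central_inv [simp]: "central x \<Longrightarrow> central (inv x)"
  unfolding central_def using commute_inv inv_closed by blast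

lemma central_nat_pow [simp]: "central x \<Longrightarrow> central (x [^] (n::nat))"
  by (induction n) auto

lemma central_int_pow [simp]: "central x \<Longrightarrow> central (x [^] (n::int))"
  unfolding int_pow_def2 using central_inv central_nat_pow by presburger

lemma cm_inv_left:
  assumes "x \<in> carrier G" "y \<in> carrier G" "central (cm x y)"
  shows "cm (inv x) y = inv (cm x y)"
proof -
  have "cm (inv x) y = inv x \<otimes> (inv (cm x y) \<otimes> x)"
    using assms(1,2) by (simp add: cm_inv) (simp add: cm_def m_assoc)
  also have "inv (cm x y) \<otimes> x = x \<otimes> inv (cm x y)"
    using assms by (intro central_comm) auto
  finally show ?thesis using assms(1,2) by simp
qed

lemma generate_induct [consumes 2, case_names one gen inv_gen mult]:
  assumes "x \<in> generate G S" "S \<subseteq> carrier G"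
    and "P \<one>" "\<And>s. s \<in> S \<Longrightarrow> P s"
    and "\<And>s. s \<in> carrier G \<Longrightarrow> P s \<Longrightarrow> P (inv s)"
    and "\<And>x y. \<lbrakk>x \<in> carrier G; y \<in> carrier G; P x; P y\<rbrakk> \<Longrightarrow> P (x \<otimes> y)"
  shows "P x"
proof -
  have "subgroup {x \<in> carrier G. P x} G"
    by (rule subgroupI) (use assms in auto)
  then have "generate G S \<subseteq> {x \<in> carrier G. P x}"
    using assms by (intro generate_subgroup_incl) auto
  with assms(1) show ?thesis by auto
qed

lemma central_if_commutes_gens:
  assumes "carrier G = generate G S" "S \<subseteq> carrier G" "z \<in> carrier G"
    and "\<And>s. s \<in> S \<Longrightarrow> z \<otimes> s = s \<otimes> z"
  shows "central z"
proof -
  have "z \<otimes> g = g \<otimes> z" if "g \<in> generate G S" for g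
    using that assms(2)
  proof (induction g rule: generate_induct)
    case (inv_gen s) then show ?case using commute_inv[of s z] assms(3) by metis
  next
    case (mult x y) then show ?case using commute_mult[of x y z] assms(3) by metis
  qed (use assms in auto)
  then show ?thesis unfolding central_def using assms by blast
qed

end

text \<open>Equivalent to the law [x, [x, y]] = 1; stated for conjugates because inner automorphisms
  are the endomorphisms that supply it.\<close>

locale engel2_group = group +
  assumes conj_commute:
    "\<lbrakk>x \<in> carrier G; y \<in> carrier G\<rbrakk> \<Longrightarrow> x \<otimes> (y \<otimes> x \<otimes> inv y) = (y \<otimes> x \<otimes> inv y) \<otimes> x"

sublocale E_group \<subseteq> engel2_group
proof
  fix x y assume xy: "x \<in> carrier G" "y \<in> carrier G"
  have "(\<lambda>x. y \<otimes> x \<otimes> inv y) \<in> hom G G"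
    using xy by (auto simp: hom_def m_assoc)
  from endo_image_commute[OF this xy(1)]
  show "x \<otimes> (y \<otimes> x \<otimes> inv y) = (y \<otimes> x \<otimes> inv y) \<otimes> x" .
qed

section \<open>Abelian normal subgroups and triple commutators\<close>

context group
begin

definition centralizer :: "'a set \<Rightarrow> 'a set" where
  "centralizer S = {g \<in> carrier G. \<forall>s\<in>S. g \<otimes> s = s \<otimes> g}"

lemma centralizer_subset: "centralizer S \<subseteq> carrier G"
  by (auto simp: centralizer_def)

lemma centralizer_is_subgroup:
  assumes "S \<subseteq> carrier G"
  shows "subgroup (centralizer S) G"
proof (rule subgroupI)
  have "\<one> \<in> centralizer S" using assms by (auto simp: centralizer_def)
  then show "centralizer S \<noteq> {}" by blast
  show "inv g \<in> centralizer S" if "g \<in> centralizer S" for g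
    using that assms commute_inv unfolding centralizer_def by blast
  show "g \<otimes> h \<in> centralizer S" if "g \<in> centralizer S" "h \<in> centralizer S" for g h
    using that assms commute_mult unfolding centralizer_def by blast
qed (rule centralizer_subset)

lemma centralizer_normal:
  assumes S: "S \<subseteq> carrier G" "\<And>g s. \<lbrakk>g \<in> carrier G; s \<in> S\<rbrakk> \<Longrightarrow> g \<otimes> s \<otimes> inv g \<in> S"
  shows "centralizer S \<lhd> G"
proof (rule normal_invI[OF centralizer_is_subgroup[OF S(1)]])
  fix g h assume g: "g \<in> carrier G" and h: "h \<in> centralizer S"
  have hc: "h \<in> carrier G" using h centralizer_subset by blast
  have "g \<otimes> h \<otimes> inv g \<otimes> s = s \<otimes> (g \<otimes> h \<otimes> inv g)" if s: "s \<in> S" for s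
  proof -
    have sc: "s \<in> carrier G" using S s by blast
    have "inv g \<otimes> s \<otimes> inv (inv g) \<in> S" using S(2)[OF inv_closed[OF g] s] .
    then have *: "h \<otimes> (inv g \<otimes> s \<otimes> inv (inv g)) = (inv g \<otimes> s \<otimes> inv (inv g)) \<otimes> h"
      using h unfolding centralizer_def by blast
    have "g \<otimes> h \<otimes> inv g \<otimes> s = g \<otimes> (h \<otimes> (inv g \<otimes> s \<otimes> inv (inv g))) \<otimes> inv g"
      using g hc sc by (simp add: m_assoc)
    also have "\<dots> = s \<otimes> (g \<otimes> h \<otimes> inv g)"
      unfolding * using g hc sc by (simp add: m_assoc)
    finally show ?thesis .
  qed
  then show "g \<otimes> h \<otimes> inv g \<in> centralizer S" using g hc unfolding centralizer_def by blast
qed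

end

context engel2_group
begin

text \<open>Take the centre of the centralizer of the conjugacy class of \<open>x\<close>.\<close>

lemma abelian_normal_subgroup:
  assumes x: "x \<in> carrier G"
  obtains A where "A \<lhd> G" "x \<in> A" "\<And>g h. \<lbrakk>g \<in> A; h \<in> A\<rbrakk> \<Longrightarrow> g \<otimes> h = h \<otimes> g"
proof -
  define K where "K = {g \<otimes> x \<otimes> inv g | g. g \<in> carrier G}"
  have K: "K \<subseteq> carrier G" using x by (auto simp: K_def)
  have Kconj: "g \<otimes> s \<otimes> inv g \<in> K" if g: "g \<in> carrier G" and s: "s \<in> K" for g s
  proof -
    from s obtain h where h: "h \<in> carrier G" "s = h \<otimes> x \<otimes> inv h" unfolding K_def by blast
    then have "g \<otimes> s \<otimes> inv g = (g \<otimes> h) \<otimes> x \<otimes> inv (g \<otimes> h)"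
      using g x by (simp add: m_assoc inv_mult_group)
    moreover have "g \<otimes> h \<in> carrier G" using g h by simp
    ultimately show ?thesis unfolding K_def by (intro CollectI exI[of _ "g \<otimes> h"] conjI)
  qed
  have Kcomm: "s \<otimes> t = t \<otimes> s" if st: "s \<in> K" "t \<in> K" for s t
  proof -
    from st obtain g h where gh: "g \<in> carrier G" "s = g \<otimes> x \<otimes> inv g"
      "h \<in> carrier G" "t = h \<otimes> x \<otimes> inv h" unfolding K_def by blast
    \<comment> \<open>Conjugation by \<open>g\<close> reduces the commuting of two conjugates of
      \<open>x\<close> to that of \<open>x\<close> with a single conjugate.\<close>
    define k where "k = inv g \<otimes> h"
    have k: "k \<in> carrier G" using gh by (simp add: k_def)
    have t: "t = g \<otimes> (k \<otimes> x \<otimes> inv k) \<otimes> inv g"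
      using gh x by (simp add: k_def m_assoc inv_mult_group)
    have "s \<otimes> t = g \<otimes> (x \<otimes> (k \<otimes> x \<otimes> inv k)) \<otimes> inv g"
      unfolding t gh(2) using gh(1) x k by (simp add: m_assoc)
    also have "\<dots> = g \<otimes> ((k \<otimes> x \<otimes> inv k) \<otimes> x) \<otimes> inv g"
      by (simp only: conj_commute[OF x k])
    also have "\<dots> = t \<otimes> s"
      unfolding t gh(2) using gh(1) x k by (simp add: m_assoc)
    finally show ?thesis .
  qed
  have N: "centralizer K \<lhd> G" by (rule centralizer_normal[OF K Kconj])
  have NN: "centralizer (centralizer K) \<lhd> G"
  proof (rule centralizer_normal[OF centralizer_subset])
    show "g \<otimes> s \<otimes> inv g \<in> centralizer K" if "g \<in> carrier G" "s \<in> centralizer K" for g s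
      by (rule normal.inv_op_closed2[OF N that])
  qed
  have xK: "x \<in> K" using x unfolding K_def by (intro CollectI exI[of _ \<one>]) simp
  show thesis
  proof (rule that[OF normal_subgroup_intersect[OF NN N]])
    have "x \<otimes> s = s \<otimes> x" if "s \<in> centralizer K" for s
    proof -
      have "s \<otimes> x = x \<otimes> s" using that xK unfolding centralizer_def by blast
      then show ?thesis by (rule sym)
    qed
    then have "x \<in> centralizer (centralizer K)" using x unfolding centralizer_def[of "centralizer K"] by blast
    moreover have "\<forall>s\<in>K. x \<otimes> s = s \<otimes> x" using Kcomm[OF xK] by (intro ballI)
    then have "x \<in> centralizer K" using x by (simp only: centralizer_def mem_Collect_eq simp_thms)
    ultimately show "x \<in> centralizer (centralizer K) \<inter> centralizer K" by blast
    show "g \<otimes> h = h \<otimes> g" if "g \<in> centralizer (centralizer K) \<inter> centralizer K"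
      "h \<in> centralizer (centralizer K) \<inter> centralizer K" for g h
    proof -
      have "g \<in> centralizer (centralizer K)" "h \<in> centralizer K" using that by blast+
      then show ?thesis unfolding centralizer_def[of "centralizer K"] by blast
    qed
  qed
qed

lemma normal_cm_mem:
  assumes "A \<lhd> G" "x \<in> A" "y \<in> carrier G"
  shows "cm x y \<in> A" "cm y x \<in> A"
proof -
  have sub: "subgroup A G" using assms(1) by (rule normal_imp_subgroup)
  have xc: "x \<in> carrier G" using subgroup.mem_carrier[OF sub assms(2)] .
  have "x \<otimes> (y \<otimes> inv x \<otimes> inv y) \<in> A"
    by (intro subgroup.m_closed[OF sub] assms normal.inv_op_closed2[OF assms(1)]
        subgroup.m_inv_closed[OF sub])
  then show "cm x y \<in> A" using xc assms(3) by (simp add: cm_def m_assoc)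
  have "(y \<otimes> x \<otimes> inv y) \<otimes> inv x \<in> A"
    by (intro subgroup.m_closed[OF sub] assms normal.inv_op_closed2[OF assms(1)]
        subgroup.m_inv_closed[OF sub])
  then show "cm y x \<in> A" using xc assms(3) by (simp add: cm_def m_assoc)
qed

text \<open>An abelian normal subgroup containing \<open>x\<close> also contains
  \<open>cm x y\<close>; likewise for \<open>y\<close>.\<close>

lemma cm_commute:
  assumes "x \<in> carrier G" "y \<in> carrier G"
  shows "cm x y \<otimes> x = x \<otimes> cm x y" "cm x y \<otimes> y = y \<otimes> cm x y"
proof -
  obtain A where A: "A \<lhd> G" "x \<in> A" "\<And>g h. \<lbrakk>g \<in> A; h \<in> A\<rbrakk> \<Longrightarrow> g \<otimes> h = h \<otimes> g"
    using abelian_normal_subgroup[OF assms(1)] by blast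
  show "cm x y \<otimes> x = x \<otimes> cm x y"
    by (intro A normal_cm_mem assms)
  obtain B where B: "B \<lhd> G" "y \<in> B" "\<And>g h. \<lbrakk>g \<in> B; h \<in> B\<rbrakk> \<Longrightarrow> g \<otimes> h = h \<otimes> g"
    using abelian_normal_subgroup[OF assms(2)] by blast
  show "cm x y \<otimes> y = y \<otimes> cm x y"
    by (intro B normal_cm_mem assms)
qed

text \<open>Expand \<open>cm x (s \<otimes> inv s) = \<one>\<close>; the hypothesis kills the nested
  commutator.\<close>

lemma cm_inv_right:
  assumes "x \<in> carrier G" "s \<in> carrier G" "s \<otimes> cm x (inv s) = cm x (inv s) \<otimes> s"
  shows "cm x (inv s) = inv (cm x s)"
proof -
  have "cm s (cm x (inv s)) = \<one>" using assms by (simp add: cm_eq_one_iff)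
  moreover have "cm x (s \<otimes> inv s) = \<one>" using assms(1,2) by (simp add: cm_def)
  ultimately have "cm x s \<otimes> cm x (inv s) = \<one>"
    using cm_mult_right[of x s "inv s"] assms(1,2) by simp
  then show ?thesis using assms(1,2) by (metis cm_closed inv_closed inv_equality inv_inv)
qed

text \<open>The swap inverts the inner commutator, and the inverse can be pulled out because
  \<open>cm y z\<close> and its own commutators lie in one abelian normal subgroup containing
  \<open>y\<close>.\<close>

lemma triple_swap23:
  assumes xyz: "x \<in> carrier G" "y \<in> carrier G" "z \<in> carrier G"
  shows "cm x (cm z y) = inv (cm x (cm y z))"
proof -
  obtain A where A: "A \<lhd> G" "y \<in> A" "\<And>g h. \<lbrakk>g \<in> A; h \<in> A\<rbrakk> \<Longrightarrow> g \<otimes> h = h \<otimes> g"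
    using abelian_normal_subgroup[OF xyz(2)] by blast
  have "cm y z \<otimes> cm x (inv (cm y z)) = cm x (inv (cm y z)) \<otimes> cm y z"
    unfolding cm_inv[OF xyz(2,3)] by (intro A normal_cm_mem xyz)
  from cm_inv_right[OF xyz(1) _ this] show ?thesis
    using xyz by (simp add: cm_inv)
qed

text \<open>Expand the fact that \<open>[x, y z]\<close> commutes with \<open>y z\<close>.\<close>

lemma triple_swap13:
  assumes xyz: "x \<in> carrier G" "y \<in> carrier G" "z \<in> carrier G"
  shows "cm z (cm x y) = inv (cm y (cm x z))"
proof -
  define s where "s = cm x y"
  define t where "t = cm x z"
  define r where "r = cm y t"
  define q where "q = cm z s"
  have c: "s \<in> carrier G" "t \<in> carrier G" "r \<in> carrier G" "q \<in> carrier G"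
    using xyz by (simp_all add: s_def t_def r_def q_def)
  obtain X where X: "X \<lhd> G" "x \<in> X" "\<And>g h. \<lbrakk>g \<in> X; h \<in> X\<rbrakk> \<Longrightarrow> g \<otimes> h = h \<otimes> g"
    using abelian_normal_subgroup[OF xyz(1)] by blast
  obtain Y where Y: "Y \<lhd> G" "y \<in> Y" "\<And>g h. \<lbrakk>g \<in> Y; h \<in> Y\<rbrakk> \<Longrightarrow> g \<otimes> h = h \<otimes> g"
    using abelian_normal_subgroup[OF xyz(2)] by blast
  obtain Z where Z: "Z \<lhd> G" "z \<in> Z" "\<And>g h. \<lbrakk>g \<in> Z; h \<in> Z\<rbrakk> \<Longrightarrow> g \<otimes> h = h \<otimes> g"
    using abelian_normal_subgroup[OF xyz(3)] by blast
  have sX: "s \<in> X" and rX: "r \<in> X"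
    unfolding s_def r_def t_def by (intro normal_cm_mem X xyz)+
  have "s \<in> Y" "r \<in> Y" "q \<in> Y"
    unfolding s_def r_def q_def t_def by (intro normal_cm_mem Y xyz cm_closed)+
  then have yc: "y \<otimes> s = s \<otimes> y" "y \<otimes> r = r \<otimes> y" "y \<otimes> q = q \<otimes> y"
    and qr: "q \<otimes> r = r \<otimes> q"
    using Y by blast+
  have "t \<in> Z" "r \<in> Z"
    unfolding r_def t_def by (intro normal_cm_mem Z xyz cm_closed)+
  then have zc: "z \<otimes> t = t \<otimes> z" "z \<otimes> r = r \<otimes> z" using Z by blast+
  have p: "cm x (y \<otimes> z) = s \<otimes> (r \<otimes> t)"
    using cm_mult_right[of x y z] xyz by (simp add: s_def t_def r_def)
  have zs: "z \<otimes> s = q \<otimes> (s \<otimes> z)" unfolding q_def by (rule cm_swap[OF xyz(3) c(1)])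
  have yt: "y \<otimes> t = r \<otimes> (t \<otimes> y)" unfolding r_def by (rule cm_swap[OF xyz(2) c(2)])
  have sr: "s \<otimes> r = r \<otimes> s" by (rule X(3)[OF sX rX])
  note moves = yc zc(1) zs yt sr qr zc(2)
  have "(y \<otimes> z) \<otimes> (s \<otimes> (r \<otimes> t)) = (q \<otimes> r) \<otimes> ((s \<otimes> (r \<otimes> t)) \<otimes> (y \<otimes> z))"
    using xyz c by (simp add: m_assoc moves moves[THEN mult_eq_lift])
  then have "(y \<otimes> z) \<otimes> cm x (y \<otimes> z) = (q \<otimes> r) \<otimes> (cm x (y \<otimes> z) \<otimes> (y \<otimes> z))"
    unfolding p .
  then have "cm x (y \<otimes> z) \<otimes> (y \<otimes> z) = (q \<otimes> r) \<otimes> (cm x (y \<otimes> z) \<otimes> (y \<otimes> z))"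
    using cm_commute(2)[of x "y \<otimes> z"] xyz by simp
  then have "(q \<otimes> r) \<otimes> (cm x (y \<otimes> z) \<otimes> (y \<otimes> z)) = cm x (y \<otimes> z) \<otimes> (y \<otimes> z)"
    by (rule sym)
  then have "q \<otimes> r = \<one>"
    using xyz c by (subst (asm) r_cancel_one) simp_all
  then show ?thesis
    using inv_equality[of q r] c by (simp add: q_def r_def s_def t_def)
qed

lemma triple_swap12:
  assumes xyz: "x \<in> carrier G" "y \<in> carrier G" "z \<in> carrier G"
  shows "cm y (cm x z) = inv (cm x (cm y z))"
  using triple_swap23[of y z x] triple_swap13[of z x y] triple_swap23[of x y z] xyz by simp

lemma triple_cycle:
  assumes xyz: "x \<in> carrier G" "y \<in> carrier G" "z \<in> carrier G"
  shows "cm y (cm z x) = cm x (cm y z)"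
  using triple_swap13[of z x y] triple_swap23[of x y z] xyz by simp

text \<open>Compare the expansions of both sides of \<open>[x y, z] = [[x, y] (y x), z]\<close>.\<close>

lemma triple_pow_3:
  assumes xyz: "x \<in> carrier G" "y \<in> carrier G" "z \<in> carrier G"
  shows "cm x (cm y z) [^] (3::nat) = \<one>"
proof -
  define f where "f = cm x (cm y z)"
  define s where "s = cm x y"
  have c: "f \<in> carrier G" "s \<in> carrier G" using xyz by (simp_all add: f_def s_def)
  obtain X where X: "X \<lhd> G" "x \<in> X" "\<And>g h. \<lbrakk>g \<in> X; h \<in> X\<rbrakk> \<Longrightarrow> g \<otimes> h = h \<otimes> g"
    using abelian_normal_subgroup[OF xyz(1)] by blast
  obtain Y where Y: "Y \<lhd> G" "y \<in> Y" "\<And>g h. \<lbrakk>g \<in> Y; h \<in> Y\<rbrakk> \<Longrightarrow> g \<otimes> h = h \<otimes> g"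
    using abelian_normal_subgroup[OF xyz(2)] by blast
  obtain Z where Z: "Z \<lhd> G" "z \<in> Z" "\<And>g h. \<lbrakk>g \<in> Z; h \<in> Z\<rbrakk> \<Longrightarrow> g \<otimes> h = h \<otimes> g"
    using abelian_normal_subgroup[OF xyz(3)] by blast
  have A: "cm (x \<otimes> y) z = f \<otimes> (cm y z \<otimes> cm x z)"
    using cm_mult_left[OF xyz] by (simp add: f_def)
  have B: "cm (y \<otimes> x) z = inv f \<otimes> (cm x z \<otimes> cm y z)"
    using cm_mult_left[of y x z] triple_swap12[OF xyz] xyz by (simp add: f_def)
  have "s \<otimes> cm y z = cm y z \<otimes> s" "s \<otimes> inv f = inv f \<otimes> s"
    unfolding s_def f_def triple_swap12[OF xyz, symmetric]
    by (intro Y normal_cm_mem xyz cm_closed)+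
  moreover have "s \<otimes> cm x z = cm x z \<otimes> s"
    unfolding s_def by (intro X normal_cm_mem xyz)
  ultimately have "s \<otimes> cm (y \<otimes> x) z = cm (y \<otimes> x) z \<otimes> s"
    unfolding B using xyz c by (intro commute_mult' cm_closed m_closed inv_closed)
  then have "cm s (cm (y \<otimes> x) z) = \<one>" using xyz c by (simp add: cm_eq_one_iff)
  moreover have "x \<otimes> y = s \<otimes> (y \<otimes> x)" unfolding s_def by (rule cm_swap[OF xyz(1,2)])
  ultimately have 1: "cm (x \<otimes> y) z = cm (y \<otimes> x) z \<otimes> cm s z"
    using cm_mult_left[of s "y \<otimes> x" z] xyz c by simp
  have "cm s z = inv (cm z s)" using xyz c by (simp add: cm_inv)
  also have "cm z s = f" using triple_cycle[of z x y] triple_cycle[of x y z] xyz unfolding f_def s_def by simp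
  finally have sz: "cm s z = inv f" .
  have memZ: "f \<in> Z" "cm y z \<in> Z" "cm x z \<in> Z"
    unfolding f_def by (intro normal_cm_mem Z xyz cm_closed)+
  define w where "w = cm y z \<otimes> cm x z"
  have w: "w = cm x z \<otimes> cm y z" "w \<in> carrier G" "w \<in> Z"
    unfolding w_def using memZ Z xyz subgroup.m_closed[OF normal_imp_subgroup[OF Z(1)]] by blast+
  have "inv f \<in> Z" using memZ subgroup.m_inv_closed[OF normal_imp_subgroup[OF Z(1)]] by blast
  have "f \<otimes> w = inv f \<otimes> w \<otimes> inv f"
    using 1 unfolding A B sz by (simp add: w_def[symmetric] w(1)[symmetric])
  also have "\<dots> = (inv f \<otimes> inv f) \<otimes> w"
  proof -
    have "w \<otimes> inv f = inv f \<otimes> w" by (rule Z(3)[OF w(3) \<open>inv f \<in> Z\<close>])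
    then show ?thesis using c w(2) by (simp only: m_assoc inv_closed m_closed)
  qed
  finally have "f = inv f \<otimes> inv f" using c w(2) by simp
  then have "f \<otimes> f = f \<otimes> (inv f \<otimes> inv f)" by (rule arg_cong)
  then have "f \<otimes> f = inv f" using c by simp
  then have "f \<otimes> f \<otimes> f = \<one>" using c by simp
  then show ?thesis using c by (simp add: f_def[symmetric] numeral_3_eq_3)
qed

text \<open>Lets the sign of a swap of the last two arguments pass through both outer commutators of
  a fourfold one. An abelian normal subgroup containing \<open>z\<close> contains everything that
  has to commute.\<close>

lemma cm_inv_right_triple:
  assumes xyzt: "x \<in> carrier G" "y \<in> carrier G" "z \<in> carrier G" "t \<in> carrier G"
  shows "cm x (inv (cm y (cm z t))) = inv (cm x (cm y (cm z t)))"
proof -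
  define s where "s = cm y (cm z t)"
  have s: "s \<in> carrier G" using xyzt by (simp add: s_def)
  obtain A where A: "A \<lhd> G" "z \<in> A" "\<And>g h. \<lbrakk>g \<in> A; h \<in> A\<rbrakk> \<Longrightarrow> g \<otimes> h = h \<otimes> g"
    using abelian_normal_subgroup[OF xyzt(3)] by blast
  have sA: "s \<in> A" unfolding s_def by (intro normal_cm_mem A xyzt cm_closed)
  then have "inv s \<in> A" using subgroup.m_inv_closed[OF normal_imp_subgroup[OF A(1)]] by blast
  then have "s \<otimes> cm x (inv s) = cm x (inv s) \<otimes> s"
    by (intro A(3) sA normal_cm_mem(2)[OF A(1)] xyzt)
  from cm_inv_right[OF xyzt(1) s this] show ?thesis by (simp add: s_def)
qed

text \<open>The fourfold commutator is alternating, hence invariant under the even permutation that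
  exchanges the two halves; this permutation also inverts it.\<close>

lemma triple_central:
  assumes yzt: "y \<in> carrier G" "z \<in> carrier G" "t \<in> carrier G"
  shows "central (cm y (cm z t))"
proof -
  have "cm x (cm y (cm z t)) = \<one>" if x: "x \<in> carrier G" for x
  proof -
    define F where "F x y z t = cm x (cm y (cm z t))" for x y z t
    have Fc: "F x y z t \<in> carrier G"
      if "x \<in> carrier G" "y \<in> carrier G" "z \<in> carrier G" "t \<in> carrier G" for x y z t
      using that by (simp add: F_def)
    have s12: "F y x z t = inv (F x y z t)"
      if "x \<in> carrier G" "y \<in> carrier G" "z \<in> carrier G" "t \<in> carrier G" for x y z t
      using triple_swap12[of x y "cm z t"] that unfolding F_def by simp
    have s23: "F x z y t = inv (F x y z t)" and s34: "F x y t z = inv (F x y z t)"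
      if "x \<in> carrier G" "y \<in> carrier G" "z \<in> carrier G" "t \<in> carrier G" for x y z t
      using triple_swap12[of y z t] triple_swap23[of y z t] cm_inv_right_triple[of x y z t] that
      unfolding F_def by simp_all
    note c = x yzt
    have "F z t x y = inv (F z x t y)" using s23[of z x t y] c by simp
    also have "F z x t y = inv (F x z t y)" using s12[of x z t y] c by simp
    also have "F x z t y = inv (F x z y t)" using s34[of x z y t] c by simp
    also have "F x z y t = inv (F x y z t)" using s23[of x y z t] c by simp
    finally have even: "F z t x y = F x y z t" using Fc c by simp
    have "F x y z t = cm (cm z t) (cm x y)"
      unfolding F_def using triple_cycle[of "cm z t" x y] c by simp
    moreover have "F z t x y = cm (cm x y) (cm z t)"
      unfolding F_def using triple_cycle[of "cm x y" z t] c by simp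
    ultimately have "inv (F x y z t) = F x y z t" using even c by (simp add: cm_inv)
    then have "F x y z t \<otimes> F x y z t = \<one>" using Fc c by (metis r_inv)
    moreover have "F x y z t [^] (3::nat) = \<one>"
      unfolding F_def using triple_pow_3[of x y "cm z t"] c by simp
    ultimately show ?thesis using Fc[OF c] by (simp add: F_def[symmetric] numeral_3_eq_3)
  qed
  then have "cm y (cm z t) \<otimes> x = x \<otimes> cm y (cm z t)" if "x \<in> carrier G" for x
    using that yzt cm_eq_one_iff[of x "cm y (cm z t)"] by simp
  then show ?thesis using yzt unfolding central_def by blast
qed

text \<open>By cyclic invariance with \<open>cm z t\<close> as one entry, the commutator of the two
  is a fourfold commutator, and triple commutators are central.\<close>

lemma cm_cm_commute:
  assumes "x \<in> carrier G" "y \<in> carrier G" "z \<in> carrier G" "t \<in> carrier G"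
  shows "cm x y \<otimes> cm z t = cm z t \<otimes> cm x y"
proof -
  have "cm (cm z t) (cm x y) = cm x (cm y (cm z t))"
    using triple_cycle[of "cm z t" x y] assms by simp
  also have "\<dots> = \<one>"
    using triple_central[of y z t] assms by simp
  finally show ?thesis using assms by (simp add: cm_eq_one_iff)
qed

end

section \<open>The abelianization\<close>

context group
begin

abbreviation D :: "'a set" where "D \<equiv> derived G (carrier G)"

lemma cm_in_derived: "\<lbrakk>x \<in> carrier G; y \<in> carrier G\<rbrakk> \<Longrightarrow> cm x y \<in> D"
  unfolding derived_def cm_def by (rule generate.incl) blast

lemma derived_closed: "h \<in> D \<Longrightarrow> h \<in> carrier G"
  using derived_in_carrier by blast

lemma derived_induct [consumes 1, case_names one cm inv_cm mult]:
  assumes "h \<in> D"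
    and "P \<one>" "\<And>x y. \<lbrakk>x \<in> carrier G; y \<in> carrier G\<rbrakk> \<Longrightarrow> P (cm x y)"
    and "\<And>s. s \<in> carrier G \<Longrightarrow> P s \<Longrightarrow> P (inv s)"
    and "\<And>x y. \<lbrakk>x \<in> carrier G; y \<in> carrier G; P x; P y\<rbrakk> \<Longrightarrow> P (x \<otimes> y)"
  shows "P h"
  using assms(1) unfolding derived_def
proof (rule generate_induct)
  show "derived_set G (carrier G) \<subseteq> carrier G" by blast
  show "P s" if "s \<in> derived_set G (carrier G)" for s
    using that assms(3) unfolding cm_def by blast
qed (use assms in auto)

text \<open>Congruences modulo \<open>D\<close> are computed in the quotient, which is kept abstract
  so that only its kernel is visible.\<close>

lemma abelianization:
  obtains Q :: "'a set monoid" and \<pi> where "comm_group Q" "group_hom G Q \<pi>"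
    "\<And>x. x \<in> carrier G \<Longrightarrow> \<pi> x = \<one>\<^bsub>Q\<^esub> \<longleftrightarrow> x \<in> D"
proof -
  interpret N: normal D G by (rule derived_self_is_normal)
  show thesis
  proof (rule that[of "G Mod D" "\<lambda>x. D #> x"])
    show "comm_group (G Mod D)" by (rule derived_quot_is_comm_group)
    show "group_hom G (G Mod D) (\<lambda>x. D #> x)"
      by (simp add: group_hom_def group_hom_axioms_def N.r_coset_hom_Mod N.factorgroup_is_group)
    show "D #> x = \<one>\<^bsub>G Mod D\<^esub> \<longleftrightarrow> x \<in> D" if "x \<in> carrier G" for x
      using that coset_join1[OF _ that N.is_subgroup] coset_join2[OF that N.is_subgroup] N.subset
      by auto
  qed
qed

text \<open>Hall's formula for class 2. The two hypotheses make the subgroup generated by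
  \<open>x\<close> and \<open>y\<close> of class at most 2, whatever the class of the whole
  group.\<close>

lemma mult_power:
  fixes n :: nat
  assumes xy: "x \<in> carrier G" "y \<in> carrier G"
    and k: "cm y x \<otimes> x = x \<otimes> cm y x" "cm y x \<otimes> y = y \<otimes> cm y x"
  shows "(x \<otimes> y) [^] n = x [^] n \<otimes> (y [^] n \<otimes> cm y x [^] (n choose 2))"
proof -
  define c where "c = cm y x"
  have c: "c \<in> carrier G" using xy by (simp add: c_def)
  have cx: "c [^] m \<otimes> x = x \<otimes> c [^] m" and cy: "c [^] m \<otimes> y = y \<otimes> c [^] m" for m :: nat
    using k xy c group_commutes_pow[of c x m] group_commutes_pow[of c y m] by (simp_all add: c_def)
  have yx: "y \<otimes> x = x \<otimes> (y \<otimes> c)"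
    using cm_swap[OF xy(2,1)] cx[of 1] cy[of 1] xy c by (metis c_def m_assoc m_closed nat_pow_Suc nat_pow_0 l_one One_nat_def)
  have ypx: "y [^] n \<otimes> x = x \<otimes> (y [^] n \<otimes> c [^] n)" for n :: nat
  proof (induction n)
    case (Suc n)
    have "y [^] Suc n \<otimes> x = y [^] n \<otimes> (x \<otimes> (y \<otimes> c))" using xy c by (simp add: m_assoc yx)
    also have "\<dots> = (y [^] n \<otimes> x) \<otimes> (y \<otimes> c)" using xy c by (simp add: m_assoc)
    also have "\<dots> = x \<otimes> (y [^] n \<otimes> (c [^] n \<otimes> y \<otimes> c))"
      using xy c by (simp only: Suc.IH m_assoc m_closed nat_pow_closed)
    also have "\<dots> = x \<otimes> (y [^] Suc n \<otimes> c [^] Suc n)"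
      using xy c by (simp only: cy m_assoc m_closed nat_pow_closed nat_pow_Suc)
    finally show ?case .
  qed (use xy in simp)
  show ?thesis unfolding c_def[symmetric]
  proof (induction n)
    case (Suc n)
    have ch: "Suc n choose 2 = (n choose 2) + n"
      using binomial_Suc_Suc[of n 1] unfolding Suc_1 by simp
    have "(x \<otimes> y) [^] Suc n = x [^] n \<otimes> (y [^] n \<otimes> (c [^] (n choose 2) \<otimes> x) \<otimes> y)"
      using xy c by (simp add: Suc.IH m_assoc)
    also have "\<dots> = x [^] n \<otimes> ((y [^] n \<otimes> x) \<otimes> (c [^] (n choose 2) \<otimes> y))"
      using xy c by (simp only: cx m_assoc m_closed nat_pow_closed)
    also have "\<dots> = x [^] n \<otimes> (x \<otimes> (y [^] n \<otimes> ((c [^] n \<otimes> y) \<otimes> c [^] (n choose 2))))"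
      using xy c by (simp only: ypx cy mult_eq_lift[OF cy] m_assoc m_closed nat_pow_closed)
    also have "\<dots> = x [^] Suc n \<otimes> (y [^] Suc n \<otimes> (c [^] n \<otimes> c [^] (n choose 2)))"
      using xy c by (simp only: mult_eq_lift[OF cy] m_assoc m_closed nat_pow_closed nat_pow_Suc)
    also have "c [^] n \<otimes> c [^] (n choose 2) = c [^] (Suc n choose 2)"
      using c by (simp only: ch nat_pow_mult add.commute)
    finally show ?case .
  qed (use xy in \<open>simp add: numeral_2_eq_2\<close>)
qed

end

lemma (in comm_group) generate3_word:
  assumes "x \<in> generate G {a, b, c}" "a \<in> carrier G" "b \<in> carrier G" "c \<in> carrier G"
  shows "\<exists>(i::int) (j::int) (k::int). x = a [^] i \<otimes> (b [^] j \<otimes> c [^] k)"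
proof -
  have *: "(a [^] i \<otimes> (b [^] j \<otimes> c [^] k)) \<otimes> (a [^] i' \<otimes> (b [^] j' \<otimes> c [^] k'))
      = a [^] (i + i') \<otimes> (b [^] (j + j') \<otimes> c [^] (k + k'))" for i j k i' j' k' :: int
    using assms(2-) by (simp add: int_pow_mult m_ac)
  have **: "inv (a [^] i \<otimes> (b [^] j \<otimes> c [^] k)) = a [^] (-i) \<otimes> (b [^] (-j) \<otimes> c [^] (-k))"
    for i j k :: int
    using assms(2-) by (simp add: int_pow_neg inv_mult)
  show ?thesis using assms(1)
  proof (rule generate_induct)
    show "\<exists>(i::int) (j::int) (k::int). \<one> = a [^] i \<otimes> (b [^] j \<otimes> c [^] k)"
      by (intro exI[of _ 0]) simp
    show "\<exists>(i::int) (j::int) (k::int). s = a [^] i \<otimes> (b [^] j \<otimes> c [^] k)" if "s \<in> {a, b, c}" for s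
    proof -
      from that consider "s = a" | "s = b" | "s = c" by blast
      then show ?thesis
      proof cases
        case 1 then show ?thesis using assms by (intro exI[of _ 1] exI[of _ 0]) simp
      next
        case 2 then show ?thesis using assms by (intro exI[of _ 0] exI[of _ 1] exI[of _ 0]) simp
      next
        case 3 then show ?thesis using assms by (intro exI[of _ 0] exI[of _ 1]) simp
      qed
    qed
    show "\<exists>(i::int) (j::int) (k::int). inv s = a [^] i \<otimes> (b [^] j \<otimes> c [^] k)"
      if "\<exists>(i::int) (j::int) (k::int). s = a [^] i \<otimes> (b [^] j \<otimes> c [^] k)" for s
      using that ** by blast
    show "\<exists>(i::int) (j::int) (k::int). x \<otimes> y = a [^] i \<otimes> (b [^] j \<otimes> c [^] k)"
      if "\<exists>(i::int) (j::int) (k::int). x = a [^] i \<otimes> (b [^] j \<otimes> c [^] k)"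
        "\<exists>(i::int) (j::int) (k::int). y = a [^] i \<otimes> (b [^] j \<otimes> c [^] k)" for x y
      using that * by blast
  qed (use assms in auto)
qed

section \<open>The abelianization as a quotient of Z^3, and endomorphisms from functionals\<close>

locale three_generated = group +
  fixes a b c
  assumes gens [simp]: "a \<in> carrier G" "b \<in> carrier G" "c \<in> carrier G"
    and generated: "carrier G = generate G {a, b, c}"
begin

text \<open>Cyclic symmetry, by which results about \<open>c\<close> are transferred to
  \<open>a\<close> and \<open>b\<close>.\<close>

lemma rotate: "three_generated G b c a"
proof -
  have "{b, c, a} = {a, b, c}" by blast
  then show ?thesis by unfold_locales (use gens generated in metis)+
qed

definition ab_word :: "int \<Rightarrow> int \<Rightarrow> int \<Rightarrow> 'a" where
  "ab_word i j k = a [^] i \<otimes> (b [^] j \<otimes> c [^] k)"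

lemma ab_word_closed [simp]: "ab_word i j k \<in> carrier G"
  by (simp add: ab_word_def)

lemma word_mod_derived:
  assumes "x \<in> carrier G"
  shows "\<exists>i j k. inv (ab_word i j k) \<otimes> x \<in> D"
proof -
  obtain Q :: "'a set monoid" and \<pi> where Q: "comm_group Q" and hom: "group_hom G Q \<pi>"
    and ker: "\<And>x. x \<in> carrier G \<Longrightarrow> \<pi> x = \<one>\<^bsub>Q\<^esub> \<longleftrightarrow> x \<in> D" using abelianization by blast
  interpret Q: comm_group Q by (rule Q)
  interpret \<pi>: group_hom G Q \<pi> by (rule hom)
  have w: "\<pi> (ab_word i j k) = \<pi> a [^]\<^bsub>Q\<^esub> i \<otimes>\<^bsub>Q\<^esub> (\<pi> b [^]\<^bsub>Q\<^esub> j \<otimes>\<^bsub>Q\<^esub> \<pi> c [^]\<^bsub>Q\<^esub> k)"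
    for i j k by (simp add: ab_word_def \<pi>.hom_int_pow)
  have "\<pi> ` generate G {a, b, c} = generate Q (\<pi> ` {a, b, c})"
    by (rule \<pi>.generate_img[symmetric]) simp
  then have "\<pi> x \<in> generate Q {\<pi> a, \<pi> b, \<pi> c}" using assms generated by auto
  then obtain i j k :: int where "\<pi> x = \<pi> (ab_word i j k)"
    unfolding w using Q.generate3_word[of "\<pi> x" "\<pi> a" "\<pi> b" "\<pi> c"] by auto
  then have "\<pi> (inv (ab_word i j k) \<otimes> x) = \<one>\<^bsub>Q\<^esub>"
    using assms by simp
  then have "inv (ab_word i j k) \<otimes> x \<in> D"
    using ker[of "inv (ab_word i j k) \<otimes> x"] assms by simp
  then show ?thesis by (intro exI)
qed

text \<open>The kernel of the map from Z^3 onto the abelianization.\<close>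

definition rel :: "int \<Rightarrow> int \<Rightarrow> int \<Rightarrow> bool" where
  "rel i j k \<longleftrightarrow> ab_word i j k \<in> D"

lemma rel_lattice:
  "rel 0 0 0" "rel i j k \<Longrightarrow> rel (- i) (- j) (- k)"
  "rel i j k \<Longrightarrow> rel i' j' k' \<Longrightarrow> rel (i + i') (j + j') (k + k')"
  "\<lbrakk>x \<in> carrier G; inv (ab_word i j k) \<otimes> x \<in> D; inv (ab_word i' j' k') \<otimes> x \<in> D\<rbrakk>
    \<Longrightarrow> rel (i - i') (j - j') (k - k')"
  "\<lbrakk>x \<in> carrier G; y \<in> carrier G;
     inv (ab_word i j k) \<otimes> x \<in> D; inv (ab_word i' j' k') \<otimes> y \<in> D\<rbrakk>
    \<Longrightarrow> inv (ab_word (i + i') (j + j') (k + k')) \<otimes> (x \<otimes> y) \<in> D"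
proof -
  obtain Q :: "'a set monoid" and \<pi> where Q: "comm_group Q" and hom: "group_hom G Q \<pi>"
    and ker: "\<And>x. x \<in> carrier G \<Longrightarrow> \<pi> x = \<one>\<^bsub>Q\<^esub> \<longleftrightarrow> x \<in> D" using abelianization by blast
  interpret Q: comm_group Q by (rule Q)
  interpret \<pi>: group_hom G Q \<pi> by (rule hom)
  define w where "w i j k = \<pi> a [^]\<^bsub>Q\<^esub> i \<otimes>\<^bsub>Q\<^esub> (\<pi> b [^]\<^bsub>Q\<^esub> j \<otimes>\<^bsub>Q\<^esub> \<pi> c [^]\<^bsub>Q\<^esub> k)"
    for i j k :: int
  have wc: "w i j k \<in> carrier Q" for i j k by (simp add: w_def)
  have \<pi>w: "\<pi> (ab_word i j k) = w i j k" for i j k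
    by (simp add: w_def ab_word_def \<pi>.hom_int_pow)
  have wm: "w i j k \<otimes>\<^bsub>Q\<^esub> w i' j' k' = w (i + i') (j + j') (k + k')" for i j k i' j' k'
    by (simp add: w_def Q.int_pow_mult Q.m_ac)
  have w0: "w 0 0 0 = \<one>\<^bsub>Q\<^esub>" by (simp add: w_def)
  have wn: "w (- i) (- j) (- k) = inv\<^bsub>Q\<^esub> (w i j k)" for i j k
    by (rule Q.inv_equality[symmetric]) (simp_all add: wm wc w0)
  have r: "rel i j k \<longleftrightarrow> w i j k = \<one>\<^bsub>Q\<^esub>" for i j k
    using ker[of "ab_word i j k"] by (simp add: rel_def \<pi>w)
  have m: "inv (ab_word i j k) \<otimes> x \<in> D \<longleftrightarrow> \<pi> x = w i j k" if "x \<in> carrier G" for i j k x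
  proof -
    have "inv (ab_word i j k) \<otimes> x \<in> D \<longleftrightarrow> inv\<^bsub>Q\<^esub> (w i j k) \<otimes>\<^bsub>Q\<^esub> \<pi> x = \<one>\<^bsub>Q\<^esub>"
      using that by (subst ker[symmetric]) (simp_all add: \<pi>w)
    also have "\<dots> \<longleftrightarrow> \<pi> x = w i j k"
      using that wc Q.inv_solve_left[of "\<one>\<^bsub>Q\<^esub>" "w i j k" "\<pi> x"] by auto
    finally show ?thesis .
  qed
  show "rel 0 0 0" by (simp add: r w0)
  show "rel (- i) (- j) (- k)" if "rel i j k" using that by (simp add: r wn)
  show "rel (i + i') (j + j') (k + k')" if "rel i j k" "rel i' j' k'"
    using that by (simp add: r wm[symmetric])
  show "rel (i - i') (j - j') (k - k')"
    if "x \<in> carrier G" "inv (ab_word i j k) \<otimes> x \<in> D" "inv (ab_word i' j' k') \<otimes> x \<in> D"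
    using that wm[of i j k "- i'" "- j'" "- k'"] wc by (simp add: r m wn)
  show "inv (ab_word (i + i') (j + j') (k + k')) \<otimes> (x \<otimes> y) \<in> D"
    if "x \<in> carrier G" "y \<in> carrier G"
      "inv (ab_word i j k) \<otimes> x \<in> D" "inv (ab_word i' j' k') \<otimes> y \<in> D"
    using that by (simp add: m wm)
qed

text \<open>Two exponent triples for \<open>x\<close> differ by a relation, on which the functional
  is a multiple of \<open>d\<close>; as \<open>g\<close> has exponent \<open>d\<close>, the power of
  \<open>g\<close> does not depend on the choice. The value \<open>d = 0\<close> is allowed and puts
  no condition on \<open>g\<close>.\<close>

lemma hom_of_functional:
  fixes f1 f2 f3 d :: int
  assumes f: "\<And>i j k. rel i j k \<Longrightarrow> d dvd f1 * i + f2 * j + f3 * k"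
    and g: "g \<in> carrier G" "g [^] d = \<one>"
  obtains \<alpha> where "\<alpha> \<in> hom G G"
    "\<And>x i j k. \<lbrakk>x \<in> carrier G; inv (ab_word i j k) \<otimes> x \<in> D\<rbrakk> \<Longrightarrow> \<alpha> x = g [^] (f1 * i + f2 * j + f3 * k)"
proof -
  define \<alpha> where "\<alpha> x = g [^] (SOME r. \<exists>i j k. inv (ab_word i j k) \<otimes> x \<in> D \<and> r = f1 * i + f2 * j + f3 * k)"
    for x
  have *: "\<alpha> x = g [^] (f1 * i + f2 * j + f3 * k)"
    if x: "x \<in> carrier G" "inv (ab_word i j k) \<otimes> x \<in> D" for x i j k
  proof -
    have "\<exists>r. \<exists>i j k. inv (ab_word i j k) \<otimes> x \<in> D \<and> r = f1 * i + f2 * j + f3 * k"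
      using x by blast
    from someI_ex[OF this] obtain i' j' k' where ijk: "inv (ab_word i' j' k') \<otimes> x \<in> D"
      "\<alpha> x = g [^] (f1 * i' + f2 * j' + f3 * k')" unfolding \<alpha>_def by auto
    have "d dvd f1 * (i' - i) + f2 * (j' - j) + f3 * (k' - k)"
      by (rule f, rule rel_lattice(4)[OF x(1) ijk(1) x(2)])
    then obtain q where "f1 * (i' - i) + f2 * (j' - j) + f3 * (k' - k) = d * q" by blast
    then have q: "f1 * i' + f2 * j' + f3 * k' = d * q + (f1 * i + f2 * j + f3 * k)"
      by (simp add: algebra_simps)
    have "g [^] (d * q) = \<one>" using g by (simp add: int_pow_pow[symmetric])
    then show ?thesis
      unfolding ijk(2) q using g int_pow_mult[of g "d * q" "f1 * i + f2 * j + f3 * k"] by simp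
  qed
  show thesis
  proof (rule that)
    show "\<alpha> \<in> hom G G"
    proof (rule homI)
      show "\<alpha> x \<in> carrier G" for x using g by (simp add: \<alpha>_def)
      fix x y assume xy: "x \<in> carrier G" "y \<in> carrier G"
      obtain i j k where x: "inv (ab_word i j k) \<otimes> x \<in> D" using word_mod_derived[OF xy(1)] by blast
      obtain i' j' k' where y: "inv (ab_word i' j' k') \<otimes> y \<in> D" using word_mod_derived[OF xy(2)] by blast
      have "\<alpha> (x \<otimes> y) = g [^] (f1 * (i + i') + f2 * (j + j') + f3 * (k + k'))"
        by (rule *[OF _ rel_lattice(5)[OF xy x y]]) (use xy in simp)
      also have "\<dots> = \<alpha> x \<otimes> \<alpha> y"
        unfolding *[OF xy(1) x] *[OF xy(2) y] using g by (simp add: int_pow_mult[symmetric] algebra_simps)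
      finally show "\<alpha> (x \<otimes> y) = \<alpha> x \<otimes> \<alpha> y" .
    qed
  qed (rule *)
qed

end

locale three_generated_E = E_group + three_generated
begin

text \<open>Both \<open>u\<close> and \<open>x u\<^sup>1\<^sup>-\<^sup>r\<close> are sent to \<open>g\<close>.\<close>

lemma central_of_functional:
  fixes f1 f2 f3 d :: int
  assumes f: "\<And>i j k. rel i j k \<Longrightarrow> d dvd f1 * i + f2 * j + f3 * k"
    and y: "f1 * y1 + f2 * y2 + f3 * y3 = 1"
    and g: "g \<in> carrier G" "g [^] d = \<one>"
  shows "central g"
proof -
  obtain \<alpha> where \<alpha>: "\<alpha> \<in> hom G G"
    and \<alpha>w: "\<And>x i j k. \<lbrakk>x \<in> carrier G; inv (ab_word i j k) \<otimes> x \<in> D\<rbrakk>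
      \<Longrightarrow> \<alpha> x = g [^] (f1 * i + f2 * j + f3 * k)"
    using hom_of_functional[OF f g] by blast
  interpret \<alpha>: group_hom G G \<alpha> by unfold_locales (rule \<alpha>)
  have comm: "x \<otimes> g = g \<otimes> x" if "x \<in> carrier G" "\<alpha> x = g" for x
    using endo_image_commute[OF \<alpha> that(1)] that(2) by simp
  define u where "u = ab_word y1 y2 y3"
  have u: "u \<in> carrier G" by (simp add: u_def)
  have oneD: "\<one> \<in> D" using derived_is_subgroup[of "carrier G"] subgroup.one_closed by blast
  have \<alpha>u: "\<alpha> u = g" using \<alpha>w[of u y1 y2 y3] g y oneD by (simp add: u_def)
  have ug: "u \<otimes> g = g \<otimes> u" by (rule comm[OF u \<alpha>u])
  have "g \<otimes> x = x \<otimes> g" if x: "x \<in> carrier G" for x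
  proof -
    obtain i j k where ijk: "inv (ab_word i j k) \<otimes> x \<in> D" using word_mod_derived[OF x] by blast
    define r where "r = f1 * i + f2 * j + f3 * k"
    have \<alpha>x: "\<alpha> x = g [^] r" unfolding r_def by (rule \<alpha>w[OF x ijk])
    define v where "v = u [^] (1 - r)"
    have v: "v \<in> carrier G" using u by (simp add: v_def)
    have "\<alpha> (x \<otimes> v) = g [^] r \<otimes> g [^] (1 - r)"
      using x u v by (simp add: \<alpha>x \<alpha>u v_def \<alpha>.hom_int_pow)
    also have "\<dots> = g" using g int_pow_mult[of g r "1 - r"] by simp
    finally have xv: "(x \<otimes> v) \<otimes> g = g \<otimes> (x \<otimes> v)" using comm x v by simp
    have n: "u [^] n \<otimes> g = g \<otimes> u [^] n" for n :: nat
      by (rule group_commutes_pow[OF ug u g(1)])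
    then have "v \<otimes> g = g \<otimes> v"
      unfolding v_def int_pow_def2 using commute_inv[of "u [^] (nat (- (1 - r)))" g] u g(1)
      by (auto simp del: pow_nat)
    then have "inv v \<otimes> g = g \<otimes> inv v" by (rule commute_inv[OF v g(1)])
    from commute_mult[OF m_closed[OF x v] inv_closed[OF v] g(1) xv this]
    show ?thesis using x v g(1) by (simp add: m_assoc)
  qed
  then show ?thesis using g(1) unfolding central_def by blast
qed

end

section \<open>Relation lattices\<close>

lemma int_subgroup_principal:
  fixes P :: "int \<Rightarrow> bool"
  assumes add: "\<And>x y. P x \<Longrightarrow> P y \<Longrightarrow> P (x + y)" and neg: "\<And>x. P x \<Longrightarrow> P (- x)"
    and ex: "P d" "d > 0"
  obtains n where "n > 0" "P n" "\<And>j. P j \<Longrightarrow> n dvd j"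
proof -
  define n where "n = (LEAST n::nat. n > 0 \<and> P (int n))"
  have "nat d > 0 \<and> P (int (nat d))" using ex by simp
  then have n: "n > 0 \<and> P (int n)" unfolding n_def by (rule LeastI)
  have zero: "P 0" using add[OF ex(1) neg[OF ex(1)]] by simp
  have nat_mult: "P (int k * int n)" for k :: nat
    by (induction k) (use n zero add in \<open>auto simp: algebra_simps\<close>)
  have mult: "P (q * int n)" for q :: int
    using nat_mult[of "nat q"] neg[OF nat_mult[of "nat (- q)"]] by (cases "q \<ge> 0") auto
  show thesis
  proof (rule that[of "int n"])
    fix j assume "P j"
    then have "P (j + (- (j div int n)) * int n)" by (intro add mult)
    also have "j + (- (j div int n)) * int n = j mod int n"
      by (simp add: minus_div_mult_eq_mod[symmetric])
    finally have P: "P (j mod int n)" .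
    have b: "0 \<le> j mod int n" "j mod int n < int n" using n by simp_all
    show "int n dvd j"
    proof (rule ccontr)
      assume "\<not> int n dvd j"
      then have "j mod int n \<noteq> 0" by (simp add: dvd_eq_mod_eq_0)
      then have "nat (j mod int n) > 0 \<and> P (int (nat (j mod int n)))" using b P by simp
      then have "n \<le> nat (j mod int n)" unfolding n_def by (rule Least_le)
      then show False using b by linarith
    qed
  qed (use n in auto)
qed

text \<open>Subgroups of Z^3 as membership predicates; used for the relations of the abelianization
  and later for those among commutators.\<close>

locale lattice3 =
  fixes P :: "int \<Rightarrow> int \<Rightarrow> int \<Rightarrow> bool"
  assumes zero: "P 0 0 0"
    and neg: "P i j k \<Longrightarrow> P (- i) (- j) (- k)"
    and add: "P i j k \<Longrightarrow> P i' j' k' \<Longrightarrow> P (i + i') (j + j') (k + k')"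
begin

lemma scale: assumes "P i j k" shows "P (q * i) (q * j) (q * k)"
proof -
  have nat_mult: "P (int n * i) (int n * j) (int n * k)" for n :: nat
    by (induction n) (use assms zero add in \<open>auto simp: algebra_simps\<close>)
  show ?thesis
    using nat_mult[of "nat q"] neg[OF nat_mult[of "nat (- q)"]] by (cases "q \<ge> 0") auto
qed

text \<open>Extend the functional \<open>k\<close> from the lattice points \<open>(0, 0, k)\<close> one coordinate at a time.\<close>

lemma functional_mod:
  assumes d: "d > 0" "P d 0 0" "P 0 d 0" and k: "\<And>k. P 0 0 k \<Longrightarrow> d dvd k"
  obtains f1 f2 where "\<And>i j k. P i j k \<Longrightarrow> d dvd f1 * i + f2 * j + k"
proof -
  obtain n where n: "n > 0" "\<exists>r. P 0 n r" and ndvd: "\<And>j. \<exists>r. P 0 j r \<Longrightarrow> n dvd j"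
  proof (rule int_subgroup_principal[of "\<lambda>j. \<exists>r. P 0 j r" d])
    show "\<exists>r. P 0 (x + y) r" if "\<exists>r. P 0 x r" "\<exists>r. P 0 y r" for x y
      using that add[of 0 x _ 0 y] by auto
    show "\<exists>r. P 0 (- x) r" if "\<exists>r. P 0 x r" for x using that neg[of 0 x] by auto
  qed (use d in auto)
  obtain r where r: "P 0 n r" using n by blast
  have "n dvd d" using ndvd d by blast
  then obtain q where q: "d = n * q" ..
  have q0: "q \<noteq> 0" using q d by auto
  \<comment> \<open>A multiple of (0, n, r) differs from (0, d, 0) by (0, 0, q r), so d divides q r
    and therefore n divides r. The quotient \<open>t\<close> defines the functional on the second
    coordinate; the first is treated alike below.\<close>
  have "P (q * 0 + - 0) (q * n + - d) (q * r + - 0)" by (intro add scale[OF r] neg d)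
  then have "d dvd q * r" using q by (intro k) (simp add: mult.commute)
  then have "n dvd r" using q q0 by (simp add: mult.commute)
  then obtain t where t: "r = n * t" ..
  have f2: "d dvd - t * j + k" if "P 0 j k" for j k
  proof -
    have "n dvd j" using ndvd that by blast
    then obtain s where s: "j = n * s" ..
    have "P (0 + (- s) * 0) (j + (- s) * n) (k + (- s) * r)" by (intro add that scale[OF r])
    then show ?thesis using k[of "k - s * r"] s t by (simp add: algebra_simps)
  qed
  obtain n' where n': "n' > 0" "\<exists>s r. P n' s r" and n'dvd: "\<And>i. \<exists>s r. P i s r \<Longrightarrow> n' dvd i"
  proof (rule int_subgroup_principal[of "\<lambda>i. \<exists>s r. P i s r" d])
    show "\<exists>s r. P (x + y) s r" if "\<exists>s r. P x s r" "\<exists>s r. P y s r" for x y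
      using that add by meson
    show "\<exists>s r. P (- x) s r" if "\<exists>s r. P x s r" for x using that neg by meson
  qed (use d in auto)
  obtain u v where uv: "P n' u v" using n' by blast
  have "n' dvd d" using n'dvd d by blast
  then obtain q' where q': "d = n' * q'" ..
  have q'0: "q' \<noteq> 0" using q' d by auto
  have "P (q' * n' + - d) (q' * u + - 0) (q' * v + - 0)" by (intro add scale[OF uv] neg d)
  then have "d dvd - t * (q' * u) + q' * v" using q' by (intro f2) (simp add: mult.commute)
  then have "n' * q' dvd (v - t * u) * q'" using q' by (simp add: algebra_simps)
  then have "n' dvd v - t * u" using q'0 by simp
  then obtain w where w: "v - t * u = n' * w" ..
  show thesis
  proof (rule that[of "- w" "- t"])
    fix i j k assume P: "P i j k"
    have "n' dvd i" using n'dvd P by blast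
    then obtain s where s: "i = n' * s" ..
    have "P (i + (- s) * n') (j + (- s) * u) (k + (- s) * v)" by (intro add P scale[OF uv])
    then have "d dvd - t * (j - s * u) + (k - s * v)" using s by (intro f2) (simp add: algebra_simps)
    also have "- t * (j - s * u) + (k - s * v) = - t * j + k - s * (v - t * u)"
      by (simp add: algebra_simps)
    also have "\<dots> = - w * i + - t * j + k" unfolding w using s by (simp add: algebra_simps)
    finally show "d dvd - w * i + - t * j + k" .
  qed
qed

text \<open>The lattice meets the third axis only in 0, so its rank is at most 2: two independent
  points determine a functional by their cross product, and smaller rank is easier. Dividing by the
  gcd makes the functional take the value 1.\<close>

lemma functional_zero:
  assumes k: "\<And>k. P 0 0 k \<Longrightarrow> k = 0"
  obtains f1 f2 f3 y1 y2 y3 where "f1 * y1 + f2 * y2 + f3 * y3 = 1"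
    "\<And>i j k. P i j k \<Longrightarrow> f1 * i + f2 * j + f3 * k = 0"
proof -
  have "\<exists>F1 F2 F3. (F1 \<noteq> 0 \<or> F2 \<noteq> 0 \<or> F3 \<noteq> 0) \<and> (\<forall>i j k. P i j k \<longrightarrow> F1 * i + F2 * j + F3 * k = 0)"
  proof (cases "\<exists>i j k i' j' k'. P i j k \<and> P i' j' k' \<and>
      (j * k' - k * j' \<noteq> 0 \<or> k * i' - i * k' \<noteq> 0 \<or> i * j' - j * i' \<noteq> 0)")
    case True
    then obtain i j k i' j' k' where l: "P i j k" "P i' j' k'" and
      ne: "j * k' - k * j' \<noteq> 0 \<or> k * i' - i * k' \<noteq> 0 \<or> i * j' - j * i' \<noteq> 0" by blast
    have "(j * k' - k * j') * x + (k * i' - i * k') * y + (i * j' - j * i') * z = 0" if m: "P x y z" for x y z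
    proof -
      \<comment> \<open>Coefficients of the combination whose first two coordinates cancel; its
        third coordinate is, up to sign, the determinant of the three points.\<close>
      define \<alpha> \<beta> \<gamma> where "\<alpha> = i' * y - j' * x" and "\<beta> = x * j - y * i" and "\<gamma> = i * j' - j * i'"
      have "P (\<alpha> * i + \<beta> * i' + \<gamma> * x) (\<alpha> * j + \<beta> * j' + \<gamma> * y) (\<alpha> * k + \<beta> * k' + \<gamma> * z)"
        by (intro add scale l m)
      moreover have "\<alpha> * i + \<beta> * i' + \<gamma> * x = 0" "\<alpha> * j + \<beta> * j' + \<gamma> * y = 0"
        by (simp_all add: \<alpha>_def \<beta>_def \<gamma>_def algebra_simps)
      ultimately have "\<alpha> * k + \<beta> * k' + \<gamma> * z = 0" using k by simp
      then show ?thesis by (simp add: \<alpha>_def \<beta>_def \<gamma>_def algebra_simps)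
    qed
    then show ?thesis using ne by blast
  next
    case False
    show ?thesis
    proof (cases "\<exists>i j k. P i j k \<and> (i \<noteq> 0 \<or> j \<noteq> 0)")
      case True
      then obtain i j k where l: "P i j k" "i \<noteq> 0 \<or> j \<noteq> 0" by blast
      have "(- j) * x + i * y + 0 * z = 0" if "P x y z" for x y z
        using False l that by (auto simp: algebra_simps)
      then show ?thesis using l(2) by (intro exI[of _ "- j"] exI[of _ i] exI[of _ 0]) auto
    next
      case False2: False
      have "0 * x + 0 * y + 1 * z = 0" if "P x y z" for x y z
      proof -
        have "x = 0" "y = 0" using False2 that by blast+
        then show ?thesis using k that by simp
      qed
      then show ?thesis by (intro exI[of _ 0] exI[of _ "0::int"] exI[of _ 1]) auto
    qed
  qed
  then obtain F1 F2 F3 where ne: "F1 \<noteq> 0 \<or> F2 \<noteq> 0 \<or> F3 \<noteq> 0"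
    and F: "\<And>i j k. P i j k \<Longrightarrow> F1 * i + F2 * j + F3 * k = 0" by blast
  define h where "h = gcd F2 F3"
  define g where "g = gcd F1 h"
  have g0: "g \<noteq> 0" using ne by (auto simp: g_def h_def)
  obtain u v where uv: "u * F2 + v * F3 = h" unfolding h_def using bezout_int by blast
  obtain s t where st: "s * F1 + t * h = g" unfolding g_def using bezout_int by blast
  obtain f1 f2 f3 where f: "F1 = g * f1" "F2 = g * f2" "F3 = g * f3"
    unfolding g_def h_def by (metis dvd_def gcd_dvd1 gcd_dvd2 dvd_trans)
  have "g * (f1 * s + f2 * (t * u) + f3 * (t * v)) = g * 1"
    using st unfolding uv[symmetric] f by (simp add: algebra_simps)
  then have "f1 * s + f2 * (t * u) + f3 * (t * v) = 1" using g0 by simp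
  moreover have "f1 * i + f2 * j + f3 * k = 0" if "P i j k" for i j k
  proof -
    have "g * (f1 * i + f2 * j + f3 * k) = 0" using F[OF that] unfolding f by (simp add: algebra_simps)
    then show ?thesis using g0 by simp
  qed
  ultimately show thesis by (rule that)
qed

end

sublocale three_generated \<subseteq> rel: lattice3 rel
  by unfold_locales (rule rel_lattice; assumption)+

context three_generated
begin

lemma rel_c_iff: "rel 0 0 k \<longleftrightarrow> c [^] k \<in> D"
  by (simp add: rel_def ab_word_def)

lemma rel_a_iff: "rel k 0 0 \<longleftrightarrow> a [^] k \<in> D"
  by (simp add: rel_def ab_word_def)

lemma rel_b_iff: "rel 0 k 0 \<longleftrightarrow> b [^] k \<in> D"
  by (simp add: rel_def ab_word_def)

end

lemma (in group) comm_group_if_central: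
  assumes "\<And>x. x \<in> carrier G \<Longrightarrow> central x"
  shows "comm_group G"
  by (rule group_comm_groupI) (use assms central_comm in blast)

context three_generated_E
begin

lemma rotate_E: "three_generated_E G b c a"
  using rotate by (simp add: three_generated_E_def E_group_axioms)

text \<open>The functional has modulus 0, and \<open>g [^] 0 = \<one>\<close> holds for every
  \<open>g\<close>, so all elements are central.\<close>

lemma infinite_c:
  assumes "\<And>k::int. c [^] k \<in> D \<Longrightarrow> k = 0"
  shows "comm_group G"
proof (rule comm_group_if_central)
  fix g assume g: "g \<in> carrier G"
  show "central g"
  proof (rule rel.functional_zero)
    show "k = 0" if "rel 0 0 k" for k using assms that by (simp add: rel_c_iff)
    fix f1 f2 f3 y1 y2 y3
    assume "f1 * y1 + f2 * y2 + f3 * y3 = 1" "\<And>i j k. rel i j k \<Longrightarrow> f1 * i + f2 * j + f3 * k = 0"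
    then show "central g" using g by (intro central_of_functional[of 0 f1 f2 f3 y1 y2 y3]) simp_all
  qed
qed

text \<open>Because \<open>c\<close> attains the exponent \<open>d\<close> of the abelianization,
  the functional k on multiples of \<open>c\<close> extends with value 1 at (0, 0, 1).\<close>

lemma finite_c:
  fixes d :: nat
  assumes d: "d > 0" "a [^] d \<in> D" "b [^] d \<in> D"
    and c: "\<And>k::int. c [^] k \<in> D \<Longrightarrow> int d dvd k"
    and g: "g \<in> carrier G" "g [^] d = \<one>"
  shows "central g"
proof -
  show ?thesis
  proof (rule rel.functional_mod)
    show "rel (int d) 0 0" using d by (simp add: rel_a_iff int_pow_int)
    show "rel 0 (int d) 0" using d by (simp add: rel_b_iff int_pow_int)
    show "int d dvd k" if "rel 0 0 k" for k using c that by (simp add: rel_c_iff)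
    fix f1 f2 assume "\<And>i j k. rel i j k \<Longrightarrow> int d dvd f1 * i + f2 * j + k"
    then show "central g"
      using g by (intro central_of_functional[of "int d" f1 f2 1 0 0 1]) (simp_all add: int_pow_int)
  qed (use d in simp)
qed

text \<open>Apply \<open>infinite_c\<close> to all three rotations: unless the group is abelian,
  every generator has finite order modulo \<open>D\<close>.\<close>

lemma comm_or_finite:
  obtains "comm_group G"
  | N :: nat where "N > 0" "\<And>x. x \<in> carrier G \<Longrightarrow> x [^] N \<in> D"
proof -
  interpret r1: three_generated_E G b c a by (rule rotate_E)
  interpret r2: three_generated_E G c a b by (rule r1.rotate_E)
  consider "comm_group G" | i j k :: int where "i \<noteq> 0" "j \<noteq> 0" "k \<noteq> 0"
     "a [^] i \<in> D" "b [^] j \<in> D" "c [^] k \<in> D"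
    using infinite_c r1.infinite_c r2.infinite_c by blast
  then show thesis
  proof cases
    case 1 then show thesis by (rule that(1))
  next
    case (2 i j k)
    define M where "M = i * j * k"
    define N where "N = nat \<bar>M\<bar>"
    have N: "N > 0" using 2 by (simp add: N_def M_def)
    have oneD: "\<one> \<in> D" using derived_is_subgroup[of "carrier G"] subgroup.one_closed by blast
    obtain Q :: "'a set monoid" and \<pi> where Q: "comm_group Q" and hom: "group_hom G Q \<pi>"
      and ker: "\<And>x. x \<in> carrier G \<Longrightarrow> \<pi> x = \<one>\<^bsub>Q\<^esub> \<longleftrightarrow> x \<in> D" using abelianization by blast
    interpret Q: comm_group Q by (rule Q)
    interpret \<pi>: group_hom G Q \<pi> by (rule hom)
    have "\<pi> x [^]\<^bsub>Q\<^esub> M = \<one>\<^bsub>Q\<^esub>" if x: "x \<in> carrier G" for x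
    proof -
      obtain l m n where "inv (ab_word l m n) \<otimes> x \<in> D" using word_mod_derived[OF x] by blast
      then have "\<pi> (inv (ab_word l m n) \<otimes> x) = \<one>\<^bsub>Q\<^esub>"
        using ker[of "inv (ab_word l m n) \<otimes> x"] x by simp
      then have "inv\<^bsub>Q\<^esub> (\<pi> (ab_word l m n)) \<otimes>\<^bsub>Q\<^esub> \<pi> x = \<one>\<^bsub>Q\<^esub>" using x by simp
      then have px: "\<pi> x = \<pi> (ab_word l m n)"
        using Q.inv_solve_left[of "\<one>\<^bsub>Q\<^esub>" "\<pi> (ab_word l m n)" "\<pi> x"] x by auto
      have z: "\<pi> a [^]\<^bsub>Q\<^esub> i = \<one>\<^bsub>Q\<^esub>" "\<pi> b [^]\<^bsub>Q\<^esub> j = \<one>\<^bsub>Q\<^esub>" "\<pi> c [^]\<^bsub>Q\<^esub> k = \<one>\<^bsub>Q\<^esub>"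
        using 2 ker[of "a [^] i"] ker[of "b [^] j"] ker[of "c [^] k"] by (simp_all add: \<pi>.hom_int_pow)
      have "\<pi> a [^]\<^bsub>Q\<^esub> (i * (l * j * k)) = \<one>\<^bsub>Q\<^esub>" "\<pi> b [^]\<^bsub>Q\<^esub> (j * (m * i * k)) = \<one>\<^bsub>Q\<^esub>"
        "\<pi> c [^]\<^bsub>Q\<^esub> (k * (n * i * j)) = \<one>\<^bsub>Q\<^esub>"
        by (simp_all only: Q.int_pow_pow[symmetric] \<pi>.hom_closed gens z Q.int_pow_one)
      moreover have "i * (l * j * k) = l * M" "j * (m * i * k) = m * M" "k * (n * i * j) = n * M"
        by (simp_all add: M_def)
      ultimately show ?thesis
        unfolding px ab_word_def
        by (simp add: \<pi>.hom_int_pow Q.int_pow_distrib Q.int_pow_pow)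
    qed
    then have "\<pi> x [^]\<^bsub>Q\<^esub> int N = \<one>\<^bsub>Q\<^esub>" if x: "x \<in> carrier G" for x
      using that by (cases "M \<ge> 0") (auto simp: N_def Q.int_pow_neg simp del: int_pow_int)
    then have "x [^] N \<in> D" if x: "x \<in> carrier G" for x
      using ker[of "x [^] N"] that by (simp add: \<pi>.hom_nat_pow int_pow_int)
    then show thesis using N that(2) by blast
  qed
qed

end

section \<open>Reduction to p-groups\<close>

lemma twice_choose_two: "2 * (n choose 2) = n * (n - 1)"
  using binomial_absorption[of 1 n] by (cases n) (auto simp: choose_two)

context group
begin

lemma derived_induct' [consumes 1, case_names one cm inv mult]:
  assumes "h \<in> D"
    and "P \<one>" "\<And>x y. \<lbrakk>x \<in> carrier G; y \<in> carrier G\<rbrakk> \<Longrightarrow> P (cm x y)"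
    and "\<And>s. s \<in> D \<Longrightarrow> P s \<Longrightarrow> P (inv s)"
    and "\<And>x y. \<lbrakk>x \<in> D; y \<in> D; P x; P y\<rbrakk> \<Longrightarrow> P (x \<otimes> y)"
  shows "P h"
proof -
  interpret sub: subgroup D G by (rule derived_is_subgroup) simp
  have "h \<in> D \<and> P h"
    using assms(1) by (induction h rule: derived_induct) (use assms cm_in_derived in auto)
  then show ?thesis ..
qed

end

context engel2_group
begin

text \<open>No class 2 assumption is in force here; \<open>cm x y\<close> commutes with
  \<open>x\<close>, which is enough to remove the correction term.\<close>

lemma cm_pow_left:
  assumes "x \<in> carrier G" "y \<in> carrier G"
  shows "cm (x [^] (n::nat)) y = cm x y [^] n"
proof (induction n)
  case 0 then show ?case using assms by (simp add: cm_eq_one_iff)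
next
  case (Suc n)
  have "cm x y \<otimes> x [^] n = x [^] n \<otimes> cm x y"
    using group_commutes_pow[OF cm_commute(1)[symmetric], of x y n] assms by simp
  then have "cm (x [^] n) (cm x y) = \<one>" using assms by (simp add: cm_eq_one_iff)
  moreover have "cm x y \<otimes> cm x y [^] n = cm x y [^] Suc n"
    using nat_pow_Suc2[of "cm x y" n] assms by simp
  ultimately show ?case using cm_mult_left[of "x [^] n" x y] Suc assms by simp
qed

lemma cm_pow_right:
  assumes "x \<in> carrier G" "y \<in> carrier G"
  shows "cm x (y [^] (n::nat)) = cm x y [^] n"
proof -
  have "cm x (y [^] n) = inv (cm (y [^] n) x)" using assms by (simp add: cm_inv)
  also have "\<dots> = inv (cm y x [^] n)" using assms by (simp add: cm_pow_left)
  also have "\<dots> = cm x y [^] n"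
    using nat_pow_inv[of "cm y x" n] assms by (simp add: cm_inv)
  finally show ?thesis .
qed

lemma mult_power_engel:
  assumes "x \<in> carrier G" "y \<in> carrier G"
  shows "(x \<otimes> y) [^] (n::nat) = x [^] n \<otimes> (y [^] n \<otimes> cm y x [^] (n choose 2))"
  by (rule mult_power) (use assms cm_commute in auto)

lemma derived_commute:
  assumes "h \<in> D" "h' \<in> D"
  shows "h \<otimes> h' = h' \<otimes> h"
proof -
  have *: "h \<otimes> cm x y = cm x y \<otimes> h" if "h \<in> D" "x \<in> carrier G" "y \<in> carrier G" for h x y
    using that(1)
  proof (induction h rule: derived_induct')
    case (cm u v) then show ?case using cm_cm_commute that by blast
  next
    case (inv s) then show ?case using commute_inv[of s "cm x y"] that derived_closed by blast
  next
    case (mult s t) then show ?case using commute_mult[of s t "cm x y"] that derived_closed by blast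
  qed (use that in simp)
  show ?thesis using assms(2)
  proof (induction h' rule: derived_induct')
    case (cm x y) then show ?case using * assms(1) by blast
  next
    case (inv s)
    then have "inv s \<otimes> h = h \<otimes> inv s"
      using commute_inv[of s h] assms(1) derived_closed by metis
    then show ?case by (rule sym)
  next
    case (mult s t) then show ?case
      using commute_mult'[of s t h] assms(1) derived_closed by blast
  qed (use assms(1) derived_closed in simp)
qed

text \<open>On a commutator in the first argument this is a triple commutator; centrality of the
  values carries the property to products.\<close>

lemma cm_derived:
  assumes "h \<in> D" "y \<in> carrier G"
  shows "central (cm h y) \<and> cm h y [^] (3::nat) = \<one>"
  using assms(1)
proof (induction h rule: derived_induct')
  case one then show ?case using assms(2) by simp
next
  case (cm u v)
  have eq: "cm (cm u v) y = inv (cm y (cm u v))" using cm assms(2) by (simp add: cm_inv)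
  show ?case unfolding eq
    using triple_central[of y u v] triple_pow_3[of y u v] cm assms(2)
    by (simp add: nat_pow_inv)
next
  case (inv s)
  have s: "s \<in> carrier G" using inv(1) by (rule derived_closed)
  have eq: "cm (inv s) y = inv (cm s y)" using cm_inv_left inv(2) s assms(2) by blast
  show ?case unfolding eq using inv(2) s assms(2) by (simp add: nat_pow_inv del: cm_inv)
next
  case (mult s t)
  have c: "s \<in> carrier G" "t \<in> carrier G" using mult derived_closed by blast+
  have eq: "cm (s \<otimes> t) y = cm t y \<otimes> cm s y"
    using cm_mult_left[of s t y] mult c assms(2) by simp
  have "cm t y \<otimes> cm s y = cm s y \<otimes> cm t y"
    using mult c assms(2) by (intro central_comm) auto
  from pow_mult_distrib[OF this, of 3] show ?case
    unfolding eq using mult c assms(2) by simp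
qed

text \<open>\<open>D\<close> is abelian, and its generators have exponent dividing 3N because
  [u, v]^N = [u^N, v] has first entry in \<open>D\<close>.\<close>

lemma bounded_exponent:
  assumes N: "\<And>x. x \<in> carrier G \<Longrightarrow> x [^] (N::nat) \<in> D" and x: "x \<in> carrier G"
  shows "x [^] (N * (N * 3)) = \<one>"
proof -
  have "h [^] (N * 3) = \<one>" if "h \<in> D" for h
    using that
  proof (induction h rule: derived_induct')
    case (cm u v)
    have "cm u v [^] (N * 3) = cm (u [^] N) v [^] (3::nat)"
      using cm by (simp add: nat_pow_pow[symmetric] cm_pow_left)
    then show ?case using cm_derived[OF N] cm by simp
  next
    case (inv s) then show ?case using derived_closed by (simp add: nat_pow_inv)
  next
    case (mult s t)
    then show ?case
      using pow_mult_distrib[OF derived_commute, of s t "N * 3"] derived_closed by simp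
  qed simp
  from this[OF N[OF x]] show ?thesis using x by (simp add: nat_pow_pow)
qed

text \<open>The obstruction to multiplicativity is \<open>cm y x [^] (m choose 2)\<close>; the
  factor 2 in the hypothesis makes \<open>E\<close> divide the binomial coefficient.\<close>

lemma power_hom:
  assumes E: "\<And>x. x \<in> carrier G \<Longrightarrow> x [^] (E::nat) = \<one>" and m: "2 * E dvd m * (m - 1)"
  shows "(\<lambda>x. x [^] m) \<in> hom G G"
proof (rule homI)
  fix x y assume xy: "x \<in> carrier G" "y \<in> carrier G"
  have "2 * (m choose 2) = m * (m - 1)" by (rule twice_choose_two)
  then have "E dvd m choose 2" using m by (metis nat_mult_dvd_cancel1 zero_less_numeral)
  then obtain q where "m choose 2 = E * q" ..
  then have "cm y x [^] (m choose 2) = \<one>"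
    using E[of "cm y x"] xy by (simp add: nat_pow_pow[symmetric])
  then show "(x \<otimes> y) [^] m = x [^] m \<otimes> y [^] m"
    using mult_power_engel[OF xy, of m] xy by simp
qed simp

end

text \<open>Chinese remainders: \<open>m\<close> is 1 modulo the \<open>p\<close>-part of
  \<open>2 * E\<close> and 0 modulo the rest. The modulus is \<open>2 * E\<close> rather than
  \<open>E\<close> to suit \<open>power_hom\<close>.\<close>

lemma idempotent_mod:
  fixes E p :: nat
  assumes "E > 0" "prime p"
  obtains m s r where "2 * E = p ^ s * r" "2 * E dvd m * (m - 1)" "r dvd m" "p dvd E \<Longrightarrow> \<not> p dvd m"
proof -
  obtain r where r: "2 * E = p ^ multiplicity p (2 * E) * r" "\<not> p dvd r"
    using multiplicity_decompose'[of "2 * E" p] assms by (metis mult_eq_0_iff not_gr_zero not_prime_unit zero_neq_numeral)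
  define s where "s = multiplicity p (2 * E)"
  have "coprime (p ^ s) r" using r(2) assms(2) by (simp add: prime_imp_coprime)
  then obtain m where m: "[m = 1] (mod p ^ s)" "[m = 0] (mod r)"
    using binary_chinese_remainder_nat by blast
  have rm: "r dvd m" using m(2) by (simp add: cong_0_iff)
  have "p ^ s dvd m - 1 \<or> m = 0"
    using m(1) by (cases "m = 0") (auto simp: cong_altdef_nat cong_sym_eq)
  then have "2 * E dvd m * (m - 1)"
    using rm mult_dvd_mono[of r m "p ^ s" "m - 1"] unfolding r(1)[folded s_def]
    by (auto simp: mult.commute)
  moreover have "\<not> p dvd m" if "p dvd E"
  proof
    assume pm: "p dvd m"
    have "s > 0"
    proof (rule ccontr)
      assume "\<not> s > 0"
      then have "2 * E = r" using r(1) by (simp add: s_def)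
      then show False using r(2) that by (metis dvd_mult)
    qed
    then have "[m = 1] (mod p)" using cong_dvd_modulus_nat[OF m(1), of p] by (simp add: dvd_power)
    then have "p dvd 1" using pm cong_dvd_iff by blast
    then show False using assms(2) by simp
  qed
  ultimately show thesis using that[of s r m] r(1) rm by (simp add: s_def)
qed

locale p_three_generated_E = three_generated_E +
  fixes p s :: nat
  assumes prime: "prime p" and p_power: "x \<in> carrier G \<Longrightarrow> x [^] (p ^ s) = \<one>"

text \<open>The powering map \<open>x \<mapsto> x\<^sup>m\<close> with \<open>m\<close> idempotent modulo the exponent is an
  idempotent endomorphism onto the \<open>p\<close>-component, so endomorphisms of the component extend to \<open>G\<close>.\<close>

lemma (in three_generated_E) reduction_to_p_groups:
  assumes p_case: "\<And>(H :: ('a, 'b) monoid_scheme) a b c p s.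
    p_three_generated_E H a b c p s \<Longrightarrow> comm_group H"
  shows "comm_group G"
proof (rule comm_or_finite)
  fix N :: nat
  assume N: "N > 0" "\<And>x. x \<in> carrier G \<Longrightarrow> x [^] N \<in> D"
  define E where "E = N * (N * 3)"
  have E0: "E > 0" using N by (simp add: E_def)
  have E: "x [^] E = \<one>" if "x \<in> carrier G" for x
    unfolding E_def by (rule bounded_exponent[OF N(2) that])
  have E_dvd: "x [^] n = x [^] n'" if x: "x \<in> carrier G" and n: "n = n' + E * q" for x n n' q
    using E[OF x] x by (simp add: n nat_pow_mult[symmetric] nat_pow_pow[symmetric])
  show "comm_group G"
  proof (rule group_comm_groupI, rule ccontr)
    fix x y assume xy: "x \<in> carrier G" "y \<in> carrier G" "x \<otimes> y \<noteq> y \<otimes> x"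
    define g where "g = cm x y"
    have g: "g \<in> carrier G" "g \<noteq> \<one>" using xy by (simp_all add: g_def cm_eq_one_iff)
    then have "ord g \<noteq> 1" using ord_eq_1 by blast
    \<comment> \<open>This choice of prime ensures that the nontrivial commutator \<open>g\<close>
      survives in the \<open>p\<close>-component.\<close>
    then obtain p where p: "prime p" "p dvd ord g" using prime_factor_nat by blast
    have "ord g dvd E" using E g by (simp add: pow_eq_id)
    then have pE: "p dvd E" using p by auto
    obtain m s r where m: "2 * E = p ^ s * r" "2 * E dvd m * (m - 1)" "r dvd m" "\<not> p dvd m"
      using idempotent_mod[OF E0 p(1)] pE by metis
    define \<rho> where "\<rho> = (\<lambda>x. x [^] m)"
    have \<rho>: "\<rho> \<in> hom G G" unfolding \<rho>_def by (rule power_hom[OF E m(2)])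
    interpret \<rho>: group_hom G G \<rho> by unfold_locales (rule \<rho>)
    have m0: "m > 0" using m(4) by (cases m) auto
    have idem: "\<rho> (\<rho> x) = \<rho> x" if "x \<in> carrier G" for x
    proof -
      obtain q where "m * (m - 1) = 2 * E * q" using m(2) ..
      then have "m * m = m + E * (2 * q)" using m0 by (cases m) (auto simp: algebra_simps)
      then show ?thesis using E_dvd[OF that] that by (simp add: \<rho>_def nat_pow_pow)
    qed
    define P where "P = \<rho> ` carrier G"
    have P: "subgroup P G" unfolding P_def by (rule \<rho>.img_is_subgroup)
    have fixP: "\<rho> x = x" "x \<in> carrier G" if "x \<in> P" for x
      using that idem by (auto simp: P_def)
    let ?H = "G\<lparr>carrier := P\<rparr>"
    interpret H: group ?H by (rule subgroup_imp_group[OF P])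
    have "comm_group ?H"
    proof (rule p_case)
      show "p_three_generated_E ?H (\<rho> a) (\<rho> b) (\<rho> c) p s"
      proof unfold_locales
        fix \<beta> g assume \<beta>: "\<beta> \<in> hom ?H ?H" and g: "g \<in> carrier ?H"
        have "\<beta> \<circ> \<rho> \<in> hom G G"
        proof (rule homI)
          fix x assume "x \<in> carrier G"
          then have "\<rho> x \<in> carrier ?H" by (simp add: P_def)
          then have "\<beta> (\<rho> x) \<in> P" using \<beta> hom_in_carrier by fastforce
          then show "(\<beta> \<circ> \<rho>) x \<in> carrier G" using fixP by simp
        next
          fix x y assume "x \<in> carrier G" "y \<in> carrier G"
          then show "(\<beta> \<circ> \<rho>) (x \<otimes> y) = (\<beta> \<circ> \<rho>) x \<otimes> (\<beta> \<circ> \<rho>) y"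
            using hom_mult[OF \<beta>, of "\<rho> x" "\<rho> y"] by (simp add: P_def)
        qed
        from endo_image_commute[OF this, of g]
        show "g \<otimes>\<^bsub>?H\<^esub> \<beta> g = \<beta> g \<otimes>\<^bsub>?H\<^esub> g" using g fixP by simp
      next
        show "\<rho> a \<in> carrier ?H" "\<rho> b \<in> carrier ?H" "\<rho> c \<in> carrier ?H" by (simp_all add: P_def)
        have "generate ?H {\<rho> a, \<rho> b, \<rho> c} = generate G {\<rho> a, \<rho> b, \<rho> c}"
          by (rule generate_consistent[OF _ P]) (auto simp: P_def)
        also have "\<dots> = \<rho> ` generate G {a, b, c}"
          using \<rho>.generate_img[of "{a, b, c}"] by simp
        also have "\<dots> = carrier ?H" by (simp add: P_def generated)
        finally show "carrier ?H = generate ?H {\<rho> a, \<rho> b, \<rho> c}" ..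
        show "prime p" by (rule p(1))
        fix x assume "x \<in> carrier ?H"
        then obtain y where y: "y \<in> carrier G" "x = y [^] m" by (auto simp: P_def \<rho>_def)
        obtain q where "m = r * q" using m(3) ..
        then have "m * p ^ s = 0 + E * (2 * q)" using m(1) by (metis add_0 mult.assoc mult.commute)
        then have "x [^] (p ^ s) = \<one>"
          using E_dvd[OF y(1), of "m * p ^ s" 0 "2 * q"] y by (simp add: nat_pow_pow)
        then show "x [^]\<^bsub>?H\<^esub> (p ^ s) = \<one>\<^bsub>?H\<^esub>" using nat_pow_consistent[of x "p ^ s" P] by simp
      qed
    qed
    then interpret H: comm_group ?H .
    have "\<rho> x \<otimes> \<rho> y = \<rho> y \<otimes> \<rho> x"
      using H.m_comm[of "\<rho> x" "\<rho> y"] xy by (simp add: P_def)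
    then have "cm (\<rho> x) (\<rho> y) = \<one>" using xy by (simp add: cm_eq_one_iff)
    moreover have "\<rho> g = cm (\<rho> x) (\<rho> y)" using xy by (simp add: g_def cm_def)
    ultimately have "\<rho> g = \<one>" by simp
    then have "ord g dvd m" using g by (simp add: \<rho>_def pow_eq_id)
    then show False using p m(4) by auto
  qed
qed

section \<open>Three-generated groups of class 3\<close>

lemma (in three_generated) gens_subset: "{a, b, c} \<subseteq> carrier G"
  by simp

context p_three_generated_E
begin

lemma rotate_p: "p_three_generated_E G b c a p s"
  using rotate_E p_three_generated_E_axioms
  by (simp add: p_three_generated_E_def)

text \<open>The hypotheses make \<open>p ^ n\<close> the exact order of \<open>x\<close> modulo
  \<open>D\<close>: the gcd with \<open>k\<close> is a power of \<open>p\<close> that still sends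
  \<open>x\<close> into \<open>D\<close>, and a proper one would contradict minimality. The disjunct
  \<open>n = 0\<close> takes care of the truncated \<open>n - 1\<close>.\<close>

lemma p_power_dvd:
  assumes x: "x \<in> carrier G" and n: "x [^] (p ^ n) \<in> D" "n = 0 \<or> x [^] (p ^ (n - 1)) \<notin> D"
    and k: "x [^] (k::int) \<in> D"
  shows "int (p ^ n) dvd k"
proof -
  interpret sub: subgroup D G by (rule derived_is_subgroup) simp
  have D_pow: "h [^] (i::int) \<in> D" if "h \<in> D" for h i
  proof -
    have "h [^] (m::nat) \<in> D" for m using that by (induction m) auto
    then show ?thesis unfolding int_pow_def2 by (auto simp del: pow_nat)
  qed
  define g where "g = gcd (int (p ^ n)) k"
  obtain u v where uv: "u * int (p ^ n) + v * k = g" unfolding g_def using bezout_int by blast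
  have "x [^] g = (x [^] (p ^ n)) [^] u \<otimes> (x [^] k) [^] v"
    using x by (simp add: uv[symmetric] int_pow_mult int_pow_pow mult.commute int_pow_int[symmetric])
  then have xg: "x [^] g \<in> D" using D_pow n(1) k by auto
  have "nat g dvd p ^ n" unfolding g_def by (metis gcd_dvd1 nat_dvd_iff nat_int of_nat_dvd_iff gcd_ge_0_int int_nat_eq)
  then obtain t where t: "t \<le> n" "nat g = p ^ t" using prime by (metis divides_primepow_nat)
  then have g: "g = int (p ^ t)" unfolding g_def by (metis gcd_ge_0_int int_nat_eq)
  have "t = n"
  proof (rule ccontr)
    assume "t \<noteq> n"
    then have n0: "n \<noteq> 0" and le: "t \<le> n - 1" using t by auto
    have "p ^ (n - 1) = p ^ t * p ^ (n - 1 - t)" using le by (metis le_add_diff_inverse power_add)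
    then have "x [^] (p ^ (n - 1)) = (x [^] g) [^] int (p ^ (n - 1 - t))"
      using x by (simp only: g int_pow_int nat_pow_pow)
    then show False using D_pow[OF xg] n n0 by simp
  qed
  then show ?thesis using g unfolding g_def by (metis gcd_dvd2)
qed

text \<open>The least exponent killing all generators modulo \<open>D\<close> is attained by one of
  them; rotate it into the place of \<open>c\<close> and use \<open>finite_c\<close>.\<close>

lemma exponent_of_abelianization:
  obtains n where "\<And>x. x \<in> carrier G \<Longrightarrow> x [^] (p ^ n) \<in> D"
    "\<And>g. \<lbrakk>g \<in> carrier G; g [^] (p ^ n) = \<one>\<rbrakk> \<Longrightarrow> central g"
proof -
  interpret sub: subgroup D G by (rule derived_is_subgroup) simp
  define n where "n = (LEAST n. a [^] (p ^ n) \<in> D \<and> b [^] (p ^ n) \<in> D \<and> c [^] (p ^ n) \<in> D)"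
  have "a [^] (p ^ s) \<in> D \<and> b [^] (p ^ s) \<in> D \<and> c [^] (p ^ s) \<in> D" by (simp add: p_power)
  then have n: "a [^] (p ^ n) \<in> D \<and> b [^] (p ^ n) \<in> D \<and> c [^] (p ^ n) \<in> D"
    unfolding n_def by (rule LeastI)
  have min: "n = 0 \<or> a [^] (p ^ (n - 1)) \<notin> D \<or> b [^] (p ^ (n - 1)) \<notin> D \<or> c [^] (p ^ (n - 1)) \<notin> D"
    using not_less_Least[of "n - 1" "\<lambda>n. a [^] (p ^ n) \<in> D \<and> b [^] (p ^ n) \<in> D \<and> c [^] (p ^ n) \<in> D"]
    unfolding n_def[symmetric] by auto
  interpret r1: p_three_generated_E G b c a p s by (rule rotate_p)
  interpret r2: p_three_generated_E G c a b p s by (rule r1.rotate_p)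
  have p0: "p ^ n > 0" using prime by (simp add: prime_gt_0_nat)
  have "central g" if g: "g \<in> carrier G" "g [^] (p ^ n) = \<one>" for g
  proof -
    from min consider "n = 0 \<or> c [^] (p ^ (n - 1)) \<notin> D" | "n = 0 \<or> a [^] (p ^ (n - 1)) \<notin> D"
      | "n = 0 \<or> b [^] (p ^ (n - 1)) \<notin> D" by blast
    then show ?thesis
    proof cases
      case 1 show ?thesis by (rule finite_c[OF p0 _ _ p_power_dvd[OF _ _ 1] g]) (use n in simp_all)
    next
      case 2 show ?thesis by (rule r1.finite_c[OF p0 _ _ p_power_dvd[OF _ _ 2] g]) (use n in simp_all)
    next
      case 3 show ?thesis by (rule r2.finite_c[OF p0 _ _ p_power_dvd[OF _ _ 3] g]) (use n in simp_all)
    qed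
  qed
  moreover have "x [^] (p ^ n) \<in> D" if x: "x \<in> carrier G" for x
  proof -
    obtain Q :: "'a set monoid" and \<pi> where Q: "comm_group Q" and hom: "group_hom G Q \<pi>"
      and ker: "\<And>x. x \<in> carrier G \<Longrightarrow> \<pi> x = \<one>\<^bsub>Q\<^esub> \<longleftrightarrow> x \<in> D" using abelianization by blast
    interpret Q: comm_group Q by (rule Q)
    interpret \<pi>: group_hom G Q \<pi> by (rule hom)
    have "\<pi> y [^]\<^bsub>Q\<^esub> (p ^ n) = \<one>\<^bsub>Q\<^esub>" if "y \<in> generate G {a, b, c}" for y
      using that gens_subset
    proof (induction y rule: generate_induct)
      case (gen y)
      then have "y [^] (p ^ n) \<in> D" "y \<in> carrier G" using n by auto
      then show ?case using ker[of "y [^] (p ^ n)"] by (simp add: \<pi>.hom_nat_pow)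
    qed (auto simp: Q.nat_pow_inv Q.nat_pow_distrib)
    then have "\<pi> (x [^] (p ^ n)) = \<one>\<^bsub>Q\<^esub>" using x generated by (simp add: \<pi>.hom_nat_pow)
    then show ?thesis using ker x by simp
  qed
  ultimately show thesis by (rule that[rotated])
qed

end

section \<open>The alternating triple commutator form\<close>

locale three_generated_engel2 = engel2_group + three_generated
begin

definition triple :: "'a \<Rightarrow> 'a \<Rightarrow> 'a \<Rightarrow> 'a" where
  "triple x y z = cm x (cm y z)"

lemma triple_closed [simp]:
  "\<lbrakk>x \<in> carrier G; y \<in> carrier G; z \<in> carrier G\<rbrakk> \<Longrightarrow> triple x y z \<in> carrier G"
  by (simp add: triple_def)

lemma triple_rot:
  "\<lbrakk>x \<in> carrier G; y \<in> carrier G; z \<in> carrier G\<rbrakk> \<Longrightarrow> triple y z x = triple x y z"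
  unfolding triple_def by (rule triple_cycle)

lemma triple_hom:
  assumes "y \<in> carrier G" "z \<in> carrier G"
  shows "group_hom G G (\<lambda>x. triple x y z)"
proof (unfold_locales, rule homI)
  fix x x' assume x: "x \<in> carrier G" "x' \<in> carrier G"
  have cen: "central (cm x' (cm y z))" by (rule triple_central[OF x(2) assms])
  then have "cm x' (cm y z) \<otimes> cm x (cm y z) = cm x (cm y z) \<otimes> cm x' (cm y z)"
    using x assms by (intro central_comm) auto
  then show "triple (x \<otimes> x') y z = triple x y z \<otimes> triple x' y z"
    using cm_mult_left[of x x' "cm y z"] x assms cen by (simp add: triple_def)
qed (use assms in simp)

lemma triple_same:
  assumes "x \<in> carrier G" "y \<in> carrier G"
  shows "triple x x y = \<one>" "triple x y x = \<one>" "triple y x x = \<one>"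
proof -
  show *: "triple y x x = \<one>" using assms by (simp add: triple_def cm_eq_one_iff)
  show "triple x x y = \<one>" "triple x y x = \<one>"
    using * triple_rot[of x x y] triple_rot[of y x x] assms by auto
qed

abbreviation t :: 'a where "t \<equiv> triple a b c"

lemma triple_gens: "{x, y, z} \<subseteq> {a, b, c} \<Longrightarrow> triple x y z \<in> {\<one>, t, inv t}"
proof -
  have 1: "triple a c b = inv t" unfolding triple_def by (rule triple_swap23) simp_all
  have 2: "triple c b a = inv t" using triple_rot[of a c b] 1 by simp
  have 3: "triple b a c = inv t" using triple_rot[of c b a] 2 by simp
  note 1 2 3
  moreover have "triple b c a = t" "triple c a b = t"
    using triple_rot[of a b c] triple_rot[of b c a] by simp_all
  ultimately show ?thesis if "{x, y, z} \<subseteq> {a, b, c}"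
    using that by (auto simp: triple_same)
qed

text \<open>An alternating trilinear form on three generators has its values in the span of one
  value. Rotating the arguments reduces linearity to the first argument.\<close>

lemma triple_in_generate:
  assumes "x \<in> carrier G" "y \<in> carrier G" "z \<in> carrier G"
  shows "triple x y z \<in> generate G {t}"
proof -
  interpret T: subgroup "generate G {t}" G by (rule generate_is_subgroup) simp
  have step: "triple x y z \<in> generate G {t}"
    if "\<And>x. x \<in> {a, b, c} \<Longrightarrow> triple x y z \<in> generate G {t}" "x \<in> carrier G" "y \<in> carrier G" "z \<in> carrier G"
    for x y z
  proof -
    interpret h: group_hom G G "\<lambda>x. triple x y z" by (rule triple_hom[OF that(3,4)])
    have "x \<in> generate G {a, b, c}" using that(2) generated by simp
    then show ?thesis using gens_subset
    proof (induction x rule: generate_induct)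
      case one show ?case using h.hom_one T.one_closed by simp
    next
      case (inv_gen s) then show ?case using h.hom_inv T.m_inv_closed by simp
    next
      case (mult u v) then show ?case using h.hom_mult T.m_closed by simp
    qed (use that in auto)
  qed
  have g: "triple x y z \<in> generate G {t}" if "{x, y, z} \<subseteq> {a, b, c}" for x y z
    using triple_gens[OF that] T.one_closed generate.incl[of t "{t}" G] generate.inv[of t "{t}" G] by auto
  have c: "x \<in> carrier G" if "x \<in> {a, b, c}" for x using that by auto
  have 1: "triple x y z \<in> generate G {t}" if "x \<in> carrier G" "y \<in> {a, b, c}" "z \<in> {a, b, c}" for x y z
    by (rule step) (use that g c in auto)
  have 2: "triple x y z \<in> generate G {t}" if "x \<in> carrier G" "y \<in> carrier G" "z \<in> {a, b, c}" for x y z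
  proof -
    have "triple y z x \<in> generate G {t}"
    proof (rule step)
      fix v assume v: "v \<in> {a, b, c}"
      show "triple v z x \<in> generate G {t}"
        using 1[OF that(1) v that(3)] triple_rot[of x v z] that(1) c[OF v] c[OF that(3)] by simp
    qed (use that c in auto)
    then show ?thesis using triple_rot[of x y z] that c by simp
  qed
  have "triple z x y \<in> generate G {t}"
  proof (rule step)
    fix v assume v: "v \<in> {a, b, c}"
    show "triple v x y \<in> generate G {t}"
      using 2[OF assms(1,2) v] triple_rot[of v x y] assms c[OF v] by simp
  qed (use assms in auto)
  then show ?thesis using triple_rot[of z x y] assms by simp
qed

lemma class_2_if_t:
  assumes "t = \<one>" "x \<in> carrier G" "y \<in> carrier G"
  shows "central (cm x y)"
proof -
  have "cm (cm x y) z = \<one>" if z: "z \<in> carrier G" for z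
  proof -
    have "triple z x y \<in> generate G {\<one>}" using triple_in_generate[OF z assms(2,3)] assms(1) by simp
    then have "cm z (cm x y) = \<one>" by (simp add: generate_one triple_def)
    then show ?thesis using cm_inv[of z "cm x y"] z assms by simp
  qed
  then show ?thesis
    using assms(2,3) by (intro central_iff_cm[THEN iffD2] conjI ballI cm_closed)
qed

text \<open>\<open>B x y = [x, y]\<^sup>d\<close> is an alternating form with values in \<open>\<langle>t\<rangle>\<close>. On three generators
  such a form is degenerate; \<open>x\<close> below spans its radical.\<close>

lemma class_2:
  fixes d :: nat
  assumes d: "\<And>x. x \<in> carrier G \<Longrightarrow> x [^] d \<in> D"
    and cen: "\<And>g. \<lbrakk>g \<in> carrier G; g [^] d = \<one>\<rbrakk> \<Longrightarrow> central g"
    and xy: "x \<in> carrier G" "y \<in> carrier G"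
  shows "central (cm x y)"
proof (rule class_2_if_t[OF _ xy])
  define B where "B x y = cm x y [^] d" for x y
  have Bc: "B x y \<in> carrier G" if "x \<in> carrier G" "y \<in> carrier G" for x y
    using that by (simp add: B_def)
  have B_alt: "B x y = cm (x [^] d) y" if "x \<in> carrier G" "y \<in> carrier G" for x y
    using that by (simp add: B_def cm_pow_left)
  have Bcen: "central (B x y)" if "x \<in> carrier G" "y \<in> carrier G" for x y
    unfolding B_alt[OF that] using cm_derived[OF d] that by blast
  have Bswap: "B y x = inv (B x y)" if "x \<in> carrier G" "y \<in> carrier G" for x y
    using that by (simp add: B_def cm_inv[symmetric, of x y] nat_pow_inv del: cm_inv)
  have Bself: "B x x = \<one>" if "x \<in> carrier G" for x using that by (simp add: B_def)
  have Bhom: "group_hom G G (\<lambda>x. B x y)" if y: "y \<in> carrier G" for y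
  proof (unfold_locales, rule homI)
    fix x x' assume x: "x \<in> carrier G" "x' \<in> carrier G"
    define w where "w = cm x' y \<otimes> cm x y"
    define f where "f = cm x (cm x' y)"
    have c: "w \<in> carrier G" "f \<in> carrier G" using x y by (simp_all add: w_def f_def)
    have fcen: "central f" unfolding f_def by (rule triple_central[OF x y])
    \<comment> \<open>The class 3 correction disappears after raising to the power \<open>d\<close>,
      because the values of \<open>B\<close> are already central.\<close>
    have "f [^] d = cm x (B x' y)" unfolding f_def B_def using x y by (simp add: cm_pow_right)
    also have "\<dots> = \<one>" using Bcen x y by simp
    finally have f1: "f [^] d = \<one>" .
    have "B (x \<otimes> x') y = (f \<otimes> w) [^] d"
      using cm_mult_left[OF x y] by (simp add: B_def f_def w_def)
    also have "\<dots> = w [^] d"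
      using pow_mult_distrib[OF central_comm[OF fcen c(1)] c(2,1)] f1 c by simp
    also have "\<dots> = B x' y \<otimes> B x y"
      unfolding w_def B_def
      by (rule pow_mult_distrib) (use x y in \<open>auto intro: derived_commute cm_in_derived\<close>)
    also have "\<dots> = B x y \<otimes> B x' y"
      by (rule central_comm) (use x y Bcen Bc in auto)
    finally show "B (x \<otimes> x') y = B x y \<otimes> B x' y" .
  qed (use y Bc in auto)
  have tc: "t \<in> carrier G" by simp
  have Bt: "\<exists>i::int. B x y = t [^] i" if "x \<in> carrier G" "y \<in> carrier G" for x y
  proof -
    interpret T: subgroup "generate G {t}" G by (rule generate_is_subgroup) simp
    \<comment> \<open>Commutators of \<open>D\<close> with the group are products of triple
      commutators and their inverses; \<open>B x y\<close> is one of them with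
      \<open>x [^] d\<close> in \<open>D\<close>.\<close>
    have "cm h y \<in> generate G {t}" if "h \<in> D" for h
      using that
    proof (induction h rule: derived_induct')
      case one then show ?case using \<open>y \<in> carrier G\<close> T.one_closed by simp
    next
      case (cm u v)
      have "cm (cm u v) y = inv (triple y u v)" using cm \<open>y \<in> carrier G\<close> by (simp add: triple_def cm_inv)
      then show ?case using triple_in_generate[of y u v] T.m_inv_closed cm \<open>y \<in> carrier G\<close> by simp
    next
      case (inv v)
      then have v: "v \<in> carrier G" "central (cm v y)"
        using derived_closed cm_derived \<open>y \<in> carrier G\<close> by blast+
      then have "cm (inv v) y = inv (cm v y)" using cm_inv_left \<open>y \<in> carrier G\<close> by blast
      then show ?case using inv T.m_inv_closed by simp
    next
      case (mult u v)
      have c: "u \<in> carrier G" "v \<in> carrier G" "central (cm v y)"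
        using mult derived_closed cm_derived \<open>y \<in> carrier G\<close> by blast+
      then have "cm (u \<otimes> v) y = cm v y \<otimes> cm u y"
        using cm_mult_left[of u v y] \<open>y \<in> carrier G\<close> by simp
      then show ?case using mult T.m_closed by simp
    qed
    then have "B x y \<in> generate G {t}" unfolding B_alt[OF that] using d that by blast
    then show ?thesis using generate_pow[OF tc] by auto
  qed
  obtain i j k :: int where ijk: "B a b = t [^] i" "B a c = t [^] j" "B b c = t [^] k"
    using Bt gens by metis
  \<comment> \<open>The vector (k, -j, i) is the kernel of the alternating 3 by 3 matrix with
    entries i, j, k above the diagonal.\<close>
  define x where "x = a [^] k \<otimes> (b [^] (- j) \<otimes> c [^] i)"
  have x: "x \<in> carrier G" by (simp add: x_def)
  have hom_x: "h x = h a [^] k \<otimes> (h b [^] (- j) \<otimes> h c [^] i)" if "group_hom G G h" for h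
  proof -
    interpret h: group_hom G G h by (rule that)
    show ?thesis by (simp add: x_def h.hom_int_pow)
  qed
  have inv_t: "inv (t [^] n) = t [^] (- n)" for n :: int by (simp add: int_pow_neg)
  have ba: "B b a = t [^] (- i)" "B c a = t [^] (- j)" "B c b = t [^] (- k)"
    using Bswap[of a b] Bswap[of a c] Bswap[of b c] by (simp_all add: ijk inv_t)
  have "B x y = \<one>" if "y \<in> {a, b, c}" for y
  proof -
    from that consider "y = a" | "y = b" | "y = c" by blast
    then show ?thesis
    proof cases
      case 1 then show ?thesis
        using hom_x[OF Bhom, of a] by (simp add: ba Bself int_pow_pow int_pow_mult[symmetric] mult.commute)
    next
      case 2 then show ?thesis
        using hom_x[OF Bhom, of b] by (simp add: ba ijk Bself int_pow_pow int_pow_mult[symmetric] mult.commute)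
    next
      case 3 then show ?thesis
        using hom_x[OF Bhom, of c] by (simp add: ba ijk Bself int_pow_pow int_pow_mult[symmetric] mult.commute)
    qed
  qed
  then have xc: "central (cm x y)" if y: "y \<in> {a, b, c}" for y
  proof (intro cen)
    show "cm x y \<in> carrier G" using x y gens_subset by blast
    show "cm x y [^] d = \<one>" using \<open>\<And>y. y \<in> {a, b, c} \<Longrightarrow> B x y = \<one>\<close>[OF y] by (simp only: B_def)
  qed
  have "triple c a b = t" "triple b c a = t" "triple a b c = t"
    using triple_rot[of a b c] triple_rot[of b c a] by simp_all
  have "triple x a b = \<one>" "triple x b c = \<one>" "triple x c a = \<one>"
    using triple_rot[of x a b] triple_rot[of x b c] triple_rot[of x c a]
      triple_rot[of b x a] triple_rot[of c x b] triple_rot[of a x c] xc x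
    unfolding triple_def by simp_all
  \<comment> \<open>In each triple two of the three generators in \<open>x\<close> repeat an
    argument, so only one power of \<open>t\<close> survives.\<close>
  then have "t [^] i = \<one>" "t [^] k = \<one>" "t [^] (- j) = \<one>"
    using hom_x[OF triple_hom, of a b] hom_x[OF triple_hom, of b c] hom_x[OF triple_hom, of c a]
      \<open>triple c a b = t\<close> \<open>triple b c a = t\<close>
    by (simp_all add: triple_same)
  then have "B a b = \<one>" using ijk by simp
  then have "central (cm a b)" by (intro cen) (simp_all add: B_def)
  then have "triple c a b = \<one>" by (simp add: triple_def)
  then show "t = \<one>" using \<open>triple c a b = t\<close> by simp
qed

end

section \<open>Words in groups of class 2\<close>

locale class2_group = group +
  assumes cm_is_central [simp]: "\<lbrakk>x \<in> carrier G; y \<in> carrier G\<rbrakk> \<Longrightarrow> central (cm x y)"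
begin

lemma cm_hom_left: "y \<in> carrier G \<Longrightarrow> group_hom G G (\<lambda>x. cm x y)"
proof (unfold_locales, rule homI)
  fix x x' assume y: "y \<in> carrier G" and x: "x \<in> carrier G" "x' \<in> carrier G"
  have "cm x' y \<otimes> cm x y = cm x y \<otimes> cm x' y"
    using x y by (intro central_comm) auto
  then show "cm (x \<otimes> x') y = cm x y \<otimes> cm x' y"
    using cm_mult_left[OF x y] x y by simp
qed simp

lemma cm_hom_right: "x \<in> carrier G \<Longrightarrow> group_hom G G (\<lambda>y. cm x y)"
proof (unfold_locales, rule homI)
  fix y y' assume x: "x \<in> carrier G" and y: "y \<in> carrier G" "y' \<in> carrier G"
  then show "cm x (y \<otimes> y') = cm x y \<otimes> cm x y'"
    using cm_mult_right[OF x y] by simp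
qed simp

lemma cm_int_pow:
  assumes "x \<in> carrier G" "y \<in> carrier G"
  shows "cm (x [^] (i::int)) (y [^] (j::int)) = cm x y [^] (i * j)"
proof -
  interpret l: group_hom G G "\<lambda>x. cm x (y [^] j)" using assms by (intro cm_hom_left) simp
  interpret r: group_hom G G "\<lambda>y. cm x y" using assms by (intro cm_hom_right)
  show ?thesis
    using assms by (simp add: l.hom_int_pow r.hom_int_pow int_pow_pow mult.commute)
qed

text \<open>With the commutators in this cyclic order, the commutator of two words is the cross product
  of their first three exponents.\<close>

definition word :: "'a \<Rightarrow> 'a \<Rightarrow> 'a \<Rightarrow> int \<Rightarrow> int \<Rightarrow> int \<Rightarrow> int \<Rightarrow> int \<Rightarrow> int \<Rightarrow> 'a" where
  "word x y z i j k l m n = x [^] i \<otimes> (y [^] j \<otimes> (z [^] k \<otimes>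
     (cm y z [^] l \<otimes> (cm z x [^] m \<otimes> cm x y [^] n))))"

context
  fixes x y z assumes xyz [simp]: "x \<in> carrier G" "y \<in> carrier G" "z \<in> carrier G"
begin

lemma word_closed [simp]: "word x y z i j k l m n \<in> carrier G"
  by (simp add: word_def)

text \<open>Collection: every exchange of letters leaves a central commutator with the product of
  the exponents. Moving \<open>z\<close> past \<open>x\<close> produces \<open>cm z x\<close>
  itself, the other two exchanges produce inverses, hence the one plus sign.\<close>

lemma word_mult:
  "word x y z i j k l m n \<otimes> word x y z i' j' k' l' m' n' =
   word x y z (i + i') (j + j') (k + k') (l + l' - k * j') (m + m' + k * i') (n + n' - j * i')"
proof -
  define u v w where "u = cm y z" and "v = cm z x" and "w = cm x y"
  have c: "u \<in> carrier G" "v \<in> carrier G" "w \<in> carrier G" by (simp_all add: u_def v_def w_def)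
  have cen: "central (u [^] q)" "central (v [^] q)" "central (w [^] q)" for q :: int
    by (simp_all add: u_def v_def w_def)
  have comm: "f [^] (q::int) \<otimes> g [^] (q'::int) = g [^] q' \<otimes> f [^] q"
    if "f \<in> {u, v, w}" "g \<in> carrier G" for f g q q'
    using that cen by (intro central_comm) auto
  have zx: "z [^] q \<otimes> x [^] q' = x [^] q' \<otimes> (z [^] q \<otimes> v [^] (q * q'))" for q q' :: int
  proof -
    have "z [^] q \<otimes> x [^] q' = v [^] (q * q') \<otimes> (x [^] q' \<otimes> z [^] q)"
      using cm_swap[of "z [^] q" "x [^] q'"] by (simp add: cm_int_pow v_def)
    also have "\<dots> = (x [^] q' \<otimes> z [^] q) \<otimes> v [^] (q * q')" by (rule central_comm[OF cen(2)]) simp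
    finally show ?thesis using c by (simp add: m_assoc)
  qed
  have yx: "y [^] q \<otimes> x [^] q' = x [^] q' \<otimes> (y [^] q \<otimes> w [^] (- (q * q')))" for q q' :: int
  proof -
    have "cm y x [^] (q * q') = w [^] (- (q * q'))"
      using cm_inv[of x y] by (simp add: w_def int_pow_neg[symmetric] int_pow_inv[symmetric])
        (metis cm_closed cm_inv int_pow_inv int_pow_neg xyz)
    then have "y [^] q \<otimes> x [^] q' = w [^] (- (q * q')) \<otimes> (x [^] q' \<otimes> y [^] q)"
      using cm_swap[of "y [^] q" "x [^] q'"] by (simp add: cm_int_pow)
    also have "\<dots> = (x [^] q' \<otimes> y [^] q) \<otimes> w [^] (- (q * q'))" by (rule central_comm[OF cen(3)]) simp
    finally show ?thesis using c by (simp add: m_assoc)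
  qed
  have zy: "z [^] q \<otimes> y [^] q' = y [^] q' \<otimes> (z [^] q \<otimes> u [^] (- (q * q')))" for q q' :: int
  proof -
    have "cm z y [^] (q * q') = u [^] (- (q * q'))"
      using cm_inv[of y z] by (simp add: u_def int_pow_neg[symmetric] int_pow_inv[symmetric])
        (metis cm_closed cm_inv int_pow_inv int_pow_neg xyz)
    then have "z [^] q \<otimes> y [^] q' = u [^] (- (q * q')) \<otimes> (y [^] q' \<otimes> z [^] q)"
      using cm_swap[of "z [^] q" "y [^] q'"] by (simp add: cm_int_pow)
    also have "\<dots> = (y [^] q' \<otimes> z [^] q) \<otimes> u [^] (- (q * q'))" by (rule central_comm[OF cen(1)]) simp
    finally show ?thesis using c by (simp add: m_assoc)
  qed
  have ux: "u [^] q \<otimes> x [^] q' = x [^] q' \<otimes> u [^] q" and uy: "u [^] q \<otimes> y [^] q' = y [^] q' \<otimes> u [^] q"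
    and uz: "u [^] q \<otimes> z [^] q' = z [^] q' \<otimes> u [^] q"
    and vx: "v [^] q \<otimes> x [^] q' = x [^] q' \<otimes> v [^] q" and vy: "v [^] q \<otimes> y [^] q' = y [^] q' \<otimes> v [^] q"
    and vz: "v [^] q \<otimes> z [^] q' = z [^] q' \<otimes> v [^] q"
    and wx: "w [^] q \<otimes> x [^] q' = x [^] q' \<otimes> w [^] q" and wy: "w [^] q \<otimes> y [^] q' = y [^] q' \<otimes> w [^] q"
    and wz: "w [^] q \<otimes> z [^] q' = z [^] q' \<otimes> w [^] q"
    and vu: "v [^] q \<otimes> u [^] q' = u [^] q' \<otimes> v [^] q"
    and wu: "w [^] q \<otimes> u [^] q' = u [^] q' \<otimes> w [^] q"
    and wv: "w [^] q \<otimes> v [^] q' = v [^] q' \<otimes> w [^] q"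
    for q q' :: int by (rule comm; use c in simp)+
  have add: "f [^] q \<otimes> f [^] q' = f [^] (q + q')" if "f \<in> carrier G" for f and q q' :: int
    using that by (rule int_pow_mult[symmetric])
  note adds = add[OF xyz(1)] add[OF xyz(2)] add[OF xyz(3)] add[OF c(1)] add[OF c(2)] add[OF c(3)]
  note rules = zx yx zy ux uy uz vx vy vz wx wy wz vu wu wv adds
  show ?thesis
    unfolding word_def u_def[symmetric] v_def[symmetric] w_def[symmetric]
    by (simp only: m_assoc rules rules[THEN mult_eq_lift] xyz c int_pow_closed m_closed)
      (simp only: diff_conv_add_uminus add.assoc add.commute add.left_commute mult.commute)
qed

lemma word_0: "word x y z 0 0 0 0 0 0 = \<one>"
  by (simp add: word_def)

lemma word_gens:
  "word x y z 1 0 0 0 0 0 = x" "word x y z 0 1 0 0 0 0 = y" "word x y z 0 0 1 0 0 0 = z"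
  by (simp_all add: word_def)

lemma word_cm_gens:
  "word x y z 0 0 0 1 0 0 = cm y z" "word x y z 0 0 0 0 1 0 = cm z x" "word x y z 0 0 0 0 0 1 = cm x y"
  by (simp_all add: word_def)

lemma word_inv:
  "inv (word x y z i j k l m n) =
   word x y z (- i) (- j) (- k) (- l - k * j) (- m + k * i) (- n - j * i)"
  by (rule inv_equality) (simp_all add: word_mult word_0 algebra_simps)

lemma word_pow:
  "word x y z i j k l m n [^] (r::nat) =
   word x y z (int r * i) (int r * j) (int r * k) (int r * l - int (r choose 2) * (k * j))
     (int r * m + int (r choose 2) * (k * i)) (int r * n - int (r choose 2) * (j * i))"
proof (induction r)
  case (Suc r)
  have "Suc r choose 2 = (r choose 2) + r"
    using binomial_Suc_Suc[of r 1] unfolding Suc_1 by simp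
  then show ?case by (simp add: Suc word_mult algebra_simps)
qed (simp add: word_0 numeral_2_eq_2)

lemma word_cm:
  "cm (word x y z i j k l m n) (word x y z i' j' k' l' m' n') =
   word x y z 0 0 0 (j * k' - k * j') (k * i' - i * k') (i * j' - j * i')"
proof -
  define s t where "s = word x y z i j k l m n" and "t = word x y z i' j' k' l' m' n'"
  have c: "s \<in> carrier G" "t \<in> carrier G" by (simp_all add: s_def t_def)
  have "s \<otimes> t = word x y z 0 0 0 (j * k' - k * j') (k * i' - i * k') (i * j' - j * i') \<otimes> (t \<otimes> s)"
    by (simp add: s_def t_def word_mult algebra_simps)
  then have "cm s t \<otimes> (t \<otimes> s) =
      word x y z 0 0 0 (j * k' - k * j') (k * i' - i * k') (i * j' - j * i') \<otimes> (t \<otimes> s)"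
    using cm_swap[OF c] by simp
  then show ?thesis using c unfolding s_def[symmetric] t_def[symmetric] by simp
qed

lemma word_central [simp]: "central (word x y z 0 0 0 l m n)"
  by (simp add: word_def)

lemma word_int_pow:
  "word x y z 0 0 0 l m n [^] (r::int) = word x y z 0 0 0 (r * l) (r * m) (r * n)"
  using word_pow[of 0 0 0 l m n "nat r"] word_pow[of 0 0 0 l m n "nat (- r)"]
  unfolding int_pow_def2 by (auto simp: word_inv simp del: pow_nat)

end

text \<open>Exponents divisible by \<open>d\<close> are absorbed into the central part through the
  rows of the matrix of the power map.\<close>

lemma word_reduce:
  assumes xyz: "x \<in> carrier G" "y \<in> carrier G" "z \<in> carrier G"
    and r: "x [^] (d::nat) = word x y z 0 0 0 m11 m12 m13" "y [^] d = word x y z 0 0 0 m21 m22 m23"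
      "z [^] d = word x y z 0 0 0 m31 m32 m33"
  shows "word x y z (int d * i) (int d * j) (int d * k) l m n =
    word x y z 0 0 0 (i * m11 + j * m21 + k * m31 + l) (i * m12 + j * m22 + k * m32 + m)
      (i * m13 + j * m23 + k * m33 + n)"
proof -
  have "word x y z (int d * i) (int d * j) (int d * k) l m n =
    (x [^] d) [^] i \<otimes> ((y [^] d) [^] j \<otimes> ((z [^] d) [^] k \<otimes> word x y z 0 0 0 l m n))"
    using xyz by (simp add: word_def int_pow_pow[symmetric] int_pow_int)
  also have "\<dots> = word x y z 0 0 0 (i * m11 + j * m21 + k * m31 + l) (i * m12 + j * m22 + k * m32 + m)
      (i * m13 + j * m23 + k * m33 + n)"
    unfolding r word_int_pow[OF xyz] word_mult[OF xyz] by (simp add: add.assoc)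
  finally show ?thesis .
qed

end

locale class2_three_generated = class2_group + three_generated
begin

abbreviation W :: "int \<Rightarrow> int \<Rightarrow> int \<Rightarrow> int \<Rightarrow> int \<Rightarrow> int \<Rightarrow> 'a" where
  "W \<equiv> word a b c"

lemma W_surj:
  assumes "g \<in> carrier G"
  obtains i j k l m n where "g = W i j k l m n"
proof -
  have "g \<in> generate G {a, b, c}" using assms generated by simp
  then have "\<exists>i j k l m n. g = W i j k l m n"
    using gens_subset
  proof (induction g rule: generate_induct)
    case one show ?case using word_0[of a b c] by (metis gens)
  next
    case (gen s) then show ?case using word_gens[of a b c] gens by (metis empty_iff insert_iff)
  next
    case (inv_gen s) then show ?case using word_inv[of a b c] gens by metis
  next
    case (mult s t) then show ?case using word_mult[of a b c] gens by metis
  qed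
  then show thesis using that by blast
qed

lemma derived_W:
  assumes "h \<in> D"
  obtains l m n where "h = W 0 0 0 l m n"
proof -
  have "\<exists>l m n. h = W 0 0 0 l m n"
    using assms
  proof (induction h rule: derived_induct)
    case one show ?case using word_0[of a b c] by (metis gens)
  next
    case (cm x y)
    obtain i j k l m n where x: "x = W i j k l m n" by (rule W_surj[OF cm(1)])
    obtain i' j' k' l' m' n' where y: "y = W i' j' k' l' m' n'" by (rule W_surj[OF cm(2)])
    show ?case unfolding x y word_cm[OF gens] by blast
  next
    case (inv_cm s)
    then obtain l m n where "s = W 0 0 0 l m n" by blast
    then have "inv s = W 0 0 0 (- l) (- m) (- n)" using word_inv[OF gens, of 0 0 0] by simp
    then show ?case by blast
  next
    case (mult s t)
    then obtain l m n l' m' n' where "s = W 0 0 0 l m n" "t = W 0 0 0 l' m' n'" by blast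
    then have "s \<otimes> t = W 0 0 0 (l + l') (m + m') (n + n')" by (simp add: word_mult[OF gens])
    then show ?case by blast
  qed
  then show thesis using that by blast
qed

text \<open>Von Dyck's theorem for the relatively free group of class 2.\<close>

lemma endo_of_kernel:
  assumes a1: "a1 \<in> carrier G" "b1 \<in> carrier G" "c1 \<in> carrier G"
    and ker: "\<And>i j k l m n. W i j k l m n = \<one> \<Longrightarrow> word a1 b1 c1 i j k l m n = \<one>"
  obtains \<alpha> where "\<alpha> \<in> hom G G"
    "\<And>i j k l m n. \<alpha> (W i j k l m n) = word a1 b1 c1 i j k l m n"
proof -
  let ?W1 = "word a1 b1 c1"
  define \<alpha> where "\<alpha> g = (SOME h. \<exists>i j k l m n. g = W i j k l m n \<and> h = ?W1 i j k l m n)" for g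
  have \<alpha>: "\<alpha> (W i j k l m n) = ?W1 i j k l m n" for i j k l m n
  proof -
    have "\<exists>h. \<exists>i' j' k' l' m' n'. W i j k l m n = W i' j' k' l' m' n' \<and> h = ?W1 i' j' k' l' m' n'"
      by blast
    from someI_ex[OF this] obtain i' j' k' l' m' n' where
      eq: "W i j k l m n = W i' j' k' l' m' n'" "\<alpha> (W i j k l m n) = ?W1 i' j' k' l' m' n'"
      unfolding \<alpha>_def by blast
    \<comment> \<open>Inverses and products of words have the same exponent formulas for every
      triple of elements, so this quotient and its counterpart in \<open>a1\<close>,
      \<open>b1\<close>, \<open>c1\<close> have equal exponents.\<close>
    have "inv (W i j k l m n) \<otimes> W i' j' k' l' m' n' = \<one>" using eq(1) by simp
    then have "inv (?W1 i j k l m n) \<otimes> ?W1 i' j' k' l' m' n' = \<one>"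
      unfolding word_inv[OF gens] word_mult[OF gens] word_inv[OF a1] word_mult[OF a1] by (rule ker)
    then have "?W1 i' j' k' l' m' n' = ?W1 i j k l m n"
      using inv_solve_left[of \<one> "?W1 i j k l m n" "?W1 i' j' k' l' m' n'"] a1 by auto
    then show ?thesis using eq(2) by simp
  qed
  show thesis
  proof (rule that[OF _ \<alpha>], rule homI)
    fix x assume "x \<in> carrier G"
    then obtain i j k l m n where x: "x = W i j k l m n" by (rule W_surj)
    show "\<alpha> x \<in> carrier G" unfolding x \<alpha> using a1 by simp
  next
    fix x y assume xy: "x \<in> carrier G" "y \<in> carrier G"
    obtain i j k l m n where x: "x = W i j k l m n" by (rule W_surj[OF xy(1)])
    obtain i' j' k' l' m' n' where y: "y = W i' j' k' l' m' n'" by (rule W_surj[OF xy(2)])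
    show "\<alpha> (x \<otimes> y) = \<alpha> x \<otimes> \<alpha> y"
      unfolding x y word_mult[OF gens] \<alpha> word_mult[OF a1] ..
  qed
qed

end

locale class2_three_generated_E = class2_three_generated + E_group
begin

lemma commute_of_kernel:
  assumes "a1 \<in> carrier G" "b1 \<in> carrier G" "c1 \<in> carrier G"
    and "\<And>i j k l m n. W i j k l m n = \<one> \<Longrightarrow> word a1 b1 c1 i j k l m n = \<one>"
  shows "cm (W i j k l m n) (word a1 b1 c1 i j k l m n) = \<one>"
proof -
  obtain \<alpha> where "\<alpha> \<in> hom G G"
    "\<And>i j k l m n. \<alpha> (W i j k l m n) = word a1 b1 c1 i j k l m n"
    using endo_of_kernel[OF assms] by blast
  then show ?thesis using endo_image_commute[of \<alpha> "W i j k l m n"] assms(1-3) cm_eq_one_iff by simp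
qed

text \<open>Under the assumption \<open>ker\<close>, the group is presented by the three power relations together with
  the relations among the commutators.\<close>

lemma commute_of_relations:
  fixes d :: nat
  assumes d: "a [^] d = W 0 0 0 m11 m12 m13" "b [^] d = W 0 0 0 m21 m22 m23" "c [^] d = W 0 0 0 m31 m32 m33"
    and ker: "\<And>i j k l m n. W i j k l m n = \<one> \<Longrightarrow> int d dvd i \<and> int d dvd j \<and> int d dvd k"
    and a1: "a1 \<in> carrier G" "b1 \<in> carrier G" "c1 \<in> carrier G"
    and d1: "a1 [^] d = word a1 b1 c1 0 0 0 m11 m12 m13" "b1 [^] d = word a1 b1 c1 0 0 0 m21 m22 m23"
      "c1 [^] d = word a1 b1 c1 0 0 0 m31 m32 m33"
    and cen: "\<And>l m n. W 0 0 0 l m n = \<one> \<Longrightarrow> word a1 b1 c1 0 0 0 l m n = \<one>"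
  shows "cm (W i j k l m n) (word a1 b1 c1 i j k l m n) = \<one>"
proof (rule commute_of_kernel[OF a1])
  fix i j k l m n assume 1: "W i j k l m n = \<one>"
  obtain i' where i: "i = int d * i'" using ker[OF 1] by (auto elim: dvdE)
  obtain j' where j: "j = int d * j'" using ker[OF 1] by (auto elim: dvdE)
  obtain k' where k: "k = int d * k'" using ker[OF 1] by (auto elim: dvdE)
  show "word a1 b1 c1 i j k l m n = \<one>"
    using 1 cen unfolding i j k word_reduce[OF gens d] word_reduce[OF a1 d1] by blast
qed

end

section \<open>Endomorphisms as matrices\<close>

lemma prime_dvd_cases:
  fixes p :: int
  assumes "prime p" "p dvd x * y" "\<not> p dvd x"
  shows "p dvd y"
  using assms prime_dvd_mult_iff by blast

text \<open>If \<open>p\<close> does not divide \<open>i\<close>, the conclusions of \<open>M\<close> for \<open>(i, j, k)\<close> force \<open>R\<close> to be the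
  orthogonal complement of \<open>(i, j, k)\<close> modulo \<open>p\<close>, and then too many vectors satisfy the premise of \<open>M\<close>.\<close>

lemma lattice_rank:
  fixes R :: "int \<Rightarrow> int \<Rightarrow> int \<Rightarrow> bool" and p :: int
  assumes "lattice3 R" and p: "prime p"
    and Rp: "R p 0 0" "R 0 p 0" "R 0 0 p" and ne: "\<not> (R 1 0 0 \<and> R 0 1 0 \<and> R 0 0 1)"
    and M: "\<And>x y z. R (x * m11 + y * m21 + z * m31) (x * m12 + y * m22 + z * m32) (x * m13 + y * m23 + z * m33)
      \<Longrightarrow> R 0 z (- y) \<and> R (- z) 0 x \<and> R y (- x) 0"
    and x: "R (i * m11 + j * m21 + k * m31) (i * m12 + j * m22 + k * m32) (i * m13 + j * m23 + k * m33)"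
  shows "p dvd i"
proof (rule ccontr)
  interpret lattice3 R by fact
  assume i: "\<not> p dvd i"
  have "coprime p i" using p i by (simp add: prime_imp_coprime)
  then obtain s t where st: "s * i + t * p = 1"
    using bezout_int[of i p] by (metis coprime_iff_gcd_eq_1 gcd.commute)
  \<comment> \<open>\<open>R\<close> contains p Z^3, and \<open>i\<close> is invertible modulo
    \<open>p\<close>.\<close>
  have div: "R l m n" if "R (i * l) (i * m) (i * n)" for l m n
  proof -
    have "R (s * (i * l) + (t * l * p + (t * m * 0 + t * n * 0))) (s * (i * m) + (t * l * 0 + (t * m * p + t * n * 0)))
        (s * (i * n) + (t * l * 0 + (t * m * 0 + t * n * p)))"
      by (intro add scale that Rp)
    moreover have "s * (i * q) + t * q * p = q" for q
    proof -
      have "s * (i * q) + t * q * p = (s * i + t * p) * q" by (simp add: algebra_simps)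
      then show ?thesis using st by simp
    qed
    ultimately show ?thesis by simp
  qed
  have r: "R 0 k (- j)" "R (- k) 0 i" "R j (- i) 0" using M[OF x] by blast+
  have notR: "\<not> R 1 0 0"
  proof
    assume 1: "R 1 0 0"
    have "R (j * 1 + - j) (j * 0 + - (- i)) (j * 0 + - 0)" by (intro add scale 1 neg r)
    moreover have "R (k * 1 + - k) (k * 0 + 0) (k * 0 + i)" by (intro add scale 1 r)
    ultimately have "R 0 1 0" "R 0 0 1" using div[of 0 1 0] div[of 0 0 1] by simp_all
    then show False using 1 ne by blast
  qed
  have c0: "p dvd c" if c: "R c 0 0" for c
  proof (rule ccontr)
    assume "\<not> p dvd c"
    then have "coprime p c" using p by (simp add: prime_imp_coprime)
    then obtain s t where "s * c + t * p = 1"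
      using bezout_int[of c p] by (metis coprime_iff_gcd_eq_1 gcd.commute)
    moreover have "R (s * c + t * p) (s * 0 + t * 0) (s * 0 + t * 0)" by (intro add scale c Rp)
    ultimately show False using notR by simp
  qed
  have R1: "p dvd i * l + j * m + k * n" if "R l m n" for l m n
  proof (rule c0)
    have "R (i * l + (m * j + (- n) * (- k))) (i * m + (m * (- i) + (- n) * 0)) (i * n + (m * 0 + (- n) * i))"
      by (intro add scale that r)
    then show "R (i * l + j * m + k * n) 0 0" by (simp add: algebra_simps)
  qed
  have R2: "R l m n" if dv: "p dvd i * l + j * m + k * n" for l m n
  proof (rule div)
    obtain q where q: "i * l + j * m + k * n = q * p" using dv by (metis dvd_def mult.commute)
    have "R (q * p + (- m * j + n * (- k))) (q * 0 + (- m * (- i) + n * 0)) (q * 0 + (- m * 0 + n * i))"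
      by (intro add scale Rp r)
    then show "R (i * l) (i * m) (i * n)" unfolding q[symmetric] by (simp add: algebra_simps)
  qed
  \<comment> \<open>\<open>f\<close> is the pairing of (x, y, z) M with (i, j, k). By
    \<open>key\<close>, its kernel modulo \<open>p\<close> consists of vectors parallel to (i, j,
    k), too few for a linear functional on a space of dimension 3.\<close>
  define f where "f x y z = x * (i * m11 + j * m12 + k * m13) + y * (i * m21 + j * m22 + k * m23)
    + z * (i * m31 + j * m32 + k * m33)" for x y z
  have key: "p dvd j * z - k * y \<and> p dvd k * x - i * z \<and> p dvd i * y - j * x" if "p dvd f x y z" for x y z
  proof -
    have "R (x * m11 + y * m21 + z * m31) (x * m12 + y * m22 + z * m32) (x * m13 + y * m23 + z * m33)"
      by (rule R2) (use that in \<open>simp add: f_def algebra_simps\<close>)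
    from M[OF this] show ?thesis
      using R1[of 0 z "- y"] R1[of "- z" 0 x] R1[of y "- x" 0] by (simp add: algebra_simps)
  qed
  define l1 l2 l3 where "l1 = f 1 0 0" and "l2 = f 0 1 0" and "l3 = f 0 0 1"
  have f: "f x y z = x * l1 + y * l2 + z * l3" for x y z
    by (simp add: f_def l1_def l2_def l3_def)
  \<comment> \<open>Vectors such as (0, l3, -l2) lie in the kernel of \<open>f\<close> by
    construction; they force all coefficients of \<open>f\<close> to vanish modulo
    \<open>p\<close>.\<close>
  have "p dvd i * l2" "p dvd i * l3" using key[of 0 l3 "- l2"] by (simp_all add: f)
  then have l23: "p dvd l2" "p dvd l3" using prime_dvd_cases[OF p _ i] by blast+
  have "p dvd - i * l1 - j * l2" using key[of l2 "- l1" 0] by (simp add: f)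
  then have "p dvd (- i * l1 - j * l2) + j * l2" using l23(1) by (intro dvd_add dvd_mult)
  then have "p dvd i * l1" by simp
  then have "p dvd l1" using prime_dvd_cases[OF p _ i] by blast
  have "p dvd f 0 1 0" using l23 by (simp add: l2_def)
  then show False using key[of 0 1 0] i by simp
qed

definition det3 :: "int \<Rightarrow> int \<Rightarrow> int \<Rightarrow> int \<Rightarrow> int \<Rightarrow> int \<Rightarrow> int \<Rightarrow> int \<Rightarrow> int \<Rightarrow> int" where
  "det3 m11 m12 m13 m21 m22 m23 m31 m32 m33 =
    m11 * (m22 * m33 - m23 * m32) + m12 * (m23 * m31 - m21 * m33) + m13 * (m21 * m32 - m22 * m31)"

text \<open>Three cyclic shifts of \<open>lattice_rank\<close> show that only p Z^3 is sent into
  \<open>R\<close> by M. Multiplying with the adjugate of M gives the other two claims, since adj(M)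
  M = det(M).\<close>

lemma lattice_core:
  fixes R :: "int \<Rightarrow> int \<Rightarrow> int \<Rightarrow> bool" and p :: int
  assumes R: "lattice3 R" and p: "prime p"
    and Rp: "R p 0 0" "R 0 p 0" "R 0 0 p" and ne: "\<not> (R 1 0 0 \<and> R 0 1 0 \<and> R 0 0 1)"
    and M: "\<And>x y z. R (x * m11 + y * m21 + z * m31) (x * m12 + y * m22 + z * m32) (x * m13 + y * m23 + z * m33)
      \<Longrightarrow> R 0 z (- y) \<and> R (- z) 0 x \<and> R y (- x) 0"
  shows lattice_core_kernel: "
      R (x * m11 + y * m21 + z * m31) (x * m12 + y * m22 + z * m32) (x * m13 + y * m23 + z * m33)
      \<Longrightarrow> p dvd x \<and> p dvd y \<and> p dvd z"
    and lattice_core_det: "\<not> p dvd det3 m11 m12 m13 m21 m22 m23 m31 m32 m33" (is "\<not> p dvd ?d")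
    and lattice_core_R: "R l m n \<Longrightarrow> p dvd l \<and> p dvd m \<and> p dvd n"
proof -
  interpret lattice3 R by fact
  let ?R = "\<lambda>x y z. R (x * m11 + y * m21 + z * m31) (x * m12 + y * m22 + z * m32)
    (x * m13 + y * m23 + z * m33)"
  have 1: "p dvd x \<and> p dvd y \<and> p dvd z" if x: "?R x y z" for x y z
  proof (intro conjI)
    show "p dvd x" by (rule lattice_rank[OF R p Rp ne M x])
    have "lattice3 (\<lambda>l m n. R n l m)" by unfold_locales (use zero neg add in auto)
    then show "p dvd y"
    proof (rule lattice_rank[OF _ p, of "\<lambda>l m n. R n l m" m22 m32 m12 m23 m33 m13 m21 m31 m11 y z x])
      show "R (- y) 0 z \<and> R x (- z) 0 \<and> R 0 y (- x)"
        if "R (x * m21 + y * m31 + z * m11) (x * m22 + y * m32 + z * m12) (x * m23 + y * m33 + z * m13)"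
        for x y z
        using M[of z x y] that by (simp add: ac_simps)
    qed (use Rp ne x in \<open>auto simp: ac_simps\<close>)
    have "lattice3 (\<lambda>l m n. R m n l)" by unfold_locales (use zero neg add in auto)
    then show "p dvd z"
    proof (rule lattice_rank[OF _ p, of "\<lambda>l m n. R m n l" m33 m13 m23 m31 m11 m21 m32 m12 m22 z x y])
      show "R z (- y) 0 \<and> R 0 x (- z) \<and> R (- x) 0 y"
        if "R (x * m31 + y * m11 + z * m21) (x * m32 + y * m12 + z * m22) (x * m33 + y * m13 + z * m23)"
        for x y z
        using M[of y z x] that by (simp add: ac_simps)
    qed (use Rp ne x in \<open>auto simp: ac_simps\<close>)
  qed
  show "?R x y z \<Longrightarrow> p dvd x \<and> p dvd y \<and> p dvd z" by (rule 1)
  have R0: "R l m n" if dv: "p dvd l" "p dvd m" "p dvd n" for l m n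
  proof -
    obtain l' m' n' where "l = p * l'" "m = p * m'" "n = p * n'" using dv by (auto elim!: dvdE)
    moreover have "R (l' * p + (m' * 0 + n' * 0)) (l' * 0 + (m' * p + n' * 0)) (l' * 0 + (m' * 0 + n' * p))"
      by (intro add scale Rp)
    ultimately show ?thesis by (simp add: ac_simps)
  qed
  have adj: "p dvd l * (m22 * m33 - m23 * m32) + m * (m23 * m31 - m21 * m33) + n * (m21 * m32 - m22 * m31)
    \<and> p dvd l * (m13 * m32 - m12 * m33) + m * (m11 * m33 - m13 * m31) + n * (m12 * m31 - m11 * m32)
    \<and> p dvd l * (m12 * m23 - m13 * m22) + m * (m13 * m21 - m11 * m23) + n * (m11 * m22 - m12 * m21)"
    if "R (?d * l) (?d * m) (?d * n)" for l m n
    by (rule 1) (use that in \<open>simp add: det3_def algebra_simps\<close>)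
  show nd: "\<not> p dvd ?d"
  proof
    assume d: "p dvd ?d"
    have cof: "p dvd m22 * m33 - m23 * m32" "p dvd m13 * m32 - m12 * m33" "p dvd m12 * m23 - m13 * m22"
      "p dvd m23 * m31 - m21 * m33" "p dvd m11 * m33 - m13 * m31" "p dvd m13 * m21 - m11 * m23"
      "p dvd m21 * m32 - m22 * m31" "p dvd m12 * m31 - m11 * m32" "p dvd m11 * m22 - m12 * m21"
      using adj[of 1 0 0] adj[of 0 1 0] adj[of 0 0 1] R0 d by simp_all
    \<comment> \<open>All minors vanish modulo \<open>p\<close>, so (m21, -m11, 0) M lies in p Z^3
      and \<open>p\<close> divides \<open>m11\<close>; the other columns give the rest of the first
      row. But then (1, 0, 0) M lies in \<open>R\<close>.\<close>
    have "p dvd m11" using 1[of m21 "- m11" 0] R0 cof by (simp add: algebra_simps dvd_diff_commute)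
    moreover have "p dvd m12" using 1[of m22 "- m12" 0] R0 cof by (simp add: algebra_simps dvd_diff_commute)
    moreover have "p dvd m13" using 1[of m23 "- m13" 0] R0 cof by (simp add: algebra_simps dvd_diff_commute)
    ultimately have "p dvd 1" using 1[of 1 0 0] R0 by simp
    then show False using p by (simp add: not_prime_unit)
  qed
  show "p dvd l \<and> p dvd m \<and> p dvd n" if R: "R l m n"
  proof -
    let ?x = "l * (m22 * m33 - m23 * m32) + m * (m23 * m31 - m21 * m33) + n * (m21 * m32 - m22 * m31)"
    let ?y = "l * (m13 * m32 - m12 * m33) + m * (m11 * m33 - m13 * m31) + n * (m12 * m31 - m11 * m32)"
    let ?z = "l * (m12 * m23 - m13 * m22) + m * (m13 * m21 - m11 * m23) + n * (m11 * m22 - m12 * m21)"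
    have "p dvd ?x" "p dvd ?y" "p dvd ?z" using adj[OF scale[OF R]] by blast+
    then have "p dvd ?x * m11 + ?y * m21 + ?z * m31" "p dvd ?x * m12 + ?y * m22 + ?z * m32"
      "p dvd ?x * m13 + ?y * m23 + ?z * m33" by simp_all
    moreover have "?x * m11 + ?y * m21 + ?z * m31 = ?d * l" "?x * m12 + ?y * m22 + ?z * m32 = ?d * m"
      "?x * m13 + ?y * m23 + ?z * m33 = ?d * n" by (simp_all add: det3_def algebra_simps)
    ultimately have "p dvd ?d * l" "p dvd ?d * m" "p dvd ?d * n" by simp_all
    then show ?thesis using prime_dvd_cases[OF p _ nd] by blast
  qed
qed

section \<open>Freeness of the abelianization and of the derived subgroup, and the matrix of the
  power map\<close>

locale class2_p_three_generated_E = class2_three_generated_E +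
  fixes p r s :: nat
  assumes prime: "prime p" and p_power: "x \<in> carrier G \<Longrightarrow> x [^] (p ^ s) = \<one>"
    and abel_exp: "x \<in> carrier G \<Longrightarrow> x [^] (p ^ r) \<in> D"
    and exp_central: "\<lbrakk>g \<in> carrier G; g [^] (p ^ r) = \<one>\<rbrakk> \<Longrightarrow> central g"
    and noncomm: "cm b c \<noteq> \<one> \<or> cm c a \<noteq> \<one> \<or> cm a b \<noteq> \<one>"
begin

abbreviation Z :: "int \<Rightarrow> int \<Rightarrow> int \<Rightarrow> 'a" where
  "Z l m n \<equiv> W 0 0 0 l m n"

text \<open>With q = 1 these are the relations among the commutators themselves; larger q isolates
  the top layer of the derived subgroup.\<close>

lemma Z_lattice: "lattice3 (\<lambda>l m n. Z (q * l) (q * m) (q * n) = \<one>)"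
proof
  show "Z (q * 0) (q * 0) (q * 0) = \<one>" by (simp add: word_0)
  show "Z (q * - i) (q * - j) (q * - k) = \<one>" if "Z (q * i) (q * j) (q * k) = \<one>" for i j k
    using that word_inv[OF gens, of 0 0 0 "q * i" "q * j" "q * k"] by simp
  show "Z (q * (i + i')) (q * (j + j')) (q * (k + k')) = \<one>"
    if "Z (q * i) (q * j) (q * k) = \<one>" "Z (q * i') (q * j') (q * k') = \<one>" for i j k i' j' k'
    using that word_mult[OF gens, of 0 0 0 "q * i" "q * j" "q * k" 0 0 0 "q * i'" "q * j'" "q * k'"]
    by (simp add: distrib_left)
qed

text \<open>\<open>p ^ e_exp\<close> is the exponent of the derived subgroup, the modulus e of the
  overview.\<close>

definition e_exp :: nat where
  "e_exp = (LEAST m. Z (int (p ^ m)) 0 0 = \<one> \<and> Z 0 (int (p ^ m)) 0 = \<one> \<and> Z 0 0 (int (p ^ m)) = \<one>)"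

text \<open>The bound by \<open>r\<close> holds since [x, y]^d = [x^d, y] and x^d lies in the
  central subgroup \<open>D\<close>; positivity is noncommutativity.\<close>

lemma e_exp:
  "Z (int (p ^ e_exp)) 0 0 = \<one>" "Z 0 (int (p ^ e_exp)) 0 = \<one>" "Z 0 0 (int (p ^ e_exp)) = \<one>"
  "e_exp \<le> r" "e_exp > 0"
  "\<not> (Z (int (p ^ (e_exp - 1))) 0 0 = \<one> \<and> Z 0 (int (p ^ (e_exp - 1))) 0 = \<one> \<and>
      Z 0 0 (int (p ^ (e_exp - 1))) = \<one>)"
proof -
  let ?P = "\<lambda>m. Z (int (p ^ m)) 0 0 = \<one> \<and> Z 0 (int (p ^ m)) 0 = \<one> \<and> Z 0 0 (int (p ^ m)) = \<one>"
  have "cm x y [^] (p ^ r) = \<one>" if xy: "x \<in> carrier G" "y \<in> carrier G" for x y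
  proof -
    obtain l m k where "x [^] (p ^ r) = Z l m k" by (rule derived_W[OF abel_exp[OF xy(1)]])
    then have "cm (x [^] int (p ^ r)) (y [^] (1::int)) = \<one>"
      using xy by (simp add: int_pow_int del: of_nat_power)
    then show ?thesis unfolding cm_int_pow[OF xy] by (simp add: int_pow_int del: of_nat_power)
  qed
  then have P_r: "?P r" by (simp add: word_def int_pow_int del: of_nat_power)
  show "e_exp \<le> r" unfolding e_exp_def by (rule Least_le[of ?P, OF P_r])
  have P: "?P e_exp" unfolding e_exp_def by (rule LeastI[of ?P, OF P_r])
  then show "Z (int (p ^ e_exp)) 0 0 = \<one>" "Z 0 (int (p ^ e_exp)) 0 = \<one>" "Z 0 0 (int (p ^ e_exp)) = \<one>"
    by blast+
  show pos: "e_exp > 0"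
  proof (rule ccontr)
    assume "\<not> e_exp > 0"
    then have "?P 0" using P by simp
    then show False using noncomm by (simp add: word_cm_gens)
  qed
  then have "e_exp - 1 < e_exp" by simp
  then show "\<not> ?P (e_exp - 1)" unfolding e_exp_def by (rule not_less_Least[of _ ?P])
qed

lemma Z_dvd: assumes "int (p ^ e_exp) dvd l" "int (p ^ e_exp) dvd m" "int (p ^ e_exp) dvd k"
  shows "Z l m k = \<one>"
proof -
  interpret lattice3 "\<lambda>l m n. Z (1 * l) (1 * m) (1 * n) = \<one>" by (rule Z_lattice)
  obtain l' m' k' where lmk: "l = l' * int (p ^ e_exp)" "m = m' * int (p ^ e_exp)" "k = k' * int (p ^ e_exp)"
    using assms by (metis dvd_def mult.commute)
  have "Z (1 * (l' * int (p ^ e_exp) + (m' * 0 + k' * 0))) (1 * (l' * 0 + (m' * int (p ^ e_exp) + k' * 0)))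
     (1 * (l' * 0 + (m' * 0 + k' * int (p ^ e_exp)))) = \<one>"
    by (intro add scale) (use e_exp in simp_all)
  then show ?thesis by (simp add: lmk)
qed

end

text \<open>\<open>A M = M cof(A)\<close> modulo \<open>e\<close>, up to a correction with \<open>C\<close>. The rows of \<open>M\<close> are the \<open>d\<close>-th powers
  of the generators in terms of commutators, those of \<open>A\<close> the images of the generators, and those of
  \<open>cof(A)\<close> the images of the commutators; \<open>C\<close> is the binomial coefficient in the \<open>d\<close>-th power of a product.\<close>

definition endo_cond :: "int \<Rightarrow> int \<Rightarrow> int \<Rightarrow> int \<Rightarrow> int \<Rightarrow> int \<Rightarrow> int \<Rightarrow> int \<Rightarrow> int \<Rightarrow> int \<Rightarrow> int
  \<Rightarrow> int \<Rightarrow> int \<Rightarrow> int \<Rightarrow> int \<Rightarrow> int \<Rightarrow> int \<Rightarrow> int \<Rightarrow> int \<Rightarrow> int \<Rightarrow> bool" where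
  "endo_cond e C m11 m12 m13 m21 m22 m23 m31 m32 m33 a11 a12 a13 a21 a22 a23 a31 a32 a33 \<longleftrightarrow>
    (let k11 = a22 * a33 - a23 * a32; k12 = a23 * a31 - a21 * a33; k13 = a21 * a32 - a22 * a31;
         k21 = a32 * a13 - a33 * a12; k22 = a33 * a11 - a31 * a13; k23 = a31 * a12 - a32 * a11;
         k31 = a12 * a23 - a13 * a22; k32 = a13 * a21 - a11 * a23; k33 = a11 * a22 - a12 * a21
     in e dvd (a11 * m11 + a12 * m21 + a13 * m31 - C * (a13 * a12)) - (m11 * k11 + m12 * k21 + m13 * k31) \<and>
        e dvd (a11 * m12 + a12 * m22 + a13 * m32 + C * (a13 * a11)) - (m11 * k12 + m12 * k22 + m13 * k32) \<and>
        e dvd (a11 * m13 + a12 * m23 + a13 * m33 - C * (a12 * a11)) - (m11 * k13 + m12 * k23 + m13 * k33) \<and>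
        e dvd (a21 * m11 + a22 * m21 + a23 * m31 - C * (a23 * a22)) - (m21 * k11 + m22 * k21 + m23 * k31) \<and>
        e dvd (a21 * m12 + a22 * m22 + a23 * m32 + C * (a23 * a21)) - (m21 * k12 + m22 * k22 + m23 * k32) \<and>
        e dvd (a21 * m13 + a22 * m23 + a23 * m33 - C * (a22 * a21)) - (m21 * k13 + m22 * k23 + m23 * k33) \<and>
        e dvd (a31 * m11 + a32 * m21 + a33 * m31 - C * (a33 * a32)) - (m31 * k11 + m32 * k21 + m33 * k31) \<and>
        e dvd (a31 * m12 + a32 * m22 + a33 * m32 + C * (a33 * a31)) - (m31 * k12 + m32 * k22 + m33 * k32) \<and>
        e dvd (a31 * m13 + a32 * m23 + a33 * m33 - C * (a32 * a31)) - (m31 * k13 + m32 * k23 + m33 * k33))"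

definition scalar_mod :: "int \<Rightarrow> int \<Rightarrow> int \<Rightarrow> int \<Rightarrow> int \<Rightarrow> int \<Rightarrow> int \<Rightarrow> int \<Rightarrow> int \<Rightarrow> int \<Rightarrow> bool" where
  "scalar_mod e a11 a12 a13 a21 a22 a23 a31 a32 a33 \<longleftrightarrow>
    e dvd a12 \<and> e dvd a13 \<and> e dvd a21 \<and> e dvd a23 \<and> e dvd a31 \<and> e dvd a32 \<and>
    e dvd a11 - a22 \<and> e dvd a11 - a33"

context class2_p_three_generated_E
begin

definition C :: int where "C = int (p ^ r choose 2)"

text \<open>\<open>cond\<close> says that the images of the generators satisfy the power relations,
  so they define an endomorphism. Commuting with the images of \<open>a\<close>, \<open>b\<close>,
  \<open>c\<close> kills the off-diagonal entries; the products \<open>a b\<close> and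
  \<open>a c\<close> equate the diagonal ones.\<close>

lemma scalar_of_endo_cond:
  assumes M: "a [^] (p ^ r) = Z m11 m12 m13" "b [^] (p ^ r) = Z m21 m22 m23" "c [^] (p ^ r) = Z m31 m32 m33"
    and ker: "\<And>i j k l m n. W i j k l m n = \<one> \<Longrightarrow> int (p ^ r) dvd i \<and> int (p ^ r) dvd j \<and> int (p ^ r) dvd k"
    and Zker: "\<And>l m n. Z l m n = \<one> \<Longrightarrow> e dvd l \<and> e dvd m \<and> e dvd n"
    and e: "e = int (p ^ e_exp)"
    and cond: "endo_cond e C m11 m12 m13 m21 m22 m23 m31 m32 m33 a11 a12 a13 a21 a22 a23 a31 a32 a33"
  shows "scalar_mod e a11 a12 a13 a21 a22 a23 a31 a32 a33"
proof -
  define k11 k12 k13 where "k11 = a22 * a33 - a23 * a32" and "k12 = a23 * a31 - a21 * a33" and "k13 = a21 * a32 - a22 * a31"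
  define k21 k22 k23 where "k21 = a32 * a13 - a33 * a12" and "k22 = a33 * a11 - a31 * a13" and "k23 = a31 * a12 - a32 * a11"
  define k31 k32 k33 where "k31 = a12 * a23 - a13 * a22" and "k32 = a13 * a21 - a11 * a23" and "k33 = a11 * a22 - a12 * a21"
  define a1 b1 c1 where "a1 = W a11 a12 a13 0 0 0" and "b1 = W a21 a22 a23 0 0 0" and "c1 = W a31 a32 a33 0 0 0"
  have G: "a1 \<in> carrier G" "b1 \<in> carrier G" "c1 \<in> carrier G" by (simp_all add: a1_def b1_def c1_def)
  have Z_cong: "Z l m n = Z l' m' n'" if "e dvd l - l'" "e dvd m - m'" "e dvd n - n'" for l m n l' m' n'
  proof -
    have "Z l m n = Z l' m' n' \<otimes> Z (l - l') (m - m') (n - n')" by (simp add: word_mult)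
    also have "Z (l - l') (m - m') (n - n') = \<one>" using that unfolding e by (rule Z_dvd)
    finally show ?thesis by simp
  qed
  have cms: "cm b1 c1 = Z k11 k12 k13" "cm c1 a1 = Z k21 k22 k23" "cm a1 b1 = Z k31 k32 k33"
    by (simp_all add: a1_def b1_def c1_def word_cm k11_def k12_def k13_def k21_def k22_def k23_def
        k31_def k32_def k33_def mult.commute)
  have word1: "word a1 b1 c1 i j k l m n = a1 [^] i \<otimes> (b1 [^] j \<otimes> (c1 [^] k \<otimes>
      Z (l * k11 + m * k21 + n * k31) (l * k12 + m * k22 + n * k32) (l * k13 + m * k23 + n * k33)))"
    for i j k l m n
    unfolding word_def[of a1 b1 c1] cms word_int_pow[OF gens] by (simp add: word_mult add.assoc)
  have word0: "word a1 b1 c1 0 0 0 l m n =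
      Z (l * k11 + m * k21 + n * k31) (l * k12 + m * k22 + n * k32) (l * k13 + m * k23 + n * k33)"
    for l m n unfolding word1 using G by simp
  have pow: "W x y z 0 0 0 [^] (p ^ r) = Z (x * m11 + y * m21 + z * m31 - C * (z * y))
      (x * m12 + y * m22 + z * m32 + C * (z * x)) (x * m13 + y * m23 + z * m33 - C * (y * x))" for x y z
    unfolding word_pow[OF gens] word_reduce[OF gens M] C_def by simp
  have comm: "cm (W i j k l m n) (word a1 b1 c1 i j k l m n) = \<one>" for i j k l m n
  proof (rule commute_of_relations[OF M ker G])
    note condK = cond[unfolded endo_cond_def Let_def, folded k11_def k12_def k13_def k21_def k22_def
        k23_def k31_def k32_def k33_def]
    show "a1 [^] (p ^ r) = word a1 b1 c1 0 0 0 m11 m12 m13"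
      unfolding word0 unfolding a1_def pow using condK by (intro Z_cong) blast+
    show "b1 [^] (p ^ r) = word a1 b1 c1 0 0 0 m21 m22 m23"
      unfolding word0 unfolding b1_def pow using condK by (intro Z_cong) blast+
    show "c1 [^] (p ^ r) = word a1 b1 c1 0 0 0 m31 m32 m33"
      unfolding word0 unfolding c1_def pow using condK by (intro Z_cong) blast+
    fix l m n assume "Z l m n = \<one>"
    then have "e dvd l" "e dvd m" "e dvd n" using Zker by blast+
    then have "Z (l * k11 + m * k21 + n * k31) (l * k12 + m * k22 + n * k32) (l * k13 + m * k23 + n * k33) = \<one>"
      unfolding e by (intro Z_dvd) auto
    then show "word a1 b1 c1 0 0 0 l m n = \<one>" by (simp add: word1)
  qed simp_all
  have "Z 0 0 0 = \<one>" by (simp add: word_0)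
  have 1: "cm (W 1 0 0 0 0 0) a1 = \<one>" using comm[of 1 0 0 0 0 0] G \<open>Z 0 0 0 = \<one>\<close> by (simp add: word1)
  have 2: "cm (W 0 1 0 0 0 0) b1 = \<one>" using comm[of 0 1 0 0 0 0] G \<open>Z 0 0 0 = \<one>\<close> by (simp add: word1)
  have 3: "cm (W 0 0 1 0 0 0) c1 = \<one>" using comm[of 0 0 1 0 0 0] G \<open>Z 0 0 0 = \<one>\<close> by (simp add: word1)
  have 4: "cm (W 1 1 0 0 0 0) (a1 \<otimes> b1) = \<one>" using comm[of 1 1 0 0 0 0] G \<open>Z 0 0 0 = \<one>\<close> by (simp add: word1)
  have 5: "cm (W 1 0 1 0 0 0) (a1 \<otimes> c1) = \<one>" using comm[of 1 0 1 0 0 0] G \<open>Z 0 0 0 = \<one>\<close> by (simp add: word1)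
  have d: "e dvd a12" "e dvd a13" "e dvd a21" "e dvd a23" "e dvd a31" "e dvd a32"
    using 1 2 3 Zker unfolding a1_def b1_def c1_def word_cm[OF gens]
    by (metis add.inverse_inverse diff_0 dvd_minus_iff mult_zero_left mult_1 diff_zero)+
  have "e dvd (1 * (a12 + a22) - 1 * (a11 + a21))" "e dvd (1 * (a11 + a31) - 1 * (a13 + a33))"
    using 4 5 Zker unfolding a1_def b1_def c1_def word_mult[OF gens] word_cm[OF gens] by blast+
  then have "e dvd (1 * (a12 + a22) - 1 * (a11 + a21)) + (a21 - a12)"
    "e dvd (1 * (a11 + a31) - 1 * (a13 + a33)) + (a13 - a31)"
    using d by (blast intro: dvd_add dvd_diff)+
  then have "e dvd a22 - a11" "e dvd a11 - a33" by simp_all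
  then show ?thesis using d by (simp add: scalar_mod_def dvd_diff_commute)
qed

end

text \<open>If \<open>d \<noteq> 2\<close>, then \<open>p\<close> divides the binomial coefficient \<open>d\<close> over 2, so the \<open>d\<close>-th power
  map is additive up to \<open>p\<close>-th powers.\<close>

locale class2_p_not_2 = class2_p_three_generated_E +
  assumes d_not_2: "p ^ r \<noteq> 2"
begin

lemma p_dvd_C: "int p dvd C"
proof -
  have r: "r > 0" using e_exp(4,5) by simp
  have "2 * (p ^ r choose 2) = p ^ r * (p ^ r - 1)" by (rule twice_choose_two)
  then obtain r' where r': "r = Suc r'" and eq: "2 * (p ^ r choose 2) = p * (p ^ r' * (p ^ r - 1))"
    using r by (cases r) auto
  have "p dvd (p ^ r choose 2)"
  proof (cases "p = 2")
    case True
    then have "r' \<noteq> 0" using d_not_2 r' by (cases r') auto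
    then have "even (p ^ r' * (p ^ r - 1))" using True by simp
    moreover have "(p ^ r choose 2) = p ^ r' * (p ^ r - 1)" using eq True by simp
    ultimately show ?thesis using True by simp
  next
    case False
    then have "\<not> p dvd 2" using prime by (metis primes_dvd_imp_eq two_is_prime_nat)
    moreover have "p dvd 2 * (p ^ r choose 2)" unfolding eq by simp
    ultimately show ?thesis using prime prime_dvd_mult_iff by blast
  qed
  then show ?thesis unfolding C_def by simp
qed

text \<open>The \<open>q\<close>-th powers of commutators have order dividing \<open>p\<close> and
  are not all trivial, so relations among them are linear over the field with \<open>p\<close>
  elements.\<close>

definition q :: int where "q = int (p ^ (e_exp - 1))"

lemma q: "int (p ^ e_exp) = q * int p"
  using e_exp(5) unfolding q_def by (cases e_exp) auto

lemma q_dvd: "int (p ^ e_exp) dvd q * (C * x)"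
  unfolding q using p_dvd_C by (simp add: mult_dvd_mono dvd_mult2)

context
  fixes m11 m12 m13 m21 m22 m23 m31 m32 m33
  assumes M: "a [^] (p ^ r) = Z m11 m12 m13" "b [^] (p ^ r) = Z m21 m22 m23" "c [^] (p ^ r) = Z m31 m32 m33"
begin

abbreviation R :: "int \<Rightarrow> int \<Rightarrow> int \<Rightarrow> bool" where
  "R l m k \<equiv> Z (q * l) (q * m) (q * k) = \<one>"

text \<open>After the power \<open>q\<close> the quadratic correction is gone, since
  \<open>p\<close> divides \<open>C\<close> and \<open>q * p\<close> is the exponent of the derived
  subgroup.\<close>

lemma pow_d_q:
  "(W x y z 0 0 0 [^] (p ^ r)) [^] q =
   Z (q * (x * m11 + y * m21 + z * m31)) (q * (x * m12 + y * m22 + z * m32)) (q * (x * m13 + y * m23 + z * m33))"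
    (is "_ = Z (q * ?X) (q * ?Y) (q * ?V)")
proof -
  have "(W x y z 0 0 0 [^] (p ^ r)) [^] q =
    Z (q * (?X - C * (z * y))) (q * (?Y + C * (z * x))) (q * (?V - C * (y * x)))"
    unfolding word_pow[OF gens] word_reduce[OF gens M] C_def word_int_pow[OF gens] by simp
  also have "\<dots> = Z (q * ?X) (q * ?Y) (q * ?V) \<otimes> Z (- (q * (C * (z * y)))) (q * (C * (z * x))) (- (q * (C * (y * x))))"
    by (simp add: word_mult algebra_simps)
  also have "Z (- (q * (C * (z * y)))) (q * (C * (z * x))) (- (q * (C * (y * x)))) = \<one>"
    by (rule Z_dvd) (use q_dvd in simp_all)
  finally show ?thesis by simp
qed

text \<open>If the product with the matrix lies in \<open>R\<close>, the \<open>q\<close>-th power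
  of the word has trivial \<open>d\<close>-th power, hence is central; its commutators with the
  generators give the conclusions.\<close>

lemma R_M:
  assumes "R (x * m11 + y * m21 + z * m31) (x * m12 + y * m22 + z * m32) (x * m13 + y * m23 + z * m33)"
  shows "R 0 z (- y) \<and> R (- z) 0 x \<and> R y (- x) 0"
proof -
  define g where "g = W x y z 0 0 0 [^] (p ^ (e_exp - 1))"
  have "g [^] (p ^ r) = (W x y z 0 0 0 [^] (p ^ r)) [^] q"
    by (simp add: g_def q_def int_pow_int nat_pow_pow mult.commute del: of_nat_power)
  also have "\<dots> = \<one>" unfolding pow_d_q by (rule assms)
  finally have "central g" by (intro exp_central) (simp_all add: g_def)
  then have "cm g (W 1 0 0 0 0 0) = \<one>" "cm g (W 0 1 0 0 0 0) = \<one>" "cm g (W 0 0 1 0 0 0) = \<one>"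
    by simp_all
  then show ?thesis
    unfolding g_def word_pow[OF gens] word_cm[OF gens] q_def[symmetric] by simp
qed

lemma core_facts:
  shows R_kernel: "\<And>x y z. R (x * m11 + y * m21 + z * m31) (x * m12 + y * m22 + z * m32) (x * m13 + y * m23 + z * m33)
      \<Longrightarrow> int p dvd x \<and> int p dvd y \<and> int p dvd z"
    and det_unit: "\<not> int p dvd det3 m11 m12 m13 m21 m22 m23 m31 m32 m33"
    and R_dvd: "\<And>l m n. R l m n \<Longrightarrow> int p dvd l \<and> int p dvd m \<and> int p dvd n"
proof -
  have p: "prime (int p)" using prime by simp
  have "R (int p) 0 0" "R 0 (int p) 0" "R 0 0 (int p)" "\<not> (R 1 0 0 \<and> R 0 1 0 \<and> R 0 0 1)"
    using e_exp(1-3,6) by (simp_all add: q[symmetric]) (simp_all add: q_def)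
  note * = Z_lattice p this R_M
  show "int p dvd x \<and> int p dvd y \<and> int p dvd z"
    if "R (x * m11 + y * m21 + z * m31) (x * m12 + y * m22 + z * m32) (x * m13 + y * m23 + z * m33)" for x y z
    by (rule lattice_core_kernel[OF * that])
  show "\<not> int p dvd det3 m11 m12 m13 m21 m22 m23 m31 m32 m33"
    by (rule lattice_core_det[OF *])
  show "int p dvd l \<and> int p dvd m \<and> int p dvd n" if "R l m n" for l m n
    by (rule lattice_core_R[OF * that])
qed

text \<open>Divisibility is raised by one power of \<open>p\<close> at a time: a suitable multiple
  of the relation is one among \<open>q\<close>-th powers, where \<open>R_dvd\<close>
  applies.\<close>

lemma Z_kernel:
  assumes "Z l m n = \<one>"
  shows "int (p ^ e_exp) dvd l \<and> int (p ^ e_exp) dvd m \<and> int (p ^ e_exp) dvd n"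
proof -
  interpret lattice3 "\<lambda>l m n. Z (1 * l) (1 * m) (1 * n) = \<one>" by (rule Z_lattice)
  have "t \<le> e_exp \<Longrightarrow> int (p ^ t) dvd l \<and> int (p ^ t) dvd m \<and> int (p ^ t) dvd n" for t
  proof (induction t)
    case (Suc t)
    then obtain l' m' n' where lmn: "l = int (p ^ t) * l'" "m = int (p ^ t) * m'" "n = int (p ^ t) * n'"
      by (auto elim!: dvdE)
    have "e_exp - 1 = (e_exp - Suc t) + t" using Suc.prems by simp
    then have qt: "q = int (p ^ (e_exp - Suc t)) * int (p ^ t)" unfolding q_def by (simp add: power_add)
    have "R l' m' n'"
      using scale[of l m n "int (p ^ (e_exp - Suc t))"] assms by (simp add: lmn qt mult.assoc)
    from R_dvd[OF this] show ?case unfolding lmn by (simp add: mult_dvd_mono mult.commute)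
  qed simp
  then show ?thesis by blast
qed

text \<open>If \<open>p ^ t\<close> divides the exponents, the quotient word has a central
  \<open>p ^ t\<close>-th power. For t < r its power \<open>p ^ r * q\<close> is trivial, and
  \<open>R_kernel\<close> supplies the next factor \<open>p\<close>.\<close>

lemma W_kernel:
  assumes "W i j k l m n = \<one>"
  shows "int (p ^ r) dvd i \<and> int (p ^ r) dvd j \<and> int (p ^ r) dvd k"
proof -
  have "t \<le> r \<Longrightarrow> int (p ^ t) dvd i \<and> int (p ^ t) dvd j \<and> int (p ^ t) dvd k" for t
  proof (induction t)
    case (Suc t)
    then obtain i' j' k' where ijk: "i = int (p ^ t) * i'" "j = int (p ^ t) * j'" "k = int (p ^ t) * k'"
      by (auto elim!: dvdE)
    define g where "g = W i' j' k' 0 0 0"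
    have gc: "g \<in> carrier G" by (simp add: g_def)
    obtain l1 m1 n1 where "g [^] (p ^ t) = W i j k l1 m1 n1"
      unfolding g_def word_pow[OF gens] ijk by blast
    also have "\<dots> = W i j k l m n \<otimes> Z (l1 - l) (m1 - m) (n1 - n)" by (simp add: word_mult)
    finally have gt: "g [^] (p ^ t) = Z (l1 - l) (m1 - m) (n1 - n)" using assms by simp
    have rt: "p ^ r = p ^ t * p ^ (r - t)" using Suc.prems by (simp add: power_add[symmetric])
    have "(g [^] (p ^ r)) [^] q = (g [^] (p ^ t)) [^] (int (p ^ (r - t)) * q)"
      using gc unfolding rt by (simp add: nat_pow_pow[symmetric] int_pow_pow[symmetric] int_pow_int del: of_nat_power)
    also have "\<dots> = \<one>"
    proof -
      have "r - t = Suc (r - Suc t)" using Suc.prems by simp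
      then have "int (p ^ e_exp) dvd int (p ^ (r - t)) * q" unfolding q by (simp add: mult.commute)
      then show ?thesis unfolding gt word_int_pow[OF gens] by (intro Z_dvd) (simp_all add: dvd_mult2)
    qed
    finally have "int p dvd i' \<and> int p dvd j' \<and> int p dvd k'"
      unfolding g_def pow_d_q by (rule R_kernel)
    then show ?case unfolding ijk by (simp add: mult_dvd_mono mult.commute)
  qed simp
  then show ?thesis by blast
qed

end

lemma matrix:
  obtains m11 m12 m13 m21 m22 m23 m31 m32 m33 where
    "\<not> int p dvd det3 m11 m12 m13 m21 m22 m23 m31 m32 m33"
    "\<And>a11 a12 a13 a21 a22 a23 a31 a32 a33.
      endo_cond (int (p ^ e_exp)) C m11 m12 m13 m21 m22 m23 m31 m32 m33 a11 a12 a13 a21 a22 a23 a31 a32 a33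
      \<Longrightarrow> scalar_mod (int (p ^ e_exp)) a11 a12 a13 a21 a22 a23 a31 a32 a33"
proof -
  obtain m11 m12 m13 where 1: "a [^] (p ^ r) = Z m11 m12 m13"
    by (rule derived_W[OF abel_exp[OF gens(1)]])
  obtain m21 m22 m23 where 2: "b [^] (p ^ r) = Z m21 m22 m23"
    by (rule derived_W[OF abel_exp[OF gens(2)]])
  obtain m31 m32 m33 where 3: "c [^] (p ^ r) = Z m31 m32 m33"
    by (rule derived_W[OF abel_exp[OF gens(3)]])
  note M = 1 2 3
  show thesis
    by (rule that[OF det_unit[OF M] scalar_of_endo_cond[OF M W_kernel[OF M] Z_kernel[OF M] refl]])
qed

end

section \<open>Matrices modulo a prime power\<close>

lemma endo_cond_cong:
  assumes "[C = C'] (mod e)" "[m11 = n11] (mod e)" "[m12 = n12] (mod e)" "[m13 = n13] (mod e)"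
    "[m21 = n21] (mod e)" "[m22 = n22] (mod e)" "[m23 = n23] (mod e)"
    "[m31 = n31] (mod e)" "[m32 = n32] (mod e)" "[m33 = n33] (mod e)"
  shows "endo_cond e C m11 m12 m13 m21 m22 m23 m31 m32 m33 a11 a12 a13 a21 a22 a23 a31 a32 a33 \<longleftrightarrow>
    endo_cond e C' n11 n12 n13 n21 n22 n23 n31 n32 n33 a11 a12 a13 a21 a22 a23 a31 a32 a33"
  unfolding endo_cond_def Let_def
  by (intro arg_cong2[where f = "(\<and>)"] cong_dvd_iff cong_add cong_diff cong_mult cong_refl assms)

text \<open>The matrix \<open>A = \<kappa> M cof(M)\<close>, congruent to \<open>M M\<^sup>-\<^sup>T\<close>, satisfies \<open>A M A\<^sup>T = M\<close> and \<open>det A = 1\<close>;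
  it is a scalar only if \<open>M = M\<^sup>T\<close>.\<close>

lemma symmetric_if_scalar:
  fixes e :: int
  assumes \<kappa>: "[\<kappa> * det3 m11 m12 m13 m21 m22 m23 m31 m32 m33 = 1] (mod e)"
    and scalar: "\<And>a11 a12 a13 a21 a22 a23 a31 a32 a33.
      endo_cond e 0 m11 m12 m13 m21 m22 m23 m31 m32 m33 a11 a12 a13 a21 a22 a23 a31 a32 a33
      \<Longrightarrow> scalar_mod e a11 a12 a13 a21 a22 a23 a31 a32 a33"
  shows "[m21 = m12] (mod e)" "[m31 = m13] (mod e)" "[m32 = m23] (mod e)"
proof -
  define \<delta> where "\<delta> = det3 m11 m12 m13 m21 m22 m23 m31 m32 m33"
  define k11 k12 k13 where "k11 = m22 * m33 - m23 * m32" and "k12 = m23 * m31 - m21 * m33" and "k13 = m21 * m32 - m22 * m31"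
  define k21 k22 k23 where "k21 = m32 * m13 - m33 * m12" and "k22 = m33 * m11 - m31 * m13" and "k23 = m31 * m12 - m32 * m11"
  define k31 k32 k33 where "k31 = m12 * m23 - m13 * m22" and "k32 = m13 * m21 - m11 * m23" and "k33 = m11 * m22 - m12 * m21"
  note k = k11_def k12_def k13_def k21_def k22_def k23_def k31_def k32_def k33_def
  define b11 b12 b13 where "b11 = m11 * k11 + m12 * k21 + m13 * k31" and "b12 = m11 * k12 + m12 * k22 + m13 * k32"
    and "b13 = m11 * k13 + m12 * k23 + m13 * k33"
  define b21 b22 b23 where "b21 = m21 * k11 + m22 * k21 + m23 * k31" and "b22 = m21 * k12 + m22 * k22 + m23 * k32"
    and "b23 = m21 * k13 + m22 * k23 + m23 * k33"
  define b31 b32 b33 where "b31 = m31 * k11 + m32 * k21 + m33 * k31" and "b32 = m31 * k12 + m32 * k22 + m33 * k32"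
    and "b33 = m31 * k13 + m32 * k23 + m33 * k33"
  note b = b11_def b12_def b13_def b21_def b22_def b23_def b31_def b32_def b33_def
  \<comment> \<open>The Binet-Cauchy identity for a single minor of a matrix product.\<close>
  have binet: "(r1 * y1 + r2 * y2 + r3 * y3) * (s1 * z1 + s2 * z2 + s3 * z3) -
      (r1 * z1 + r2 * z2 + r3 * z3) * (s1 * y1 + s2 * y2 + s3 * y3) =
      (r2 * s3 - r3 * s2) * (y2 * z3 - y3 * z2) + (r3 * s1 - r1 * s3) * (y3 * z1 - y1 * z3) +
      (r1 * s2 - r2 * s1) * (y1 * z2 - y2 * z1)" for r1 r2 r3 s1 s2 s3 y1 y2 y3 z1 z2 z3 :: int
    by (simp add: algebra_simps)
  \<comment> \<open>The identity cof(cof(M)) = det(M) M.\<close>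
  have kk: "k22 * k33 - k32 * k23 = \<delta> * m11" "k32 * k13 - k12 * k33 = \<delta> * m21" "k12 * k23 - k22 * k13 = \<delta> * m31"
    "k23 * k31 - k33 * k21 = \<delta> * m12" "k33 * k11 - k13 * k31 = \<delta> * m22" "k13 * k21 - k23 * k11 = \<delta> * m32"
    "k21 * k32 - k31 * k22 = \<delta> * m13" "k31 * k12 - k11 * k32 = \<delta> * m23" "k11 * k22 - k21 * k12 = \<delta> * m33"
    by (simp_all add: k \<delta>_def det3_def algebra_simps)
  have cb: "b22 * b33 - b23 * b32 = k11 * (\<delta> * m11) + k12 * (\<delta> * m21) + k13 * (\<delta> * m31)"
    "b23 * b31 - b21 * b33 = k11 * (\<delta> * m12) + k12 * (\<delta> * m22) + k13 * (\<delta> * m32)"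
    "b21 * b32 - b22 * b31 = k11 * (\<delta> * m13) + k12 * (\<delta> * m23) + k13 * (\<delta> * m33)"
    "b32 * b13 - b33 * b12 = k21 * (\<delta> * m11) + k22 * (\<delta> * m21) + k23 * (\<delta> * m31)"
    "b33 * b11 - b31 * b13 = k21 * (\<delta> * m12) + k22 * (\<delta> * m22) + k23 * (\<delta> * m32)"
    "b31 * b12 - b32 * b11 = k21 * (\<delta> * m13) + k22 * (\<delta> * m23) + k23 * (\<delta> * m33)"
    "b12 * b23 - b13 * b22 = k31 * (\<delta> * m11) + k32 * (\<delta> * m21) + k33 * (\<delta> * m31)"
    "b13 * b21 - b11 * b23 = k31 * (\<delta> * m12) + k32 * (\<delta> * m22) + k33 * (\<delta> * m32)"
    "b11 * b22 - b12 * b21 = k31 * (\<delta> * m13) + k32 * (\<delta> * m23) + k33 * (\<delta> * m33)"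
    unfolding b binet kk by (simp_all only: k)
  have c\<kappa>: "(\<kappa> * x) * (\<kappa> * y) - (\<kappa> * z) * (\<kappa> * w) = \<kappa> * \<kappa> * (x * y - z * w)" for x y z w
    by (simp add: algebra_simps)
  have e: "e dvd 1 - \<kappa> * \<delta>"
    using cong_sym[OF \<kappa>] by (simp add: cong_iff_dvd_diff \<delta>_def)
  have eq: "e dvd X - Y" if "X - Y = (1 - \<kappa> * \<delta>) * V" for X Y V
    unfolding that using e by simp
  \<comment> \<open>With K = cof(M) and A = \<kappa> M K one has cof(A) = \<kappa>^2 \<delta> K M,
    so A M and M cof(A) differ only by the factor \<kappa> \<delta>, which is 1 modulo
    \<open>e\<close>.\<close>
  have "endo_cond e 0 m11 m12 m13 m21 m22 m23 m31 m32 m33 (\<kappa> * b11) (\<kappa> * b12) (\<kappa> * b13)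
    (\<kappa> * b21) (\<kappa> * b22) (\<kappa> * b23) (\<kappa> * b31) (\<kappa> * b32) (\<kappa> * b33)"
    unfolding endo_cond_def Let_def c\<kappa> cb
    apply (intro conjI)
    subgoal by (rule eq[where V = "\<kappa> * (b11 * m11 + b12 * m21 + b13 * m31)"]) (simp add: b algebra_simps)
    subgoal by (rule eq[where V = "\<kappa> * (b11 * m12 + b12 * m22 + b13 * m32)"]) (simp add: b algebra_simps)
    subgoal by (rule eq[where V = "\<kappa> * (b11 * m13 + b12 * m23 + b13 * m33)"]) (simp add: b algebra_simps)
    subgoal by (rule eq[where V = "\<kappa> * (b21 * m11 + b22 * m21 + b23 * m31)"]) (simp add: b algebra_simps)
    subgoal by (rule eq[where V = "\<kappa> * (b21 * m12 + b22 * m22 + b23 * m32)"]) (simp add: b algebra_simps)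
    subgoal by (rule eq[where V = "\<kappa> * (b21 * m13 + b22 * m23 + b23 * m33)"]) (simp add: b algebra_simps)
    subgoal by (rule eq[where V = "\<kappa> * (b31 * m11 + b32 * m21 + b33 * m31)"]) (simp add: b algebra_simps)
    subgoal by (rule eq[where V = "\<kappa> * (b31 * m12 + b32 * m22 + b33 * m32)"]) (simp add: b algebra_simps)
    subgoal by (rule eq[where V = "\<kappa> * (b31 * m13 + b32 * m23 + b33 * m33)"]) (simp add: b algebra_simps)
    done
  from scalar[OF this]
  have off: "[\<kappa> * b12 = 0] (mod e)" "[\<kappa> * b13 = 0] (mod e)" "[\<kappa> * b21 = 0] (mod e)"
    "[\<kappa> * b23 = 0] (mod e)" "[\<kappa> * b31 = 0] (mod e)" "[\<kappa> * b32 = 0] (mod e)"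
    and diag: "[\<kappa> * b22 = \<kappa> * b11] (mod e)" "[\<kappa> * b33 = \<kappa> * b11] (mod e)"
    by (simp_all add: scalar_mod_def cong_0_iff cong_iff_dvd_diff dvd_diff_commute)
  define \<mu> where "\<mu> = \<kappa> * b11"
  \<comment> \<open>From cof(M) M^T = \<delta>, so that A M^T = M modulo \<open>e\<close>; for A
    equal to a scalar \<mu> this reads M = \<mu> M^T.\<close>
  have bm: "b11 * m11 + b12 * m12 + b13 * m13 = \<delta> * m11" "b11 * m21 + b12 * m22 + b13 * m23 = \<delta> * m12"
    "b11 * m31 + b12 * m32 + b13 * m33 = \<delta> * m13"
    "b21 * m11 + b22 * m12 + b23 * m13 = \<delta> * m21" "b21 * m21 + b22 * m22 + b23 * m23 = \<delta> * m22"
    "b21 * m31 + b22 * m32 + b23 * m33 = \<delta> * m23"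
    "b31 * m11 + b32 * m12 + b33 * m13 = \<delta> * m31" "b31 * m21 + b32 * m22 + b33 * m23 = \<delta> * m32"
    "b31 * m31 + b32 * m32 + b33 * m33 = \<delta> * m33"
    by (simp_all add: b k \<delta>_def det3_def algebra_simps)
  have step: "[x = y] (mod e)"
    if "f * m + g * n + h * l = \<delta> * x" "[\<kappa> * f * m + \<kappa> * g * n + \<kappa> * h * l = y] (mod e)" for f g h m n l x y
  proof -
    have "[1 * x = (\<kappa> * \<delta>) * x] (mod e)" using cong_sym[OF \<kappa>] unfolding \<delta>_def by (rule cong_scalar_right)
    also have "(\<kappa> * \<delta>) * x = \<kappa> * f * m + \<kappa> * g * n + \<kappa> * h * l"
      using arg_cong[OF that(1), of "\<lambda>x. \<kappa> * x"] by (simp add: algebra_simps)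
    finally show ?thesis using that(2) cong_trans by simp
  qed
  have m\<mu>: "[m11 = \<mu> * m11 + 0 * m12 + 0 * m13] (mod e)" "[m12 = \<mu> * m21 + 0 * m22 + 0 * m23] (mod e)"
    "[m13 = \<mu> * m31 + 0 * m32 + 0 * m33] (mod e)"
    "[m21 = 0 * m11 + \<mu> * m12 + 0 * m13] (mod e)" "[m22 = 0 * m21 + \<mu> * m22 + 0 * m23] (mod e)"
    "[m23 = 0 * m31 + \<mu> * m32 + 0 * m33] (mod e)"
    "[m31 = 0 * m11 + 0 * m12 + \<mu> * m13] (mod e)" "[m32 = 0 * m21 + 0 * m22 + \<mu> * m23] (mod e)"
    "[m33 = 0 * m31 + 0 * m32 + \<mu> * m33] (mod e)"
    unfolding \<mu>_def by (rule step, rule bm, intro cong_add cong_mult cong_refl off diag)+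
  then have mm: "[m11 = \<mu> * m11] (mod e)" "[m12 = \<mu> * m21] (mod e)" "[m13 = \<mu> * m31] (mod e)"
    "[m21 = \<mu> * m12] (mod e)" "[m22 = \<mu> * m22] (mod e)" "[m23 = \<mu> * m32] (mod e)"
    "[m31 = \<mu> * m13] (mod e)" "[m32 = \<mu> * m23] (mod e)" "[m33 = \<mu> * m33] (mod e)"
    by simp_all
  have sq: "[x = \<mu> * (\<mu> * x)] (mod e)" if "[x = \<mu> * y] (mod e)" "[y = \<mu> * x] (mod e)" for x y
    using that by (meson cong_scalar_left cong_trans)
  have "[m11 * k11 + m12 * k12 + m13 * k13 =
      \<mu> * (\<mu> * m11) * k11 + \<mu> * (\<mu> * m12) * k12 + \<mu> * (\<mu> * m13) * k13] (mod e)"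
    by (intro cong_add cong_mult cong_refl sq[OF mm(1,1)] sq[OF mm(2,4)] sq[OF mm(3,7)])
  moreover have "m11 * k11 + m12 * k12 + m13 * k13 = \<delta>"
    by (simp add: \<delta>_def det3_def k)
  moreover have "\<mu> * (\<mu> * m11) * k11 + \<mu> * (\<mu> * m12) * k12 + \<mu> * (\<mu> * m13) * k13 =
      \<mu> * \<mu> * (m11 * k11 + m12 * k12 + m13 * k13)" by (simp add: algebra_simps)
  ultimately have d2: "[\<delta> = \<mu> * \<mu> * \<delta>] (mod e)" by simp
  \<comment> \<open>Taking determinants of M = \<mu> M^T gives \<delta> = \<mu>^3 \<delta>, and
    applying it twice gave \<delta> = \<mu>^2 \<delta>, so \<mu> = 1. Odd dimension is what rules
    out \<mu> = -1.\<close>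
  have "[\<delta> = det3 (\<mu> * m11) (\<mu> * m21) (\<mu> * m31) (\<mu> * m12) (\<mu> * m22) (\<mu> * m32) (\<mu> * m13) (\<mu> * m23) (\<mu> * m33)] (mod e)"
    unfolding \<delta>_def det3_def by (intro cong_add cong_diff cong_mult mm)
  also have "det3 (\<mu> * m11) (\<mu> * m21) (\<mu> * m31) (\<mu> * m12) (\<mu> * m22) (\<mu> * m32) (\<mu> * m13) (\<mu> * m23) (\<mu> * m33) =
      \<mu> * (\<mu> * \<mu> * \<delta>)" by (simp add: \<delta>_def det3_def algebra_simps)
  finally have "[\<delta> = \<mu> * \<delta>] (mod e)"
    using d2 by (meson cong_scalar_left cong_sym cong_trans)
  then have "[\<kappa> * \<delta> = \<mu> * (\<kappa> * \<delta>)] (mod e)"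
    using cong_scalar_left[of \<delta> "\<mu> * \<delta>" e \<kappa>] by (simp add: ac_simps)
  then have \<mu>1: "[1 = \<mu>] (mod e)"
    using \<kappa> cong_scalar_left[OF \<kappa>, of \<mu>] unfolding \<delta>_def by (metis cong_sym cong_trans mult.right_neutral)
  have "[\<mu> * x = x] (mod e)" for x using cong_scalar_right[OF cong_sym[OF \<mu>1], of x] by simp
  then show "[m21 = m12] (mod e)" "[m31 = m13] (mod e)" "[m32 = m23] (mod e)"
    using mm cong_trans by blast+
qed

text \<open>In a rank one matrix s v^T the product of two diagonal entries equals that of the
  corresponding off-diagonal ones. If it is scalar modulo a prime, its diagonal vanishes.\<close>

lemma diagonal_dvd:
  fixes p :: int
  assumes p: "prime p" and off: "p dvd s1 * v2" "p dvd s2 * v1" and d: "p dvd s1 * v1 - s2 * v2"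
  shows "p dvd s1 * v1"
proof -
  have "p dvd (s1 * v2) * (s2 * v1)" using off by simp
  then have "p dvd (s1 * v1) * (s2 * v2)" by (simp add: ac_simps)
  then have "p dvd s1 * v1 \<or> p dvd s2 * v2" using p prime_dvd_mult_iff by blast
  then show ?thesis using d by (metis dvd_diff_commute dvd_add diff_add_cancel)
qed

text \<open>For symmetric \<open>M\<close> the negative of the reflection in an anisotropic vector \<open>v\<close>.\<close>

lemma nonscalar_reflection:
  fixes p e :: int
  assumes p: "prime p" "odd p" and e: "e = p ^ m" "m > 0"
    and nd: "\<not> p dvd det3 m11 m12 m13 m12 m22 m23 m13 m23 m33"
    and scalar: "\<And>a11 a12 a13 a21 a22 a23 a31 a32 a33.
      endo_cond e 0 m11 m12 m13 m12 m22 m23 m13 m23 m33 a11 a12 a13 a21 a22 a23 a31 a32 a33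
      \<Longrightarrow> scalar_mod e a11 a12 a13 a21 a22 a23 a31 a32 a33"
  shows False
proof -
  define s1 where "s1 v1 v2 v3 = m11 * v1 + m12 * v2 + m13 * v3" for v1 v2 v3
  define s2 where "s2 v1 v2 v3 = m12 * v1 + m22 * v2 + m23 * v3" for v1 v2 v3
  define s3 where "s3 v1 v2 v3 = m13 * v1 + m23 * v2 + m33 * v3" for v1 v2 v3
  have p2: "\<not> p dvd 2"
  proof
    assume "p dvd 2"
    then have "p \<le> 2" by (rule zdvd_imp_le) simp
    then have "p = 2" using prime_gt_1_int[OF p(1)] by simp
    then show False using p(2) by simp
  qed
  \<comment> \<open>Otherwise the diagonal of M vanishes modulo \<open>p\<close>, and polarization
    at (1, 1, 0) gives \<open>p dvd m12\<close>; the determinant of a symmetric matrix with zero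
    diagonal is 2 m12 m13 m23.\<close>
  have "\<exists>v1 v2 v3. \<not> p dvd s1 v1 v2 v3 * v1 + s2 v1 v2 v3 * v2 + s3 v1 v2 v3 * v3"
  proof (rule ccontr)
    assume "\<not> ?thesis"
    then have all: "p dvd s1 v1 v2 v3 * v1 + s2 v1 v2 v3 * v2 + s3 v1 v2 v3 * v3" for v1 v2 v3 by blast
    have d: "p dvd m11" "p dvd m22" "p dvd m33"
      using all[of 1 0 0] all[of 0 1 0] all[of 0 0 1] by (simp_all add: s1_def s2_def s3_def)
    have "p dvd (m11 + m12 + (m12 + m22)) - m11 - m22"
      using all[of 1 1 0] d by (intro dvd_diff) (simp_all add: s1_def s2_def)
    then have "p dvd 2 * m12" by simp
    then have "p dvd m12" using p(1) p2 prime_dvd_mult_iff by blast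
    then have "p dvd det3 m11 m12 m13 m12 m22 m23 m13 m23 m33"
    proof -
      have "det3 m11 m12 m13 m12 m22 m23 m13 m23 m33 =
        m11 * (m22 * m33 - m23 * m23) + m12 * (m23 * m13 - m12 * m33) + m13 * (m12 * m23) - m22 * (m13 * m13)"
        by (simp add: det3_def algebra_simps)
      then show ?thesis using d \<open>p dvd m12\<close> by simp
    qed
    then show False using nd by blast
  qed
  then obtain v1 v2 v3 where "\<not> p dvd s1 v1 v2 v3 * v1 + s2 v1 v2 v3 * v2 + s3 v1 v2 v3 * v3" by blast
  moreover define x y z where "x = s1 v1 v2 v3" and "y = s2 v1 v2 v3" and "z = s3 v1 v2 v3"
  ultimately have nq: "\<not> p dvd x * v1 + y * v2 + z * v3" by simp
  define q where "q = x * v1 + y * v2 + z * v3"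
  have "coprime p q" using nq p(1) by (simp add: q_def prime_imp_coprime)
  then have "coprime q e" unfolding e(1) by (simp add: coprime_commute)
  then obtain \<kappa> where "[q * \<kappa> = 1] (mod e)" using cong_solve_coprime_int by blast
  then have \<kappa>: "e dvd \<kappa> * q - 1" by (simp add: cong_iff_dvd_diff mult.commute)
  \<comment> \<open>The factor 2/q of the reflection formula. The matrix g (M v) v^T - 1 below is
    the negated reflection, whose determinant in dimension 3 is 1.\<close>
  define g where "g = 2 * \<kappa>"
  have eq: "e dvd X - Y" if "X - Y = (\<kappa> * q - 1) * V" for X Y V
    unfolding that using \<kappa> by simp
  note xyz = x_def[unfolded s1_def] y_def[unfolded s2_def] z_def[unfolded s3_def]
  have "endo_cond e 0 m11 m12 m13 m12 m22 m23 m13 m23 m33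
    (g * (x * v1) - 1) (g * (x * v2)) (g * (x * v3)) (g * (y * v1)) (g * (y * v2) - 1) (g * (y * v3))
    (g * (z * v1)) (g * (z * v2)) (g * (z * v3) - 1)"
    unfolding endo_cond_def Let_def
    apply (intro conjI)
    subgoal by (rule eq[where V = "2 * m11"]) (simp add: q_def g_def xyz algebra_simps)
    subgoal by (rule eq[where V = "2 * m12"]) (simp add: q_def g_def xyz algebra_simps)
    subgoal by (rule eq[where V = "2 * m13"]) (simp add: q_def g_def xyz algebra_simps)
    subgoal by (rule eq[where V = "2 * m12"]) (simp add: q_def g_def xyz algebra_simps)
    subgoal by (rule eq[where V = "2 * m22"]) (simp add: q_def g_def xyz algebra_simps)
    subgoal by (rule eq[where V = "2 * m23"]) (simp add: q_def g_def xyz algebra_simps)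
    subgoal by (rule eq[where V = "2 * m13"]) (simp add: q_def g_def xyz algebra_simps)
    subgoal by (rule eq[where V = "2 * m23"]) (simp add: q_def g_def xyz algebra_simps)
    subgoal by (rule eq[where V = "2 * m33"]) (simp add: q_def g_def xyz algebra_simps)
    done
  note sc = scalar[OF this, unfolded scalar_mod_def]
  have pe: "p dvd e" using e by (simp add: dvd_power)
  have "p dvd \<kappa> * q - 1" using pe \<kappa> dvd_trans by blast
  \<comment> \<open>As \<open>g\<close> is invertible modulo \<open>p\<close>, the rank one matrix
    (M v) v^T would itself be scalar modulo \<open>p\<close>; its diagonal would vanish, whereas its
    trace \<open>q\<close> is not divisible by \<open>p\<close>.\<close>
  then have "\<not> p dvd \<kappa>" using p(1)
    by (metis dvd_diff_right_iff dvd_mult2 not_prime_unit)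
  then have "\<not> p dvd g" unfolding g_def using p(1) p2 prime_dvd_mult_iff by blast
  then have pg: "p dvd w" if "e dvd g * w" for w
    using that pe p(1) by (meson dvd_trans prime_dvd_mult_iff)
  have off: "p dvd x * v2" "p dvd x * v3" "p dvd y * v1" "p dvd y * v3" "p dvd z * v1" "p dvd z * v2"
    using sc pg by blast+
  have "e dvd g * (x * v1 - y * v2)" "e dvd g * (x * v1 - z * v3)" using sc by (simp_all add: algebra_simps)
  then have d: "p dvd x * v1 - y * v2" "p dvd x * v1 - z * v3" using pg by blast+
  have "p dvd x * v1" by (rule diagonal_dvd[OF p(1) off(1,3) d(1)])
  moreover from this have "p dvd y * v2" "p dvd z * v3" using d by (metis dvd_diff_right_iff)+
  ultimately show False using nq by simp
qed

text \<open>If (M v) v^T is scalar modulo 2 and v is nonzero, then M v vanishes; the adjugate of M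
  turns this into the vanishing of v.\<close>

lemma rank_one_nonscalar:
  fixes m11 :: int
  assumes s: "s1 = m11 * v1 + m12 * v2 + m13 * v3" "s2 = m21 * v1 + m22 * v2 + m23 * v3"
      "s3 = m31 * v1 + m32 * v2 + m33 * v3"
    and det: "odd (det3 m11 m12 m13 m21 m22 m23 m31 m32 m33)" and v: "odd v1 \<or> odd v2 \<or> odd v3"
    and off: "even (s1 * v2)" "even (s1 * v3)" "even (s2 * v1)" "even (s2 * v3)" "even (s3 * v1)" "even (s3 * v2)"
    and diag: "even (s1 * v1 - s2 * v2)" "even (s1 * v1 - s3 * v3)"
  shows False
proof -
  have "even s1 \<and> even s2 \<and> even s3" using v off diag by auto
  moreover have "det3 m11 m12 m13 m21 m22 m23 m31 m32 m33 * v1 =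
      s1 * (m22 * m33 - m23 * m32) + s2 * (m32 * m13 - m33 * m12) + s3 * (m12 * m23 - m13 * m22)"
    "det3 m11 m12 m13 m21 m22 m23 m31 m32 m33 * v2 =
      s1 * (m23 * m31 - m21 * m33) + s2 * (m33 * m11 - m31 * m13) + s3 * (m13 * m21 - m11 * m23)"
    "det3 m11 m12 m13 m21 m22 m23 m31 m32 m33 * v3 =
      s1 * (m21 * m32 - m22 * m31) + s2 * (m31 * m12 - m32 * m11) + s3 * (m11 * m22 - m12 * m21)"
    by (simp_all add: s det3_def algebra_simps)
  ultimately have "even (det3 m11 m12 m13 m21 m22 m23 m31 m32 m33 * v1)"
    "even (det3 m11 m12 m13 m21 m22 m23 m31 m32 m33 * v2)"
    "even (det3 m11 m12 m13 m21 m22 m23 m31 m32 m33 * v3)" by simp_all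
  then show False using det v by simp
qed

text \<open>An infinitesimal automorphism \<open>1 + h N\<close> with \<open>N = (M v) v\<^sup>T + q I\<close>, where \<open>q = v\<^sup>T M v\<close> and
  \<open>M v\<close>, \<open>M\<^sup>T v\<close> agree modulo 2; such \<open>v\<close> is the axial vector of \<open>M - M\<^sup>T\<close>, or arbitrary if \<open>M\<close> is symmetric.\<close>

lemma nonscalar_infinitesimal:
  fixes e h C :: int
  assumes e: "e = 2 * h" "even h" "h \<noteq> 0" and C: "h dvd C"
    and det: "odd (det3 m11 m12 m13 m21 m22 m23 m31 m32 m33)"
    and scalar: "\<And>a11 a12 a13 a21 a22 a23 a31 a32 a33.
      endo_cond e C m11 m12 m13 m21 m22 m23 m31 m32 m33 a11 a12 a13 a21 a22 a23 a31 a32 a33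
      \<Longrightarrow> scalar_mod e a11 a12 a13 a21 a22 a23 a31 a32 a33"
  shows False
proof -
  obtain v1 v2 v3 w1 w2 w3 where v: "odd v1 \<or> odd v2 \<or> odd v3"
    and w: "v1 * m11 + v2 * m21 + v3 * m31 = m11 * v1 + m12 * v2 + m13 * v3 + 2 * w1"
      "v1 * m12 + v2 * m22 + v3 * m32 = m21 * v1 + m22 * v2 + m23 * v3 + 2 * w2"
      "v1 * m13 + v2 * m23 + v3 * m33 = m31 * v1 + m32 * v2 + m33 * v3 + 2 * w3"
  proof (cases "even (m23 - m32) \<and> even (m31 - m13) \<and> even (m12 - m21)")
    case True
    then have "even (m12 - m21)" "even (m13 - m31)" by simp_all
    then obtain w2 w3 where "m12 - m21 = 2 * w2" "m13 - m31 = 2 * w3" by (metis dvd_def)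
    then show thesis by (intro that[of 1 0 0 0 w2 w3]) simp_all
  next
    case False
    then show thesis
      by (intro that[of "m23 - m32" "m31 - m13" "m12 - m21" 0 0 0]) (auto simp: algebra_simps)
  qed
  define s1 s2 s3 where s: "s1 = m11 * v1 + m12 * v2 + m13 * v3" "s2 = m21 * v1 + m22 * v2 + m23 * v3"
      "s3 = m31 * v1 + m32 * v2 + m33 * v3"
  define q where "q = s1 * v1 + s2 * v2 + s3 * v3"
  \<comment> \<open>The cofactors carry the multiplier \<open>c * (c + h * q)\<close>, which for
    this \<open>c\<close> exceeds \<open>c\<close> by \<open>2 * h * q * c\<close>, a multiple of
    \<open>e\<close>.\<close>
  define c where "c = 1 + h * q"
  obtain h' where h': "h = 2 * h'" using e(2) by blast
  obtain C' where C': "C = h * C'" using C ..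
  have eC: "e dvd C * (h * x)" for x unfolding e(1) C' h' by (simp add: mult_dvd_mono)
  have eqC: "e dvd (X + D) - Y" if "X - Y = 2 * h * V" "e dvd D" for X Y V D
  proof -
    have eq: "(X + D) - Y = e * V + D" using that(1) unfolding e(1) by linarith
    show ?thesis unfolding eq using that(2) by simp
  qed
  have eqC': "e dvd (X - D) - Y" if "X - Y = 2 * h * V" "e dvd D" for X Y V D
    using eqC[OF that(1), of "- D"] that(2) by simp
  have "endo_cond e C m11 m12 m13 m21 m22 m23 m31 m32 m33
    (c + h * (s1 * v1)) (h * (s1 * v2)) (h * (s1 * v3)) (h * (s2 * v1)) (c + h * (s2 * v2)) (h * (s2 * v3))
    (h * (s3 * v1)) (h * (s3 * v2)) (c + h * (s3 * v3))"
  proof -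
    have AM: "(c + h * (s1 * v1)) * x + h * (s1 * v2) * y + h * (s1 * v3) * z = c * x + h * s1 * (v1 * x + v2 * y + v3 * z)"
      "h * (s2 * v1) * x + (c + h * (s2 * v2)) * y + h * (s2 * v3) * z = c * y + h * s2 * (v1 * x + v2 * y + v3 * z)"
      "h * (s3 * v1) * x + h * (s3 * v2) * y + (c + h * (s3 * v3)) * z = c * z + h * s3 * (v1 * x + v2 * y + v3 * z)"
      for x y z by (simp_all add: algebra_simps)
    \<comment> \<open>The cofactors contain no terms quadratic in s v^T, because that matrix has
      rank one.\<close>
    have K: "(c + h * (s2 * v2)) * (c + h * (s3 * v3)) - h * (s2 * v3) * (h * (s3 * v2)) = c * (c + h * q) - c * h * (s1 * v1)"
      "h * (s2 * v3) * (h * (s3 * v1)) - h * (s2 * v1) * (c + h * (s3 * v3)) = - c * h * (s2 * v1)"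
      "h * (s2 * v1) * (h * (s3 * v2)) - (c + h * (s2 * v2)) * (h * (s3 * v1)) = - c * h * (s3 * v1)"
      "h * (s3 * v2) * (h * (s1 * v3)) - (c + h * (s3 * v3)) * (h * (s1 * v2)) = - c * h * (s1 * v2)"
      "(c + h * (s3 * v3)) * (c + h * (s1 * v1)) - h * (s3 * v1) * (h * (s1 * v3)) = c * (c + h * q) - c * h * (s2 * v2)"
      "h * (s3 * v1) * (h * (s1 * v2)) - h * (s3 * v2) * (c + h * (s1 * v1)) = - c * h * (s3 * v2)"
      "h * (s1 * v2) * (h * (s2 * v3)) - h * (s1 * v3) * (c + h * (s2 * v2)) = - c * h * (s1 * v3)"
      "h * (s1 * v3) * (h * (s2 * v1)) - (c + h * (s1 * v1)) * (h * (s2 * v3)) = - c * h * (s2 * v3)"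
      "(c + h * (s1 * v1)) * (c + h * (s2 * v2)) - h * (s1 * v2) * (h * (s2 * v1)) = c * (c + h * q) - c * h * (s3 * v3)"
      by (simp_all add: q_def algebra_simps)
    have MK: "x * (c * (c + h * q) - c * h * (s1 * v1)) + y * (- c * h * (s1 * v2)) + z * (- c * h * (s1 * v3))
        = c * (c + h * q) * x - c * h * s1 * (x * v1 + y * v2 + z * v3)"
      "x * (- c * h * (s2 * v1)) + y * (c * (c + h * q) - c * h * (s2 * v2)) + z * (- c * h * (s2 * v3))
        = c * (c + h * q) * y - c * h * s2 * (x * v1 + y * v2 + z * v3)"
      "x * (- c * h * (s3 * v1)) + y * (- c * h * (s3 * v2)) + z * (c * (c + h * q) - c * h * (s3 * v3))
        = c * (c + h * q) * z - c * h * s3 * (x * v1 + y * v2 + z * v3)" for x y z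
      by (simp_all add: algebra_simps)
    have main: "(c * m + h * s * (t + 2 * w)) - (c * (c + h * q) * m - c * h * t * s) =
        2 * h * (s * t + s * w + h' * q * s * t - c * q * m)" for m s t w
      unfolding c_def by (simp add: h' algebra_simps)
    have D: "e dvd C * (h * x * y)" "e dvd C * (x * (h * y))" "e dvd C * (h * x * (h * y))" for x y
      using eC[of "x * y"] eC[of "x * (h * y)"] by (simp_all add: ac_simps)
    show ?thesis
      unfolding endo_cond_def Let_def K AM MK w s[symmetric]
      by (intro conjI; (rule eqC'[OF main D(1)] eqC'[OF main D(2)] eqC'[OF main D(3)]
          eqC[OF main D(1)] eqC[OF main D(2)] eqC[OF main D(3)]))
  qed
  from scalar[OF this]
  have "2 * h dvd h * (s1 * v2)" "2 * h dvd h * (s1 * v3)" "2 * h dvd h * (s2 * v1)" "2 * h dvd h * (s2 * v3)"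
    "2 * h dvd h * (s3 * v1)" "2 * h dvd h * (s3 * v2)"
    "2 * h dvd h * (s1 * v1 - s2 * v2)" "2 * h dvd h * (s1 * v1 - s3 * v3)"
    by (simp_all add: scalar_mod_def e(1) algebra_simps)
  then have "even (s1 * v2)" "even (s1 * v3)" "even (s2 * v1)" "even (s2 * v3)" "even (s3 * v1)" "even (s3 * v2)"
    "even (s1 * v1 - s2 * v2)" "even (s1 * v1 - s3 * v3)"
    by (simp_all only: mult.commute[of 2 h] dvd_times_left_cancel_iff[OF e(3)])
  then show False by (rule rank_one_nonscalar[OF s det v])
qed

text \<open>The isometry is 1 + (M v) v^T with v isotropic modulo 2: the linear terms of A M A^T
  cancel in pairs and the last one has the factor v^T M v.\<close>

lemma nonscalar_transvection:
  assumes det: "odd (det3 m11 m12 m13 m12 m22 m23 m13 m23 m33)"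
    and scalar: "\<And>a11 a12 a13 a21 a22 a23 a31 a32 a33.
      endo_cond 2 0 m11 m12 m13 m12 m22 m23 m13 m23 m33 a11 a12 a13 a21 a22 a23 a31 a32 a33
      \<Longrightarrow> scalar_mod 2 a11 a12 a13 a21 a22 a23 a31 a32 a33"
  shows False
proof -
  obtain v1 v2 v3 where v: "odd v1 \<or> odd v2 \<or> odd v3"
    and q: "even ((m11 * v1 + m12 * v2 + m13 * v3) * v1 + (m12 * v1 + m22 * v2 + m23 * v3) * v2
      + (m13 * v1 + m23 * v2 + m33 * v3) * v3)"
  proof -
    \<comment> \<open>At (1, 1, 0) the off-diagonal entry occurs twice, so the value is
      \<open>m11 + m22\<close> modulo 2.\<close>
    consider "even m11" | "even m22" | "odd m11 \<and> odd m22" by blast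
    then show thesis
    proof cases
      case 1 then show thesis by (intro that[of 1 0 0]) simp_all
    next
      case 2 then show thesis by (intro that[of 0 1 0]) simp_all
    next
      case 3 then show thesis by (intro that[of 1 1 0]) simp_all
    qed
  qed
  define s1 s2 s3 where s: "s1 = m11 * v1 + m12 * v2 + m13 * v3" "s2 = m12 * v1 + m22 * v2 + m23 * v3"
      "s3 = m13 * v1 + m23 * v2 + m33 * v3"
  obtain q' where q': "s1 * v1 + s2 * v2 + s3 * v3 = 2 * q'" using q unfolding s[symmetric] by blast
  have eq: "2 dvd X - Y" if "X - Y = 2 * (x * y) - (s1 * v1 + s2 * v2 + s3 * v3) * m" for X Y x y m :: int
    unfolding that q' by simp
  have "endo_cond 2 0 m11 m12 m13 m12 m22 m23 m13 m23 m33
    (1 + s1 * v1) (s1 * v2) (s1 * v3) (s2 * v1) (1 + s2 * v2) (s2 * v3) (s3 * v1) (s3 * v2) (1 + s3 * v3)"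
    unfolding endo_cond_def Let_def
    apply (intro conjI)
    subgoal by (rule eq[of _ _ s1 s1 m11]) (simp add: s algebra_simps)
    subgoal by (rule eq[of _ _ s1 s2 m12]) (simp add: s algebra_simps)
    subgoal by (rule eq[of _ _ s1 s3 m13]) (simp add: s algebra_simps)
    subgoal by (rule eq[of _ _ s2 s1 m12]) (simp add: s algebra_simps)
    subgoal by (rule eq[of _ _ s2 s2 m22]) (simp add: s algebra_simps)
    subgoal by (rule eq[of _ _ s2 s3 m23]) (simp add: s algebra_simps)
    subgoal by (rule eq[of _ _ s3 s1 m13]) (simp add: s algebra_simps)
    subgoal by (rule eq[of _ _ s3 s2 m23]) (simp add: s algebra_simps)
    subgoal by (rule eq[of _ _ s3 s3 m33]) (simp add: s algebra_simps)
    done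
  from scalar[OF this] show False
    unfolding scalar_mod_def by (intro rank_one_nonscalar[OF s det v]) auto
qed

text \<open>For \<open>p = 2\<close> and \<open>m \<ge> 2\<close> only half of the modulus is known
  to divide \<open>C\<close>, and the infinitesimal automorphism absorbs the correction. In all
  other cases \<open>C\<close> vanishes modulo \<open>p ^ m\<close>, and M may be taken
  symmetric.\<close>

lemma endo_cond_nonscalar:
  fixes p :: nat and C :: int
  assumes p: "prime p" and m: "m > 0"
    and nd: "\<not> int p dvd det3 m11 m12 m13 m21 m22 m23 m31 m32 m33"
    and C: "int p dvd C" "p = 2 \<Longrightarrow> int (p ^ (m - 1)) dvd C" "p \<noteq> 2 \<Longrightarrow> int (p ^ m) dvd C"
    and scalar: "\<And>a11 a12 a13 a21 a22 a23 a31 a32 a33.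
      endo_cond (int (p ^ m)) C m11 m12 m13 m21 m22 m23 m31 m32 m33 a11 a12 a13 a21 a22 a23 a31 a32 a33
      \<Longrightarrow> scalar_mod (int (p ^ m)) a11 a12 a13 a21 a22 a23 a31 a32 a33"
  shows False
proof (cases "p = 2 \<and> m \<ge> 2")
  case True
  obtain k where k: "m = Suc (Suc k)" using True by (metis One_nat_def Suc_1 Suc_le_D Suc_le_mono)
  show False
    by (rule nonscalar_infinitesimal[OF _ _ _ _ _ scalar, of "int (p ^ (m - 1))"])
      (use True C nd in \<open>auto simp: k\<close>)
next
  case False
  define e where "e = int (p ^ m)"
  have "e dvd C"
  proof (cases "p = 2")
    case True
    then have "m = 1" using False m by simp
    then show ?thesis using C True by (simp add: e_def)
  qed (use C in \<open>simp add: e_def\<close>)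
  then have C0: "[C = 0] (mod e)" by (simp add: cong_0_iff)
  have sc0: "scalar_mod e a11 a12 a13 a21 a22 a23 a31 a32 a33"
    if "endo_cond e 0 m11 m12 m13 m21 m22 m23 m31 m32 m33 a11 a12 a13 a21 a22 a23 a31 a32 a33"
    for a11 a12 a13 a21 a22 a23 a31 a32 a33
    unfolding e_def
    by (rule scalar, fold e_def)
      (use that endo_cond_cong[OF C0 cong_refl cong_refl cong_refl cong_refl cong_refl cong_refl
        cong_refl cong_refl cong_refl] in blast)
  let ?d = "det3 m11 m12 m13 m21 m22 m23 m31 m32 m33"
  have p': "prime (int p)" using p by simp
  then have "coprime ?d (int p)" using nd by (simp add: prime_imp_coprime coprime_commute)
  then have "coprime ?d e" by (simp add: e_def)
  then obtain \<kappa> where "[?d * \<kappa> = 1] (mod e)" using cong_solve_coprime_int by blast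
  then have \<kappa>: "[\<kappa> * ?d = 1] (mod e)" by (simp add: mult.commute)
  note sym = symmetric_if_scalar[OF \<kappa> sc0]
  have sc: "scalar_mod e a11 a12 a13 a21 a22 a23 a31 a32 a33"
    if "endo_cond e 0 m11 m12 m13 m12 m22 m23 m13 m23 m33 a11 a12 a13 a21 a22 a23 a31 a32 a33"
    for a11 a12 a13 a21 a22 a23 a31 a32 a33
    by (rule sc0) (use that endo_cond_cong[OF cong_refl cong_refl cong_refl cong_refl sym(1) cong_refl cong_refl
        sym(2,3) cong_refl] in blast)
  have "[?d = det3 m11 m12 m13 m12 m22 m23 m13 m23 m33] (mod e)"
    unfolding det3_def by (intro cong_add cong_diff cong_mult cong_refl sym)
  moreover have "int p dvd e" using m by (simp add: e_def dvd_power)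
  ultimately have "[?d = det3 m11 m12 m13 m12 m22 m23 m13 m23 m33] (mod int p)"
    by (rule cong_dvd_modulus)
  then have nd': "\<not> int p dvd det3 m11 m12 m13 m12 m22 m23 m13 m23 m33"
    using nd cong_dvd_iff by blast
  show False
  proof (cases "p = 2")
    case True
    moreover from this have "m = 1" using \<open>\<not> (p = 2 \<and> m \<ge> 2)\<close> m by simp
    ultimately have "e = 2" by (simp add: e_def)
    then show False using nonscalar_transvection nd' sc True by simp blast
  next
    case False
    then have "odd (int p)" using p prime_odd_nat[of p] prime_ge_2_nat[OF p] by simp
    then show False using nonscalar_reflection[OF p' _ _ m nd' sc] by (simp add: e_def)
  qed
qed

lemma (in class2_p_not_2) contradiction: False
proof (rule matrix)
  fix m11 m12 m13 m21 m22 m23 m31 m32 m33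
  assume nd: "\<not> int p dvd det3 m11 m12 m13 m21 m22 m23 m31 m32 m33"
    and sc: "\<And>a11 a12 a13 a21 a22 a23 a31 a32 a33.
      endo_cond (int (p ^ e_exp)) C m11 m12 m13 m21 m22 m23 m31 m32 m33 a11 a12 a13 a21 a22 a23 a31 a32 a33
      \<Longrightarrow> scalar_mod (int (p ^ e_exp)) a11 a12 a13 a21 a22 a23 a31 a32 a33"
  have eq: "2 * (p ^ r choose 2) = p ^ r * (p ^ r - 1)" by (rule twice_choose_two)
  have le: "p ^ e_exp dvd p ^ r" using e_exp(4) by (simp add: le_imp_power_dvd)
  show False
  proof (rule endo_cond_nonscalar[OF prime e_exp(5) nd p_dvd_C _ _ sc])
    assume "p = 2"
    obtain m where m: "e_exp = Suc m" using e_exp(5) by (cases e_exp) auto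
    have "2 * p ^ m dvd 2 * (p ^ r choose 2)"
      unfolding eq using le m \<open>p = 2\<close> by simp
    then show "int (p ^ (e_exp - 1)) dvd C" unfolding C_def m by (simp del: of_nat_power)
  next
    assume "p \<noteq> 2"
    then have "odd p" using prime prime_odd_nat[of p] prime_ge_2_nat[OF prime] by simp
    then have "coprime (p ^ e_exp) 2" by simp
    moreover have "p ^ e_exp dvd 2 * (p ^ r choose 2)" unfolding eq using le by simp
    ultimately show "int (p ^ e_exp) dvd C"
      unfolding C_def by (simp only: of_nat_dvd_iff coprime_dvd_mult_right_iff)
  qed
qed

section \<open>Abelianizations of exponent 2\<close>

text \<open>Matrices over the field with two elements, row by row. A matrix is anisotropic if no word outside
  the centre squares to 1. The list \<open>endos2\<close> was found by exhaustive search; it serves all 204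
  anisotropic matrices.\<close>

fun anisotropic2 :: "bool list \<Rightarrow> bool" where
  "anisotropic2 [m11, m12, m13, m21, m22, m23, m31, m32, m33] \<longleftrightarrow>
     (m31 \<or> m32 \<or> m33) \<and>
     (m21 \<or> m22 \<or> m23) \<and>
     ((\<not> (m21 \<noteq> m31)) \<or> (m22 \<noteq> m32) \<or> (m23 \<noteq> m33)) \<and>
     (m11 \<or> m12 \<or> m13) \<and>
     ((m11 \<noteq> m31) \<or> (\<not> (m12 \<noteq> m32)) \<or> (m13 \<noteq> m33)) \<and>
     ((m11 \<noteq> m21) \<or> (m12 \<noteq> m22) \<or> (\<not> (m13 \<noteq> m23))) \<and>
     ((\<not> ((m11 \<noteq> m21) \<noteq> m31)) \<or> (\<not> ((m12 \<noteq> m22) \<noteq> m32)) \<or> (\<not> ((m13 \<noteq> m23) \<noteq> m33)))"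
| "anisotropic2 _ \<longleftrightarrow> False"

text \<open>The condition \<open>endo_cond 2 1\<close> on parities, with \<open>\<noteq>\<close> as
  addition and \<open>\<and>\<close> as multiplication.\<close>

fun endo2 :: "bool list \<Rightarrow> bool list \<Rightarrow> bool" where
  "endo2 [m11, m12, m13, m21, m22, m23, m31, m32, m33] [a11, a12, a13, a21, a22, a23, a31, a32, a33] \<longleftrightarrow>
    (let k11 = (a22 \<and> a33) \<noteq> (a23 \<and> a32); k12 = (a23 \<and> a31) \<noteq> (a21 \<and> a33); k13 = (a21 \<and> a32) \<noteq> (a22 \<and> a31);
         k21 = (a32 \<and> a13) \<noteq> (a33 \<and> a12); k22 = (a33 \<and> a11) \<noteq> (a31 \<and> a13); k23 = (a31 \<and> a12) \<noteq> (a32 \<and> a11);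
         k31 = (a12 \<and> a23) \<noteq> (a13 \<and> a22); k32 = (a13 \<and> a21) \<noteq> (a11 \<and> a23); k33 = (a11 \<and> a22) \<noteq> (a12 \<and> a21)
     in (((((a11 \<and> m11) \<noteq> (a12 \<and> m21)) \<noteq> (a13 \<and> m31)) \<noteq> (a13 \<and> a12)) = (((m11 \<and> k11) \<noteq> (m12 \<and> k21)) \<noteq> (m13 \<and> k31))) \<and>
     (((((a11 \<and> m12) \<noteq> (a12 \<and> m22)) \<noteq> (a13 \<and> m32)) \<noteq> (a13 \<and> a11)) = (((m11 \<and> k12) \<noteq> (m12 \<and> k22)) \<noteq> (m13 \<and> k32))) \<and>
     (((((a11 \<and> m13) \<noteq> (a12 \<and> m23)) \<noteq> (a13 \<and> m33)) \<noteq> (a12 \<and> a11)) = (((m11 \<and> k13) \<noteq> (m12 \<and> k23)) \<noteq> (m13 \<and> k33))) \<and>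
     (((((a21 \<and> m11) \<noteq> (a22 \<and> m21)) \<noteq> (a23 \<and> m31)) \<noteq> (a23 \<and> a22)) = (((m21 \<and> k11) \<noteq> (m22 \<and> k21)) \<noteq> (m23 \<and> k31))) \<and>
     (((((a21 \<and> m12) \<noteq> (a22 \<and> m22)) \<noteq> (a23 \<and> m32)) \<noteq> (a23 \<and> a21)) = (((m21 \<and> k12) \<noteq> (m22 \<and> k22)) \<noteq> (m23 \<and> k32))) \<and>
     (((((a21 \<and> m13) \<noteq> (a22 \<and> m23)) \<noteq> (a23 \<and> m33)) \<noteq> (a22 \<and> a21)) = (((m21 \<and> k13) \<noteq> (m22 \<and> k23)) \<noteq> (m23 \<and> k33))) \<and>
     (((((a31 \<and> m11) \<noteq> (a32 \<and> m21)) \<noteq> (a33 \<and> m31)) \<noteq> (a33 \<and> a32)) = (((m31 \<and> k11) \<noteq> (m32 \<and> k21)) \<noteq> (m33 \<and> k31))) \<and>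
     (((((a31 \<and> m12) \<noteq> (a32 \<and> m22)) \<noteq> (a33 \<and> m32)) \<noteq> (a33 \<and> a31)) = (((m31 \<and> k12) \<noteq> (m32 \<and> k22)) \<noteq> (m33 \<and> k32))) \<and>
     (((((a31 \<and> m13) \<noteq> (a32 \<and> m23)) \<noteq> (a33 \<and> m33)) \<noteq> (a32 \<and> a31)) = (((m31 \<and> k13) \<noteq> (m32 \<and> k23)) \<noteq> (m33 \<and> k33))))"
| "endo2 _ _ \<longleftrightarrow> False"

fun nonscalar2 :: "bool list \<Rightarrow> bool" where
  "nonscalar2 [a11, a12, a13, a21, a22, a23, a31, a32, a33] \<longleftrightarrow>
     a12 \<or> a13 \<or> a21 \<or> a23 \<or> a31 \<or> a32 \<or> a11 \<noteq> a22 \<or> a11 \<noteq> a33"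
| "nonscalar2 _ \<longleftrightarrow> False"

definition endos2 :: "bool list list" where
  "endos2 = [[False, False, True, False, True, False, True, False, False],
     [False, False, True, True, True, True, True, False, False],
     [False, True, False, True, False, False, True, True, True],
     [True, False, False, True, True, True, False, False, True],
     [True, True, True, False, False, True, False, True, False],
     [False, True, False, True, False, False, False, False, True],
     [False, True, True, False, True, False, True, True, False],
     [True, False, False, False, False, True, False, True, False],
     [False, True, True, True, False, True, False, False, True],
     [True, False, False, False, True, False, True, True, True],
     [True, False, False, False, True, False, False, True, True],
     [True, False, False, False, True, False, True, False, True],
     [True, False, False, False, True, True, False, False, True],
     [True, False, False, True, False, True, True, True, False],
     [True, False, False, True, True, False, False, False, True],
     [True, False, False, True, True, False, True, False, True],
     [True, False, True, False, True, False, False, False, True],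
     [True, False, True, False, True, True, False, False, True],
     [True, True, False, False, True, False, False, False, True],
     [True, True, False, False, True, False, False, True, True],
     [True, True, True, False, True, False, False, False, True],
     [False, False, True, False, True, False, True, False, True],
     [False, False, True, False, True, False, True, True, True],
     [False, False, True, False, True, True, True, False, True],
     [False, False, True, True, False, False, False, True, False]]"

lemma endos2:
  "list_all (\<lambda>M. anisotropic2 M \<longrightarrow> list_ex (endo2 M) endos2) (product_lists (replicate 9 [False, True]))"
  by code_simp
lemma endos2_nonscalar: "list_all nonscalar2 endos2"
  by code_simp

lemma endo_cond_of_F2:
  assumes aniso: "\<And>x y z. \<lbrakk>even (x * m11 + y * m21 + z * m31 - z * y); even (x * m12 + y * m22 + z * m32 + z * x);
      even (x * m13 + y * m23 + z * m33 - y * x)\<rbrakk> \<Longrightarrow> even x \<and> even y \<and> even (z :: int)"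
  obtains a11 a12 a13 a21 a22 a23 a31 a32 a33 where
    "endo_cond 2 1 m11 m12 m13 m21 m22 m23 m31 m32 m33 a11 a12 a13 a21 a22 a23 a31 a32 a33"
    "\<not> scalar_mod 2 a11 a12 a13 a21 a22 a23 a31 a32 a33"
proof -
  define M where "M = [odd m11, odd m12, odd m13, odd m21, odd m22, odd m23, odd m31, odd m32, odd m33]"
  \<comment> \<open>The seven conjuncts correspond to the seven nonzero vectors modulo 2.\<close>
  have "anisotropic2 M"
    unfolding M_def anisotropic2.simps
    apply (intro conjI)
    subgoal using aniso[of 0 0 1] by auto
    subgoal using aniso[of 0 1 0] by auto
    subgoal using aniso[of 0 1 1] by auto
    subgoal using aniso[of 1 0 0] by auto
    subgoal using aniso[of 1 0 1] by auto
    subgoal using aniso[of 1 1 0] by auto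
    subgoal using aniso[of 1 1 1] by auto
    done
  moreover have "M \<in> set (product_lists (replicate 9 [False, True]))"
    unfolding product_lists_set M_def by (auto simp: eval_nat_numeral simp del: product_lists.simps)
  ultimately have "list_ex (endo2 M) endos2" using endos2 by (simp add: list_all_iff)
  then obtain A where A: "endo2 M A" "A \<in> set endos2" by (auto simp: list_ex_iff)
  then have "nonscalar2 A" using endos2_nonscalar by (simp add: list_all_iff)
  then obtain a11 a12 a13 a21 a22 a23 a31 a32 a33
    where Aeq: "A = [a11, a12, a13, a21, a22, a23, a31, a32, a33]" by (cases A rule: nonscalar2.cases) auto
  have par: "2 dvd x - y \<longleftrightarrow> (odd x = odd y)" "odd (x + y) = (odd x \<noteq> odd y)" "odd (x - y) = (odd x \<noteq> odd y)"
    "odd (x * y) \<longleftrightarrow> odd x \<and> odd y" "odd (of_bool P :: int) = P" for x y :: int and P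
    by auto
  show thesis
  proof (rule that)
    show "endo_cond 2 1 m11 m12 m13 m21 m22 m23 m31 m32 m33 (of_bool a11) (of_bool a12) (of_bool a13)
      (of_bool a21) (of_bool a22) (of_bool a23) (of_bool a31) (of_bool a32) (of_bool a33)"
      using A(1) unfolding M_def Aeq endo2.simps endo_cond_def Let_def mult_1 par .
    show "\<not> scalar_mod 2 (of_bool a11) (of_bool a12) (of_bool a13)
      (of_bool a21) (of_bool a22) (of_bool a23) (of_bool a31) (of_bool a32) (of_bool a33)"
      using \<open>nonscalar2 A\<close> by (auto simp: Aeq scalar_mod_def)
  qed
qed

lemma (in group) cm_eq_one_swap: "\<lbrakk>x \<in> carrier G; y \<in> carrier G; cm x y = \<one>\<rbrakk> \<Longrightarrow> cm y x = \<one>"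
  using cm_inv[of x y] by simp

lemma (in three_generated) comm_group_if_gens_commute:
  assumes "cm b c = \<one>" "cm c a = \<one>" "cm a b = \<one>"
  shows "comm_group G"
proof -
  have eqs: "b \<otimes> c = c \<otimes> b" "c \<otimes> a = a \<otimes> c" "a \<otimes> b = b \<otimes> a"
    using assms by (simp_all only: cm_eq_one_iff gens)
  have "x \<otimes> y = y \<otimes> x" if "x \<in> {a, b, c}" "y \<in> {a, b, c}" for x y
    using that eqs by (metis empty_iff insert_iff)
  then have *: "central x" if "x \<in> {a, b, c}" for x
    using that gens_subset by (intro central_if_commutes_gens[OF generated gens_subset]) blast+
  show ?thesis
  proof (rule comm_group_if_central)
    fix x assume x: "x \<in> carrier G"
    show "central x"
      by (rule central_if_commutes_gens[OF generated gens_subset x]) (rule central_comm[OF * x, symmetric])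
  qed
qed

lemma (in group) three_generatedI:
  assumes "three_generated G a b c" "a' \<in> carrier G" "b' \<in> carrier G" "c' \<in> carrier G"
    and "{a, b, c} \<subseteq> generate G {a', b', c'}"
  shows "three_generated G a' b' c'"
proof -
  interpret three_generated G a b c by fact
  have sub: "{a', b', c'} \<subseteq> carrier G" using assms by simp
  have "carrier G \<subseteq> generate G {a', b', c'}"
    unfolding generated using generate_subgroup_incl[OF assms(5) generate_is_subgroup[OF sub]] .
  then show ?thesis using generate_incl[OF sub] by unfold_locales (use assms in auto)
qed

section \<open>Groups whose abelianization has exponent 2, by the relations among
  commutators\<close>

locale class2_p_d_2 = class2_p_three_generated_E +
  assumes d_2: "p ^ r = 2"
begin

text \<open>The whole setting is independent of the generators, so these can be adapted to a given
  relation among the commutators.\<close>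

lemma change_gens:
  assumes "a' \<in> carrier G" "b' \<in> carrier G" "c' \<in> carrier G" "{a, b, c} \<subseteq> generate G {a', b', c'}"
  shows "class2_p_d_2 G a' b' c' p r s"
proof -
  interpret n: three_generated G a' b' c'
    by (rule three_generatedI[OF three_generated_axioms assms])
  have "cm b' c' \<noteq> \<one> \<or> cm c' a' \<noteq> \<one> \<or> cm a' b' \<noteq> \<one>"
  proof (rule ccontr)
    assume "\<not> ?thesis"
    then interpret c: comm_group G using n.comm_group_if_gens_commute by blast
    have "cm x y = \<one>" if "x \<in> carrier G" "y \<in> carrier G" for x y
      using that c.m_comm by (simp add: cm_eq_one_iff)
    then show False using noncomm by simp
  qed
  then show ?thesis
    by unfold_locales (use prime p_power abel_exp exp_central d_2 in auto)
qed

lemma p_r: "p = 2" "r = 1" "p ^ e_exp = 2" "C = 1"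
proof -
  have "p dvd p ^ r" using e_exp(4,5) by (simp add: dvd_power)
  then show p: "p = 2" using prime d_2 by (metis primes_dvd_imp_eq two_is_prime_nat)
  show r: "r = 1"
  proof (rule ccontr)
    assume "r \<noteq> 1"
    then have "r \<ge> 2" using e_exp(4,5) by simp
    then have "2 ^ 2 \<le> (2::nat) ^ r" by (intro power_increasing) auto
    then show False using d_2 p by simp
  qed
  have "e_exp = 1" using e_exp(4,5) r by simp
  then have "p ^ e_exp = p" by simp
  then show "p ^ e_exp = 2" using p by simp
  show "C = 1" by (simp add: C_def d_2)
qed

lemma Z_even: "even l \<Longrightarrow> even m \<Longrightarrow> even k \<Longrightarrow> Z l m k = \<one>"
  using Z_dvd[of l m k] unfolding p_r(3) by simp

lemma Z_cong2:
  assumes "even (l - l')" "even (m - m')" "even (k - k')"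
  shows "Z l m k = Z l' m' k'"
proof -
  have "Z l m k = Z l' m' k' \<otimes> Z (l - l') (m - m') (k - k')" by (simp add: word_mult)
  then show ?thesis using Z_even[OF assms] by simp
qed

lemma square_central: "g \<in> carrier G \<Longrightarrow> g [^] (2::nat) = \<one> \<Longrightarrow> central g"
  using exp_central d_2 by simp

lemma square_derived: "g \<in> carrier G \<Longrightarrow> g [^] (2::nat) \<in> D"
  using abel_exp d_2 by simp

lemma W_square:
  assumes "a [^] (2::nat) = Z m11 m12 m13" "b [^] (2::nat) = Z m21 m22 m23" "c [^] (2::nat) = Z m31 m32 m33"
  shows "W x y z 0 0 0 [^] (2::nat) = Z (x * m11 + y * m21 + z * m31 - z * y)
      (x * m12 + y * m22 + z * m32 + z * x) (x * m13 + y * m23 + z * m33 - y * x)"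
  unfolding word_pow[OF gens] word_reduce[OF gens assms] by simp

lemma W_central_cm:
  assumes "central (W x y z l m n)"
  shows "Z 0 z (- y) = \<one>" "Z (- z) 0 x = \<one>" "Z y (- x) 0 = \<one>"
proof -
  have "cm (W x y z l m n) (W 1 0 0 0 0 0) = \<one>" "cm (W x y z l m n) (W 0 1 0 0 0 0) = \<one>"
    "cm (W x y z l m n) (W 0 0 1 0 0 0) = \<one>" using assms by simp_all
  then show "Z 0 z (- y) = \<one>" "Z (- z) 0 x = \<one>" "Z y (- x) 0 = \<one>"
    unfolding word_cm[OF gens] by simp_all
qed

text \<open>Here \<open>a\<^sup>2 = b\<^sup>2 = [a, b]\<close> as in the quaternion group, and \<open>a\<close>, \<open>b\<close> can be exchanged.\<close>

lemma c_not_central: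
  assumes "cm b c = \<one>" "cm c a = \<one>"
  shows False
proof -
  have w: "cm a b \<noteq> \<one>" using noncomm assms by simp
  have Z: "Z l m n = cm a b [^] n" for l m n using assms by (simp add: word_def)
  have w2: "cm a b [^] n = \<one>" if "even n" for n :: int using Z_even[of 0 0 n] that by (simp add: Z)
  have wn: "even n" if "cm a b [^] n = \<one>" for n :: int
  proof (rule ccontr)
    assume "odd n"
    then have "cm a b [^] n = cm a b [^] (n - 1) \<otimes> cm a b"
      using int_pow_mult[of "cm a b" "n - 1" 1] by simp
    then show False using w2[of "n - 1"] \<open>odd n\<close> that w by simp
  qed
  have wc: "cm a b [^] n = cm a b [^] n'" if "even (n - n')" for n n' :: int
    using Z_cong2[of 0 0 0 0 n n'] that by (simp add: Z)
  \<comment> \<open>Squares lie in \<open>D\<close>, which here has \<open>cm a b\<close> as its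
    only nontrivial element, and a noncentral element cannot square to 1.\<close>
  have sq: "x [^] (2::nat) = cm a b" if x: "x \<in> carrier G" "\<not> central x" for x
  proof -
    obtain l m n where "x [^] (2::nat) = Z l m n" by (rule derived_W[OF square_derived[OF x(1)]])
    then have n: "x [^] (2::nat) = cm a b [^] n" by (simp add: Z)
    have "odd n" using square_central[OF x(1)] x(2) w2 n by auto
    then show ?thesis using wc[of n 1] n by simp
  qed
  have "\<not> central a" "\<not> central b" using w by auto
  then have ab: "a [^] (2::nat) = cm a b" "b [^] (2::nat) = cm a b" using sq by simp_all
  have ca: "cm a c = \<one>" "cm c b = \<one>" using assms cm_eq_one_swap by simp_all
  have ba: "cm b a = cm a b [^] (-1 :: int)" using cm_inv[of a b] by (simp add: int_pow_neg)
  have "cm (W 1 0 0 0 0 0) (word b a c 1 0 0 0 0 0) = \<one>"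
  proof (rule commute_of_kernel)
    fix i j k l m n assume 1: "W i j k l m n = \<one>"
    have "central (W i j k l m n)" unfolding 1 by simp
    from W_central_cm[OF this] have "even j" "even i" using wn[of "- j"] wn[of i] by (simp_all add: Z)
    then obtain i' j' where ij: "i = 2 * i'" "j = 2 * j'" by (auto elim!: evenE)
    have sq: "x [^] (2 * i) = (x [^] (2::nat)) [^] i" if "x \<in> carrier G" for x and i :: int
      using that int_pow_pow[of x 2 i] int_pow_int[of G x 2] by simp
    have "word b a c i j k l m n = cm a b [^] i' \<otimes> (cm a b [^] j' \<otimes> (c [^] k \<otimes> cm a b [^] (- n)))"
      using ca assms by (simp add: word_def ij sq ab ba int_pow_pow)
    also have "cm a b [^] (- n) = cm a b [^] n" by (rule wc) simp
    also have "cm a b [^] i' \<otimes> (cm a b [^] j' \<otimes> (c [^] k \<otimes> cm a b [^] n)) = W i j k l m n"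
      using ca assms by (simp add: word_def ij sq ab)
    finally show "word b a c i j k l m n = \<one>" using 1 by simp
  qed simp_all
  then show False using w by (simp add: word_gens)
qed

text \<open>If the other two commutators are independent, one of the endomorphisms sending \<open>a\<close> to \<open>a c\<close> and
  \<open>(b, c)\<close> to \<open>(b, c)\<close>, \<open>(c, b)\<close> or \<open>(b, b c)\<close> exists.\<close>

lemma b_c_dont_commute:
  assumes u: "cm b c = \<one>"
  shows False
proof (cases "\<forall>m n. Z 0 m n = \<one> \<longrightarrow> even m \<and> even n")
  case False
  then obtain m n where mn: "Z 0 m n = \<one>" "odd m \<or> odd n" by blast
  show False
  proof (cases "even m")
    case True
    then have "Z 0 0 1 = \<one>" using mn Z_cong2[of 0 0 m 0 n 1] by simp
    then have w: "cm a b = \<one>" by (simp add: word_cm_gens)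
    have gen: "x \<in> generate G {a, c, b}" if "x \<in> {a, b, c}" for x
      using that by (intro generate.incl) auto
    interpret n: class2_p_d_2 G a c b p r s by (rule change_gens) (use gen in auto)
    show False by (rule n.c_not_central) (use u w cm_eq_one_swap in simp_all)
  next
    case False
    then have "Z 0 m n = Z 0 1 n" by (intro Z_cong2) simp_all
    then have 1: "Z 0 1 n = \<one>" using mn by simp
    \<comment> \<open>Chosen so that [c', a] is the inverse of [c, a] [a, b]^n, which is trivial;
      \<open>c'\<close> still commutes with \<open>b\<close> and hence is central.\<close>
    define c' where "c' = W 0 n (- 1) 0 0 0"
    have c': "c' = b [^] n \<otimes> inv c" by (simp add: c'_def word_def int_pow_neg)
    have c'c: "c' \<in> carrier G" by (simp add: c'_def)
    have "c = inv c' \<otimes> b [^] n" by (simp add: c' inv_mult_group m_assoc)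
    moreover have "subgroup (generate G {a, b, c'}) G" by (rule generate_is_subgroup) (simp add: c'c)
    moreover have gen: "x \<in> generate G {a, b, c'}" if "x \<in> {a, b, c'}" for x
      using that by (rule generate.incl)
    ultimately have "c \<in> generate G {a, b, c'}"
      using subgroup.m_closed[of "generate G {a, b, c'}" G "inv c'" "b [^] n"]
        subgroup.m_inv_closed subgroup_int_pow_closed by (metis insertCI)
    then interpret n: class2_p_d_2 G a b c' p r s by (intro change_gens) (use gen c'c in auto)
    have "cm b c' = Z (- 1) 0 0"
      using word_cm[OF gens, of 0 1 0 0 0 0 0 n "- 1" 0 0 0] by (simp add: c'_def word_gens)
    then have "cm b c' = \<one>" using u by (simp add: word_def)
    moreover have "cm c' a = Z 0 (- 1) (- n)"
      using word_cm[OF gens, of 0 n "- 1" 0 0 0 1 0 0 0 0 0] by (simp add: c'_def word_gens)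
    then have "cm c' a = \<one>" using 1 word_inv[OF gens, of 0 0 0 0 1 n] by simp
    ultimately show False by (rule n.c_not_central)
  qed
next
  case True
  then have ker: "even m \<and> even n" if "Z 0 m n = \<one>" for m n using that by blast
  have Z0: "Z l m n = Z 0 m n" for l m n using u by (simp add: word_def)
  obtain m11 x1 y1 where "a [^] (2::nat) = Z m11 x1 y1" by (rule derived_W[OF square_derived[OF gens(1)]])
  then have a2: "a [^] (2::nat) = Z 0 x1 y1" using Z0 by simp
  obtain m21 x2 y2 where "b [^] (2::nat) = Z m21 x2 y2" by (rule derived_W[OF square_derived[OF gens(2)]])
  then have b2: "b [^] (2::nat) = Z 0 x2 y2" using Z0 by simp
  obtain m31 x3 y3 where "c [^] (2::nat) = Z m31 x3 y3" by (rule derived_W[OF square_derived[OF gens(3)]])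
  then have c2: "c [^] (2::nat) = Z 0 x3 y3" using Z0 by simp
  have Wsq: "W i j k 0 0 0 [^] (2::nat) = Z 0 (i * x1 + j * x2 + k * x3 + k * i) (i * y1 + j * y2 + k * y3 - j * i)"
    for i j k unfolding W_square[OF a2 b2 c2] by (rule Z0)
  have cen: "even i \<and> even j \<and> even k" if "central (W i j k l m n)" for i j k l m n
    using W_central_cm[OF that] ker[of k "- j"] ker[of 0 i] Z0[of "- k" 0 i] by simp
  have aniso: "even i \<and> even j \<and> even k"
    if "even (i * x1 + j * x2 + k * x3 + k * i)" "even (i * y1 + j * y2 + k * y3 - j * i)" for i j k
    by (rule cen[of _ _ _ 0 0 0], rule square_central) (use that in \<open>simp_all add: Wsq Z_even\<close>)
  \<comment> \<open>The parity conditions say that the images with exponents (1, 0, 1), (0, j, k),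
    (0, j', k') satisfy the power relations. The contradiction is that \<open>a\<close> and
    \<open>a c\<close> do not commute.\<close>
  have endo: False
    if "even (x1 + x3 + 1 - (x1 * k' - y1 * k))" "even (y1 + y3 - (y1 * j - x1 * j'))"
      "even (j * x2 + k * x3 - (x2 * k' - y2 * k))" "even (j * y2 + k * y3 - (y2 * j - x2 * j'))"
      "even (j' * x2 + k' * x3 - (x3 * k' - y3 * k))" "even (j' * y2 + k' * y3 - (y3 * j - x3 * j'))"
    for j k j' k'
  proof -
    define a1 b1 c1 where "a1 = W 1 0 1 0 0 0" and "b1 = W 0 j k 0 0 0" and "c1 = W 0 j' k' 0 0 0"
    have G: "a1 \<in> carrier G" "b1 \<in> carrier G" "c1 \<in> carrier G" by (simp_all add: a1_def b1_def c1_def)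
    have cms: "cm b1 c1 = Z 0 0 0" "cm c1 a1 = Z 0 k' (- j')" "cm a1 b1 = Z 0 (- k) j"
      using Z0[of "j * k' - k * j'" 0 0] Z0[of j' k' "- j'"] Z0[of "- j" "- k" j]
      by (simp_all add: a1_def b1_def c1_def word_cm)
    have word1: "word a1 b1 c1 0 0 0 l m n = Z 0 (m * k' - n * k) (n * j - m * j')" for l m n
      using G by (simp add: word_def[of a1 b1 c1] cms word_int_pow word_mult)
    have "cm (W 1 0 0 0 0 0) (word a1 b1 c1 1 0 0 0 0 0) = \<one>"
    proof (rule commute_of_relations[OF a2 b2 c2 _ G])
      show "int 2 dvd i \<and> int 2 dvd j \<and> int 2 dvd k" if "W i j k l m n = \<one>" for i j k l m n
        using cen[of i j k l m n] that by simp
      show "a1 [^] (2::nat) = word a1 b1 c1 0 0 0 0 x1 y1"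
        unfolding word1 unfolding a1_def Wsq by (rule Z_cong2) (use that in simp_all)
      show "b1 [^] (2::nat) = word a1 b1 c1 0 0 0 0 x2 y2"
        unfolding word1 unfolding b1_def Wsq by (rule Z_cong2) (use that in simp_all)
      show "c1 [^] (2::nat) = word a1 b1 c1 0 0 0 0 x3 y3"
        unfolding word1 unfolding c1_def Wsq by (rule Z_cong2) (use that in simp_all)
      show "word a1 b1 c1 0 0 0 l m n = \<one>" if "Z l m n = \<one>" for l m n
        unfolding word1 by (rule Z_even) (use ker[of m n] that Z0[of l m n] in simp_all)
    qed
    then have "cm (W 1 0 0 0 0 0) (W 1 0 1 0 0 0) = \<one>" using G by (simp add: word_gens a1_def)
    then show False using ker[of "- 1" 0] unfolding word_cm[OF gens] by simp
  qed
  \<comment> \<open>Only the parities of the six exponents matter. Whenever anisotropy on the seven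
    nonzero vectors holds, one of the three choices meets all conditions of
    \<open>endo\<close>.\<close>
  show False
    using aniso[of 0 0 1] aniso[of 0 1 0] aniso[of 0 1 1] aniso[of 1 0 0] aniso[of 1 0 1] aniso[of 1 1 0]
      aniso[of 1 1 1] endo[where j = 1 and k = 0 and j' = 0 and k' = 1]
      endo[where j = 0 and k = 1 and j' = 1 and k' = 0] endo[where j = 1 and k = 0 and j' = 1 and k' = 1]
    by auto
qed

text \<open>In rank 3 every bivector is decomposable: [b, c] [c, a]^m [a, b]^n is the single
  commutator of a^(-m) b and a^(-n) c, which can replace \<open>b\<close> and
  \<open>c\<close>.\<close>

lemma commutator_relation_false:
  assumes "Z l m n = \<one>" "odd l"
  shows False
proof -
  have "Z l m n = Z 1 m n" by (rule Z_cong2) (use assms in simp_all)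
  then have 1: "Z 1 m n = \<one>" using assms by simp
  define b' c' where "b' = W (- m) 1 0 0 0 0" and "c' = W (- n) 0 1 0 0 0"
  have b'c': "b' = a [^] (- m) \<otimes> b" "c' = a [^] (- n) \<otimes> c" by (simp_all add: b'_def c'_def word_def)
  have c: "b' \<in> carrier G" "c' \<in> carrier G" by (simp_all add: b'_def c'_def)
  have bc: "b = a [^] m \<otimes> b'" "c = a [^] n \<otimes> c'" by (simp_all add: b'c' int_pow_neg)
  interpret H: subgroup "generate G {a, b', c'}" G by (rule generate_is_subgroup) (simp add: c)
  have gen: "x \<in> generate G {a, b', c'}" if "x \<in> {a, b', c'}" for x
    using that by (rule generate.incl)
  have "a [^] m \<otimes> b' \<in> generate G {a, b', c'}" "a [^] n \<otimes> c' \<in> generate G {a, b', c'}"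
    using gen by (auto intro!: H.m_closed subgroup_int_pow_closed[OF H.subgroup_axioms])
  then interpret n: class2_p_d_2 G a b' c' p r s
    by (intro change_gens) (use gen c in \<open>auto simp: bc[symmetric]\<close>)
  have "cm b' c' = \<one>" using 1 by (simp add: b'_def c'_def word_cm)
  then show False by (rule n.b_c_dont_commute)
qed

text \<open>A relation with an odd exponent is rotated into the form of
  \<open>commutator_relation_false\<close>. Without one, the commutators are independent modulo 2
  and the finite list of matrices decides.\<close>

lemma contradiction: False
proof (cases "\<forall>l m n. Z l m n = \<one> \<longrightarrow> even l \<and> even m \<and> even n")
  case False
  then obtain l m n where lmn: "Z l m n = \<one>" "odd l \<or> odd m \<or> odd n" by blast
  have gen: "x \<in> generate G {b, c, a}" "x \<in> generate G {c, a, b}" if "x \<in> {a, b, c}" for x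
    using that by (intro generate.incl; auto)+
  interpret r1: class2_p_d_2 G b c a p r s by (rule change_gens) (use gen in auto)
  interpret r2: class2_p_d_2 G c a b p r s by (rule change_gens) (use gen in auto)
  have com: "x \<otimes> y = y \<otimes> x" if "central x" "central y" for x y
    using that central_comm central_closed by blast
  have Z: "Z l m n = cm b c [^] l \<otimes> (cm c a [^] m \<otimes> cm a b [^] n)" by (simp add: word_def)
  have "Z l m n = (cm c a [^] m \<otimes> cm a b [^] n) \<otimes> cm b c [^] l"
    unfolding Z by (rule com) simp_all
  then have r1: "r1.Z m n l = \<one>" using lmn by (simp add: word_def m_assoc)
  have "Z l m n = (cm b c [^] l \<otimes> cm c a [^] m) \<otimes> cm a b [^] n"
    unfolding Z by (simp add: m_assoc)
  also have "\<dots> = cm a b [^] n \<otimes> (cm b c [^] l \<otimes> cm c a [^] m)"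
    by (rule com) simp_all
  finally have r2: "r2.Z n l m = \<one>" using lmn by (simp add: word_def)
  show False
    using lmn(2) commutator_relation_false[OF lmn(1)] r1.commutator_relation_false[OF r1]
      r2.commutator_relation_false[OF r2] by blast
next
  case True
  then have ker: "even l \<and> even m \<and> even n" if "Z l m n = \<one>" for l m n using that by blast
  obtain m11 m12 m13 where a2: "a [^] (2::nat) = Z m11 m12 m13"
    by (rule derived_W[OF square_derived[OF gens(1)]])
  obtain m21 m22 m23 where b2: "b [^] (2::nat) = Z m21 m22 m23"
    by (rule derived_W[OF square_derived[OF gens(2)]])
  obtain m31 m32 m33 where c2: "c [^] (2::nat) = Z m31 m32 m33"
    by (rule derived_W[OF square_derived[OF gens(3)]])
  have cen: "even x \<and> even y \<and> even z" if "central (W x y z l m n)" for x y z l m n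
    using W_central_cm[OF that] ker[of 0 z "- y"] ker[of "- z" 0 x] by simp
  have aniso: "even x \<and> even y \<and> even z"
    if "even (x * m11 + y * m21 + z * m31 - z * y)" "even (x * m12 + y * m22 + z * m32 + z * x)"
      "even (x * m13 + y * m23 + z * m33 - y * x)" for x y z
    by (rule cen[of _ _ _ 0 0 0], rule square_central)
      (use that in \<open>simp_all add: W_square[OF a2 b2 c2] Z_even\<close>)
  obtain a11 a12 a13 a21 a22 a23 a31 a32 a33 where
    "endo_cond 2 1 m11 m12 m13 m21 m22 m23 m31 m32 m33 a11 a12 a13 a21 a22 a23 a31 a32 a33"
    and ns: "\<not> scalar_mod 2 a11 a12 a13 a21 a22 a23 a31 a32 a33"
    by (rule endo_cond_of_F2[OF aniso])
  then have cond: "endo_cond 2 C m11 m12 m13 m21 m22 m23 m31 m32 m33 a11 a12 a13 a21 a22 a23 a31 a32 a33"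
    by (simp only: p_r(4))
  have "scalar_mod 2 a11 a12 a13 a21 a22 a23 a31 a32 a33"
  proof (rule scalar_of_endo_cond[OF _ _ _ _ _ _ cond])
    show "a [^] (p ^ r) = Z m11 m12 m13" "b [^] (p ^ r) = Z m21 m22 m23" "c [^] (p ^ r) = Z m31 m32 m33"
      using a2 b2 c2 by (simp_all add: d_2)
    show "int (p ^ r) dvd i \<and> int (p ^ r) dvd j \<and> int (p ^ r) dvd k" if "W i j k l m n = \<one>" for i j k l m n
      using cen[of i j k l m n] that by (simp add: d_2)
    show "2 = int (p ^ e_exp)" unfolding p_r(3) by simp
  qed (rule ker)
  with ns show False by blast
qed

end

lemma (in p_three_generated_E) comm_group: "comm_group G"
proof -
  obtain r where r: "\<And>x. x \<in> carrier G \<Longrightarrow> x [^] (p ^ r) \<in> D"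
    "\<And>g. \<lbrakk>g \<in> carrier G; g [^] (p ^ r) = \<one>\<rbrakk> \<Longrightarrow> central g"
    using exponent_of_abelianization by blast
  interpret e: three_generated_engel2 G a b c ..
  have c2: "central (cm x y)" if "x \<in> carrier G" "y \<in> carrier G" for x y
    by (rule e.class_2[OF r that])
  show ?thesis
  proof (rule ccontr)
    assume "\<not> comm_group G"
    then have "cm b c \<noteq> \<one> \<or> cm c a \<noteq> \<one> \<or> cm a b \<noteq> \<one>" using comm_group_if_gens_commute by blast
    then interpret c: class2_p_three_generated_E G a b c p r s
      by unfold_locales (use c2 r prime p_power in auto)
    show False
    proof (cases "p ^ r = 2")
      case True
      then interpret d: class2_p_d_2 G a b c p r s by unfold_locales
      show False by (rule d.contradiction)
    next
      case False
      then interpret d: class2_p_not_2 G a b c p r s by unfold_locales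
      show False by (rule d.contradiction)
    qed
  qed
qed

theorem theorem1p1:
  fixes G (structure)
  assumes "E_group G"
    and "a \<in> carrier G" and "b \<in> carrier G" and "c \<in> carrier G"
    and "carrier G = generate G {a, b, c}"
  shows "comm_group G"
proof -
  interpret E_group G by fact
  interpret three_generated_E G a b c by unfold_locales fact+
  show ?thesis by (rule reduction_to_p_groups) (rule p_three_generated_E.comm_group)
qed

end
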